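(* Let $p=p(n)$ satisfy $d-\ln n\to\infty$ as $n\to\infty$, where $d=pn$. Then asymptotically almost surely $G_{n,p}$ is connected and non-bipartite, and \[\left|T_{mix}(G_{n,p})-\frac{\ln n}{\ln d}\right|\le 3.\]
   Context: $G_{n,p}$ is the random graph on $V_n=\{1,\dots,n\}$ in which each of the $\binom n2$ possible edges is present independently with probability $p$; throughout, $d=pn$. An event holds asymptotically almost surely (a.a.s.) if its probability tends to $1$ as $n\to\infty$. For a connected non-bipartite graph $G$ on $V_n$, the simple random walk has transition matrix $P$ with $P_{i,j}=1/d(i)$ if $ij\in E(G)$ and $0$ otherwise ($d(i)$ the degree of $i$); its stationary distribution is $\pi(i)=d(i)/(2|E(G)|)$. For distributions $p^{(1)},p^{(2)}$ on $V_n$, $d_{TV}(p^{(1)},p^{(2)})=\max_{A\subseteq V_n}|p^{(1)}(A)-p^{(2)}(A)|$. The mixing time is $T_{mix}(G)=\sup_{x_0}\min\{t: d_{TV}(x_0P^t,\pi)<1/e\}$, the supremum over initial distributions $x_0$. *)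

theory Defs
  imports "HOL-Probability.Probability"
begin

text \<open>Vertex set V_n = {1..n}; the potential edges are the 2-element subsets of V_n.
  A graph on V_n is represented by its edge indicator E :: nat set => bool.\<close>

definition vertices :: "nat \<Rightarrow> nat set" where
  "vertices n = {1..n}"

definition pot_edges :: "nat \<Rightarrow> nat set set" where
  "pot_edges n = {e. e \<subseteq> vertices n \<and> card e = 2}"

definition Gnp :: "nat \<Rightarrow> real \<Rightarrow> (nat set \<Rightarrow> bool) pmf" where
  "Gnp n p = Pi_pmf (pot_edges n) False (\<lambda>_. bernoulli_pmf p)"

definition adj :: "(nat set \<Rightarrow> bool) \<Rightarrow> nat \<Rightarrow> nat \<Rightarrow> bool" where
  "adj E i j \<longleftrightarrow> i \<noteq> j \<and> E {i, j}"

definition degree :: "nat \<Rightarrow> (nat set \<Rightarrow> bool) \<Rightarrow> nat \<Rightarrow> nat" where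
  "degree n E i = card {j \<in> vertices n. adj E i j}"

definition num_edges :: "nat \<Rightarrow> (nat set \<Rightarrow> bool) \<Rightarrow> nat" where
  "num_edges n E = card {e \<in> pot_edges n. E e}"

definition connected_graph :: "nat \<Rightarrow> (nat set \<Rightarrow> bool) \<Rightarrow> bool" where
  "connected_graph n E \<longleftrightarrow>
     (\<forall>i\<in>vertices n. \<forall>j\<in>vertices n.
        (\<lambda>x y. x \<in> vertices n \<and> y \<in> vertices n \<and> adj E x y)\<^sup>*\<^sup>* i j)"

definition bipartite_graph :: "nat \<Rightarrow> (nat set \<Rightarrow> bool) \<Rightarrow> bool" where
  "bipartite_graph n E \<longleftrightarrow>
     (\<exists>c :: nat \<Rightarrow> bool. \<forall>i\<in>vertices n. \<forall>j\<in>vertices n. adj E i j \<longrightarrow> c i \<noteq> c j)"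

definition trans :: "(nat set \<Rightarrow> bool) \<Rightarrow> nat \<Rightarrow> nat \<Rightarrow> nat \<Rightarrow> real" where
  "trans E n i j = (if adj E i j then 1 / real (degree n E i) else 0)"

definition stat :: "nat \<Rightarrow> (nat set \<Rightarrow> bool) \<Rightarrow> nat \<Rightarrow> real" where
  "stat n E i = real (degree n E i) / (2 * real (num_edges n E))"

definition is_dist :: "nat \<Rightarrow> (nat \<Rightarrow> real) \<Rightarrow> bool" where
  "is_dist n x \<longleftrightarrow> (\<forall>i. x i \<ge> 0) \<and> (\<forall>i. i \<notin> vertices n \<longrightarrow> x i = 0)
                    \<and> (\<Sum>i\<in>vertices n. x i) = 1"

definition step :: "nat \<Rightarrow> (nat set \<Rightarrow> bool) \<Rightarrow> (nat \<Rightarrow> real) \<Rightarrow> nat \<Rightarrow> real" where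
  "step n E x j = (\<Sum>i\<in>vertices n. x i * trans E n i j)"

definition walk :: "nat \<Rightarrow> (nat set \<Rightarrow> bool) \<Rightarrow> (nat \<Rightarrow> real) \<Rightarrow> nat \<Rightarrow> nat \<Rightarrow> real" where
  "walk n E x t = (step n E ^^ t) x"

definition dTV :: "nat \<Rightarrow> (nat \<Rightarrow> real) \<Rightarrow> (nat \<Rightarrow> real) \<Rightarrow> real" where
  "dTV n p1 p2 = Max ((\<lambda>A. \<bar>(\<Sum>i\<in>A. p1 i) - (\<Sum>i\<in>A. p2 i)\<bar>) ` Pow (vertices n))"

definition Tmix :: "nat \<Rightarrow> (nat set \<Rightarrow> bool) \<Rightarrow> real" where
  "Tmix n E = (SUP x\<in>{x. is_dist n x}.
       real (LEAST t. dTV n (walk n E x t) (stat n E) < 1 / exp 1))"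

end

theory Submission
  imports Defs "HOL-Real_Asymp.Real_Asymp"
begin

text \<open>
  A walk started at a vertex \<open>z\<close> of degree of order \<open>d\<close> is followed for about
  \<open>ln n / ln d - 5/4\<close> steps by exposing the neighbourhood of \<open>z\<close> one vertex at a time.
  Three exponential supermartingales show that, with probability \<open>1 - o(1/n)\<close>, almost all of the
  mass stays on non-backtracking tree-like paths, that its \<open>l^2\<close> norm decays like \<open>d^(-t)\<close>,
  and that only \<open>O(d^t)\<close> vertices have been seen.  Keeping the true degrees in the transition
  probabilities is essential: replacing them by worst-case bounds would cost a factor
  \<open>(1 + \<epsilon>)^t\<close>, which is unbounded because \<open>t\<close> is not bounded in terms of \<open>ln d\<close>.
  Three further steps use fresh edges and a lower-tail bound for truncated sums, and bring the mass
  to within a constant of the uniform distribution; there, degrees may be replaced by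
  \<open>21/20 d\<close>, since the few vertices of larger degree carry little mass.
  A vertex of small degree only has neighbours of large degree, at the price of one more step, and
  total variation distance does not increase with time.

  When \<open>n \<le> d^(5/2)\<close>, three steps suffice directly, by counting the edges between the
  neighbourhoods of each pair of vertices.  For the lower bound, the ball of radius \<open>t\<close>
  around a vertex has expected size at most \<open>(1 + d)^t\<close>.  Mixing at a common time with
  distance below \<open>1/2\<close> excludes both disconnected and bipartite graphs.
\<close>

subsection \<open>Independent edges\<close>

text \<open>The obstacle: \<open>d\<close> may exceed \<open>ln n\<close> only slightly, while a
  union bound over \<open>n\<close> starting vertices asks for failure probabilities like
  \<open>exp (- (3 * d))\<close>, a level at which single degrees are not concentrated. What is
  concentrated is the total mass. Stepping back to the parent costs a fraction of order
  \<open>1 / d\<close> per level, and since \<open>ln n \<le> d\<close> there are at most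
  \<open>d / ln d\<close> levels, so the cost is \<open>O(1 / ln d)\<close>; likewise
  \<open>(1 - 6 / d)^t\<close> stays at least 1/2. Let \<open>L = ln n / ln d\<close>. The
  exploration has depth \<open>t\<close>, the ceiling of \<open>L - 9/4\<close>. As
  \<open>t < L - 5/4\<close>, the ball and its neighbours number \<open>O(n * d^(-1/4))\<close>, and
  most vertices remain fresh. As \<open>t \<ge> L - 9/4\<close>, the squared norm is
  \<open>O(d^(9/4) / n)\<close>, which three steps, each gaining a power of \<open>d\<close>, bring
  near \<open>1 / n\<close>. With one step for starts of small degree the common time is below
  \<open>L + 11/4\<close>. Each truncation cap has to exceed the squared norm divided by
  \<open>d\<close>, and yet be bounded by a negative power of \<open>n\<close>, since Chernoff's
  bound is exponential in its inverse; \<open>n > d^(5/2)\<close> leaves room for both.\<close>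

definition bern :: "'e set \<Rightarrow> real \<Rightarrow> ('e \<Rightarrow> bool) pmf" where
  "bern A p = Pi_pmf A False (\<lambda>_. bernoulli_pmf p)"

abbreviation expect :: "'e set \<Rightarrow> real \<Rightarrow> (('e \<Rightarrow> bool) \<Rightarrow> real) \<Rightarrow> real" where
  "expect A p f \<equiv> measure_pmf.expectation (bern A p) f"

abbreviation Pr :: "'e set \<Rightarrow> real \<Rightarrow> (('e \<Rightarrow> bool) \<Rightarrow> bool) \<Rightarrow> real" where
  "Pr A p Q \<equiv> measure_pmf.prob (bern A p) {E. Q E}"

text \<open>Plays the part of measurability with respect to the coordinates in \<open>B\<close>;
  independence of two functions then reduces to disjointness of their edge sets.\<close>

definition on_edges :: "'e set \<Rightarrow> (('e \<Rightarrow> bool) \<Rightarrow> 'b) \<Rightarrow> bool" where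
  "on_edges B f \<longleftrightarrow> (\<forall>E E'. (\<forall>e\<in>B. E e = E' e) \<longrightarrow> f E = f E')"

lemma on_edgesI: "(\<And>E E'. (\<And>e. e \<in> B \<Longrightarrow> E e = E' e) \<Longrightarrow> f E = f E') \<Longrightarrow> on_edges B f"
  unfolding on_edges_def by blast

lemma on_edgesD: "on_edges B f \<Longrightarrow> (\<And>e. e \<in> B \<Longrightarrow> E e = E' e) \<Longrightarrow> f E = f E'"
  unfolding on_edges_def by blast

lemma on_edges_comp: "on_edges B f \<Longrightarrow> on_edges B (\<lambda>E. g (f E))"
  by (intro on_edgesI arg_cong[where f=g]) (erule on_edgesD, blast)

lemma on_edges_const: "on_edges B (\<lambda>_. c)"
  by (simp add: on_edges_def)

lemma finite_set_bern: "finite A \<Longrightarrow> finite (set_pmf (bern A p))"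
  unfolding bern_def
  by (subst set_Pi_pmf) (auto intro!: finite_PiE_dflt intro: finite_subset[OF subset_UNIV])

lemma integrable_bern [intro, simp]: "finite A \<Longrightarrow> integrable (measure_pmf (bern A p)) (f :: _ \<Rightarrow> real)"
  by (rule integrable_measure_pmf_finite[OF finite_set_bern])

lemma set_bern_outside: "finite A \<Longrightarrow> E \<in> set_pmf (bern A p) \<Longrightarrow> x \<notin> A \<Longrightarrow> E x = False"
  unfolding bern_def using set_Pi_pmf_subset[of A False "\<lambda>_. bernoulli_pmf p"] by fastforce

lemma expect_cong: "(\<And>E. E \<in> set_pmf (bern A p) \<Longrightarrow> f E = g E) \<Longrightarrow> expect A p f = expect A p g"
  by (intro integral_cong_AE) (auto simp: AE_measure_pmf_iff)

lemma expect_mono: "finite A \<Longrightarrow> (\<And>E. E \<in> set_pmf (bern A p) \<Longrightarrow> f E \<le> g E) \<Longrightarrow> expect A p f \<le> expect A p g"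
  by (intro integral_mono_AE) (auto simp: AE_measure_pmf_iff)

lemma expect_split:
  assumes "finite A" "B \<subseteq> A"
  shows "expect A p f = expect B p (\<lambda>E1. expect (A - B) p (\<lambda>E2. f (\<lambda>x. if x \<in> B then E1 x else E2 x)))"
proof -
  have fin: "finite B" "finite (A - B)" using assms finite_subset by auto
  have "bern A p = bern (B \<union> (A - B)) p" using assms by (simp add: Un_absorb1)
  also have "\<dots> = map_pmf (\<lambda>(f,g) x. if x \<in> B then f x else g x) (pair_pmf (bern B p) (bern (A - B) p))"
    unfolding bern_def by (rule Pi_pmf_union) (use fin in auto)
  finally have "expect A p f = measure_pmf.expectation (pair_pmf (bern B p) (bern (A - B) p))
        (\<lambda>z. f (\<lambda>x. if x \<in> B then fst z x else snd z x))"
    by (simp add: case_prod_unfold)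
  also have "\<dots> = (\<Sum>a\<in>set_pmf (bern B p). pmf (bern B p) a *\<^sub>R
     expect (A - B) p (\<lambda>E2. f (\<lambda>x. if x \<in> B then a x else E2 x)))"
    unfolding pair_pmf_def
    by (subst pmf_expectation_bind[OF finite_set_bern[OF fin(1)]])
       (auto simp: finite_set_bern fin map_pmf_def[symmetric])
  also have "\<dots> = expect B p (\<lambda>E1. expect (A - B) p (\<lambda>E2. f (\<lambda>x. if x \<in> B then E1 x else E2 x)))"
    by (subst integral_measure_pmf[OF finite_set_bern[OF fin(1)]]) auto
  finally show ?thesis .
qed

lemma expect_mult_split:
  assumes "finite A" "on_edges B f" "on_edges C g" "B \<inter> C = {}"
  shows "expect A p (\<lambda>E. f E * g E) = expect (B \<inter> A) p f * expect (A - B) p g"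
proof -
  let ?B = "B \<inter> A"
  have fin: "finite ?B" "finite (A - ?B)" using assms finite_subset by auto
  have eq: "A - ?B = A - B" by auto
  have "expect A p (\<lambda>E. f E * g E) = expect ?B p (\<lambda>E1. expect (A - ?B) p
     (\<lambda>E2. f (\<lambda>x. if x \<in> ?B then E1 x else E2 x) * g (\<lambda>x. if x \<in> ?B then E1 x else E2 x)))"
    by (rule expect_split) (use assms in auto)
  also have "\<dots> = expect ?B p (\<lambda>E1. expect (A - ?B) p (\<lambda>E2. f E1 * g E2))"
  proof (intro expect_cong)
    fix E1 E2 assume E: "E1 \<in> set_pmf (bern ?B p)" "E2 \<in> set_pmf (bern (A - ?B) p)"
    have "f (\<lambda>x. if x \<in> ?B then E1 x else E2 x) = f E1"
    proof (rule on_edgesD[OF assms(2)])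
      fix e assume "e \<in> B"
      \<comment> \<open>On the supports, an edge of \<open>B\<close> outside \<open>A\<close> takes
        the default \<open>False\<close> in both \<open>E1\<close> and \<open>E2\<close>.\<close>
      show "(if e \<in> ?B then E1 e else E2 e) = E1 e"
        using set_bern_outside[OF fin(1) E(1), of e] set_bern_outside[OF fin(2) E(2), of e] \<open>e \<in> B\<close> by auto
    qed
    moreover have "g (\<lambda>x. if x \<in> ?B then E1 x else E2 x) = g E2"
      by (rule on_edgesD[OF assms(3)]) (use assms(4) in auto)
    ultimately show "f (\<lambda>x. if x \<in> ?B then E1 x else E2 x) * g (\<lambda>x. if x \<in> ?B then E1 x else E2 x) = f E1 * g E2"
      by simp
  qed
  also have "\<dots> = expect (B \<inter> A) p f * expect (A - B) p g" by (simp add: eq)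
  finally show ?thesis .
qed

lemma expect_indep:
  assumes "finite A" "on_edges B f" "on_edges C g" "B \<inter> C = {}"
  shows "expect A p (\<lambda>E. f E * g E) = expect A p f * expect A p g"
proof -
  have "expect A p f = expect (B \<inter> A) p f"
    using expect_mult_split[OF assms(1,2) on_edges_const[of C 1] assms(4), of p] by simp
  moreover have "expect A p g = expect (A - B) p g"
    using expect_mult_split[OF assms(1) on_edges_const[of B 1] assms(3,4), of p] by simp
  ultimately show ?thesis
    unfolding expect_mult_split[OF assms, of p] by metis
qed

lemma expect_indicator: "expect A p (\<lambda>E. of_bool (Q E)) = Pr A p Q"
proof -
  have "(\<lambda>E. of_bool (Q E) :: real) = indicator {E. Q E}" by (auto simp: fun_eq_iff)
  thus ?thesis by simp
qed

text \<open>Conditioning on the value of \<open>h\<close>, done by hand: \<open>h\<close> takes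
  finitely many values on the support, and for each value \<open>c\<close> the event
  \<open>h E = c\<close> is independent of \<open>G c\<close>. The set \<open>C c\<close> of edges
  still to be read may depend on \<open>c\<close>, as an adaptive exploration requires.\<close>

lemma expect_two_stage:
  assumes fin: "finite A" and h: "on_edges B h"
    and G: "\<And>E. E \<in> set_pmf (bern A p) \<Longrightarrow> on_edges (C (h E)) (G (h E))"
    and disj: "\<And>E. E \<in> set_pmf (bern A p) \<Longrightarrow> B \<inter> C (h E) = {}"
  shows "expect A p (\<lambda>E. G (h E) E) = expect A p (\<lambda>E. expect A p (G (h E)))"
proof -
  let ?H = "h ` set_pmf (bern A p)"
  have fH: "finite ?H" using finite_set_bern[OF fin] by auto
  have "expect A p (\<lambda>E. G (h E) E) = expect A p (\<lambda>E. \<Sum>c\<in>?H. of_bool (h E = c) * G c E)"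
    by (intro expect_cong) (simp add: fH if_distrib sum.delta of_bool_def if_distribR cong: if_cong)
  also have "\<dots> = (\<Sum>c\<in>?H. expect A p (\<lambda>E. of_bool (h E = c) * G c E))"
    by (rule Bochner_Integration.integral_sum) (use fin in auto)
  also have "\<dots> = (\<Sum>c\<in>?H. expect A p (\<lambda>E. of_bool (h E = c)) * expect A p (G c))"
  proof (intro sum.cong refl)
    fix c assume "c \<in> ?H"
    then obtain E where E: "E \<in> set_pmf (bern A p)" "c = h E" by auto
    show "expect A p (\<lambda>E. of_bool (h E = c) * G c E) = expect A p (\<lambda>E. of_bool (h E = c)) * expect A p (G c)"
      by (rule expect_indep[OF fin, of B _ "C c"])
         (use G[OF E(1)] disj[OF E(1)] E in \<open>auto intro: on_edges_comp[OF h]\<close>)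
  qed
  also have "\<dots> = (\<Sum>c\<in>?H. expect A p (\<lambda>E. of_bool (h E = c) * expect A p (G c)))"
    by simp
  also have "\<dots> = expect A p (\<lambda>E. \<Sum>c\<in>?H. of_bool (h E = c) * expect A p (G c))"
    by (rule Bochner_Integration.integral_sum[symmetric]) (use fin in auto)
  also have "\<dots> = expect A p (\<lambda>E. expect A p (G (h E)))"
    by (intro expect_cong) (simp add: fH if_distrib sum.delta of_bool_def if_distribR cong: if_cong)
  finally show ?thesis .
qed

lemma Pr_two_stage_le:
  assumes fin: "finite A" and h: "on_edges B h"
    and Q: "\<And>E. E \<in> set_pmf (bern A p) \<Longrightarrow> on_edges (C (h E)) (Q (h E))"
    and disj: "\<And>E. E \<in> set_pmf (bern A p) \<Longrightarrow> B \<inter> C (h E) = {}"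
    and le: "\<And>E. E \<in> set_pmf (bern A p) \<Longrightarrow> Pr A p (Q (h E)) \<le> \<delta>"
  shows "Pr A p (\<lambda>E. Q (h E) E) \<le> \<delta>"
proof -
  have "Pr A p (\<lambda>E. Q (h E) E) = expect A p (\<lambda>E. of_bool (Q (h E) E))"
    by (simp only: expect_indicator)
  also have "\<dots> = expect A p (\<lambda>E. expect A p (\<lambda>E'. of_bool (Q (h E) E')))"
    by (rule expect_two_stage[OF fin h, where C=C and G="\<lambda>c E. of_bool (Q c E)"])
       (use Q disj in \<open>auto intro: on_edges_comp\<close>)
  also have "\<dots> \<le> expect A p (\<lambda>E. \<delta>)"
    by (intro expect_mono fin) (use le in \<open>simp add: expect_indicator\<close>)
  finally show ?thesis by simp
qed

lemma on_edges_prod: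
  assumes "\<And>w. w \<in> W \<Longrightarrow> on_edges (B w) (f w :: _ \<Rightarrow> real)"
  shows "on_edges (\<Union>w\<in>W. B w) (\<lambda>E. \<Prod>w\<in>W. f w E)"
proof (rule on_edgesI, rule prod.cong[OF refl])
  fix E E' :: "_ \<Rightarrow> bool" and w assume *: "\<And>e. e \<in> (\<Union>w\<in>W. B w) \<Longrightarrow> E e = E' e" "w \<in> W"
  show "f w E = f w E'" by (rule on_edgesD[OF assms[OF *(2)]]) (use * in auto)
qed

lemma expect_prod_indep:
  assumes fin: "finite A" "finite W" and f: "\<And>w. w \<in> W \<Longrightarrow> on_edges (B w) (f w :: _ \<Rightarrow> real)"
    and disj: "\<And>v w. v \<in> W \<Longrightarrow> w \<in> W \<Longrightarrow> v \<noteq> w \<Longrightarrow> B v \<inter> B w = {}"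
  shows "expect A p (\<lambda>E. \<Prod>w\<in>W. f w E) = (\<Prod>w\<in>W. expect A p (f w))"
  using fin(2) f disj
proof (induction W)
  case (insert w W)
  have d: "B w \<inter> (\<Union>v\<in>W. B v) = {}"
    using insert.prems(2)[of w] insert.hyps by blast
  have o: "on_edges (\<Union>v\<in>W. B v) (\<lambda>E. \<Prod>v\<in>W. f v E)"
    by (rule on_edges_prod) (use insert.prems in auto)
  have "expect A p (\<lambda>E. \<Prod>w\<in>insert w W. f w E) = expect A p (\<lambda>E. f w E * (\<Prod>w\<in>W. f w E))"
    using insert by simp
  also have "\<dots> = expect A p (f w) * expect A p (\<lambda>E. \<Prod>w\<in>W. f w E)"
    by (rule expect_indep[OF fin(1) _ o d]) (use insert.prems in auto)
  also have "expect A p (\<lambda>E. \<Prod>w\<in>W. f w E) = (\<Prod>w\<in>W. expect A p (f w))"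
    by (rule insert.IH) (use insert in auto)
  finally show ?case using insert by simp
qed simp

lemma expect_single:
  assumes "finite A" "e \<in> A" "0 \<le> p" "p \<le> 1"
  shows "expect A p (\<lambda>E. F (E e)) = p * F True + (1 - p) * F False"
proof -
  have "expect A p (\<lambda>E. F (E e)) = measure_pmf.expectation (map_pmf (\<lambda>E. E e) (bern A p)) F" by simp
  also have "map_pmf (\<lambda>E. E e) (bern A p) = bernoulli_pmf p"
    unfolding bern_def using assms by (simp add: Pi_pmf_component)
  finally show ?thesis using assms by (simp add: algebra_simps)
qed

lemma on_edges_single: "on_edges {e} (\<lambda>E. F (E e))"
  by (auto simp: on_edges_def)

text \<open>Compares each Bernoulli factor with a Poisson one through
  \<open>1 + x \<le> exp x\<close>. The coefficients may have either sign, so upper and lower tails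
  both come from here.\<close>

lemma expect_exp_linear:
  assumes "finite A" "B \<subseteq> A" "0 \<le> p" "p \<le> 1"
  shows "expect A p (\<lambda>E. exp (\<Sum>e\<in>B. c e * of_bool (E e))) \<le> exp (p * (\<Sum>e\<in>B. exp (c e) - 1))"
proof -
  have fB: "finite B" using assms finite_subset by auto
  have "expect A p (\<lambda>E. exp (\<Sum>e\<in>B. c e * of_bool (E e))) = expect A p (\<lambda>E. \<Prod>e\<in>B. exp (c e * of_bool (E e)))"
    by (simp only: exp_sum[OF fB])
  also have "\<dots> = (\<Prod>e\<in>B. expect A p (\<lambda>E. exp (c e * of_bool (E e))))"
    by (rule expect_prod_indep[OF assms(1) fB, where B="\<lambda>e. {e}"]) (auto simp: on_edges_def)
  also have "\<dots> = (\<Prod>e\<in>B. 1 + p * (exp (c e) - 1))"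
    using assms expect_single[OF assms(1) _ assms(3,4), of _ "\<lambda>b. exp (c _ * of_bool b)"]
    by (intro prod.cong refl) (subst expect_single, auto simp: algebra_simps)
  also have "\<dots> \<le> (\<Prod>e\<in>B. exp (p * (exp (c e) - 1)))"
  proof (intro prod_mono conjI)
    fix e
    have "p * 1 \<le> 1" using assms by simp
    moreover have "0 \<le> p * exp (c e)" using assms by simp
    ultimately show "0 \<le> 1 + p * (exp (c e) - 1)" by (simp add: algebra_simps)
    show "1 + p * (exp (c e) - 1) \<le> exp (p * (exp (c e) - 1))" by (rule exp_ge_add_one_self)
  qed
  also have "\<dots> = exp (p * (\<Sum>e\<in>B. exp (c e) - 1))"
    by (simp add: exp_sum fB sum_distrib_left)
  finally show ?thesis .
qed

lemma expect_linear:
  assumes "finite A" "B \<subseteq> A" "0 \<le> p" "p \<le> 1"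
  shows "expect A p (\<lambda>E. \<Sum>e\<in>B. c e * of_bool (E e)) = p * (\<Sum>e\<in>B. c e)"
proof -
  have "expect A p (\<lambda>E. \<Sum>e\<in>B. c e * of_bool (E e)) = (\<Sum>e\<in>B. expect A p (\<lambda>E. c e * of_bool (E e)))"
    by (rule Bochner_Integration.integral_sum) (use assms in auto)
  also have "\<dots> = (\<Sum>e\<in>B. c e * p)"
    by (intro sum.cong refl, subst expect_single) (use assms in auto)
  finally show ?thesis by (simp add: sum_distrib_left mult.commute)
qed

lemma expect_variance:
  assumes "finite A" "B \<subseteq> A" "0 \<le> p" "p \<le> 1"
  shows "expect A p (\<lambda>E. ((\<Sum>e\<in>B. c e * of_bool (E e)) - p * (\<Sum>e\<in>B. c e))\<^sup>2) \<le> p * (\<Sum>e\<in>B. (c e)\<^sup>2)"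
proof -
  have fB: "finite B" using assms finite_subset by auto
  let ?X = "\<lambda>E e. of_bool (E e) - p"
  have "((\<Sum>e\<in>B. c e * of_bool (E e)) - p * (\<Sum>e\<in>B. c e))\<^sup>2
     = (\<Sum>e\<in>B. \<Sum>f\<in>B. c e * c f * (?X E e * ?X E f))" for E
  proof -
    have "(\<Sum>e\<in>B. c e * of_bool (E e)) - p * (\<Sum>e\<in>B. c e) = (\<Sum>e\<in>B. c e * ?X E e)"
      by (simp add: algebra_simps sum_subtractf sum_distrib_left)
    thus ?thesis by (simp add: power2_eq_square sum_product algebra_simps)
  qed
  hence "expect A p (\<lambda>E. ((\<Sum>e\<in>B. c e * of_bool (E e)) - p * (\<Sum>e\<in>B. c e))\<^sup>2)
     = (\<Sum>e\<in>B. \<Sum>f\<in>B. c e * c f * expect A p (\<lambda>E. ?X E e * ?X E f))"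
    using assms(1) by (simp add: Bochner_Integration.integral_sum)
  also have "\<dots> = (\<Sum>e\<in>B. \<Sum>f\<in>B. if f = e then (c e)\<^sup>2 * (p * (1 - p)) else 0)"
  proof (intro sum.cong refl)
    fix e f assume ef: "e \<in> B" "f \<in> B"
    show "c e * c f * expect A p (\<lambda>E. ?X E e * ?X E f) = (if f = e then (c e)\<^sup>2 * (p * (1 - p)) else 0)"
    proof (cases "f = e")
      case True
      have "expect A p (\<lambda>E. ?X E e * ?X E e) = p * (1 - p)"
        using ef assms by (subst expect_single[where F="\<lambda>b. (of_bool b - p) * (of_bool b - p)"]) (auto simp: algebra_simps)
      thus ?thesis using True by (simp add: power2_eq_square)
    next
      case False
      have "expect A p (\<lambda>E. ?X E e * ?X E f) = expect A p (\<lambda>E. ?X E e) * expect A p (\<lambda>E. ?X E f)"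
        by (rule expect_indep[OF assms(1), of "{e}" _ "{f}"]) (use False in \<open>auto simp: on_edges_def\<close>)
      also have "expect A p (\<lambda>E. ?X E e) = 0"
        using ef assms by (subst expect_single[where F="\<lambda>b. (of_bool b - p)"]) (auto simp: algebra_simps)
      finally show ?thesis using False by simp
    qed
  qed
  also have "\<dots> = (\<Sum>e\<in>B. (c e)\<^sup>2 * (p * (1 - p)))" by (simp add: fB)
  also have "\<dots> = p * (1 - p) * (\<Sum>e\<in>B. (c e)\<^sup>2)" by (simp add: sum_distrib_left mult.commute)
  also have "\<dots> \<le> p * 1 * (\<Sum>e\<in>B. (c e)\<^sup>2)"
    using assms by (intro mult_right_mono mult_left_mono sum_nonneg) auto
  finally show ?thesis by simp
qed

lemma Pr_le_expect:
  assumes "finite A" "\<And>E. E \<in> set_pmf (bern A p) \<Longrightarrow> of_bool (Q E) \<le> f E"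
  shows "Pr A p Q \<le> expect A p f"
  unfolding expect_indicator[symmetric] by (intro expect_mono assms)

lemma Pr_mono:
  assumes "\<And>E. E \<in> set_pmf (bern A p) \<Longrightarrow> Q E \<Longrightarrow> R E"
  shows "Pr A p Q \<le> Pr A p R"
  by (rule measure_pmf.finite_measure_mono_AE) (use assms in \<open>auto simp: AE_measure_pmf_iff\<close>)

lemma Pr_disj: "Pr A p (\<lambda>E. Q E \<or> R E) \<le> Pr A p Q + Pr A p R"
  unfolding Collect_disj_eq by (rule measure_subadditive) (auto simp: measure_pmf.emeasure_eq_measure)

lemma Pr_bex:
  assumes "finite I"
  shows "Pr A p (\<lambda>E. \<exists>i\<in>I. Q i E) \<le> (\<Sum>i\<in>I. Pr A p (Q i))"
proof -
  have "{E. \<exists>i\<in>I. Q i E} = (\<Union>i\<in>I. {E. Q i E})" by auto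
  thus ?thesis using measure_pmf.finite_measure_subadditive_finite[of I "\<lambda>i. {E. Q i E}" "bern A p"] assms by simp
qed

lemma Gnp_bern: "Gnp n p = bern (pot_edges n) p"
  by (simp add: Gnp_def bern_def)

subsection \<open>Random walk and total variation distance\<close>

definition dirac :: "nat \<Rightarrow> nat \<Rightarrow> real" where
  "dirac i j = (if j = i then 1 else 0)"

definition no_isolated :: "nat \<Rightarrow> (nat set \<Rightarrow> bool) \<Rightarrow> bool" where
  "no_isolated n E \<longleftrightarrow> (\<forall>i\<in>vertices n. degree n E i > 0)"

lemma finite_vertices [simp]: "finite (vertices n)"
  by (simp add: vertices_def)

lemma card_vertices [simp]: "card (vertices n) = n"
  by (simp add: vertices_def)

lemma finite_pot_edges [simp]: "finite (pot_edges n)"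
  unfolding pot_edges_def by (rule finite_subset[of _ "Pow (vertices n)"]) auto

lemma adj_sym: "adj E i j \<longleftrightarrow> adj E j i"
  by (auto simp: adj_def insert_commute)

lemma pair_in_pot_edges: "i \<in> vertices n \<Longrightarrow> j \<in> vertices n \<Longrightarrow> i \<noteq> j \<Longrightarrow> {i, j} \<in> pot_edges n"
  by (auto simp: pot_edges_def)

lemma real_degree: "real (degree n E i) = (\<Sum>j\<in>vertices n. of_bool (adj E i j))"
proof -
  have "(\<Sum>j\<in>vertices n. of_bool (adj E i j)) = (\<Sum>j\<in>{j\<in>vertices n. adj E i j}. 1 :: real)"
    by (rule sum.mono_neutral_cong_right) auto
  thus ?thesis by (simp add: degree_def)
qed

text \<open>Both sides count ordered adjacent pairs; each present edge comes from exactly two of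
  them.\<close>

lemma handshake: "(\<Sum>i\<in>vertices n. degree n E i) = 2 * num_edges n E"
proof -
  let ?F = "{e \<in> pot_edges n. E e}"
  have fF: "finite ?F" by simp
  have eq: "(SIGMA i:vertices n. {j \<in> vertices n. adj E i j}) = (\<Union>e\<in>?F. {(i, j). {i, j} = e})"
  proof (intro equalityI subsetI)
    fix x assume "x \<in> (SIGMA i:vertices n. {j \<in> vertices n. adj E i j})"
    thus "x \<in> (\<Union>e\<in>?F. {(i, j). {i, j} = e})"
      by (auto simp: adj_def pair_in_pot_edges)
  next
    fix x assume "x \<in> (\<Union>e\<in>?F. {(i, j). {i, j} = e})"
    then obtain i j where x: "x = (i, j)" "{i, j} \<in> pot_edges n" "E {i, j}" by auto
    moreover have "i \<noteq> j" using x(2) by (auto simp: pot_edges_def)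
    ultimately show "x \<in> (SIGMA i:vertices n. {j \<in> vertices n. adj E i j})"
      by (auto simp: adj_def pot_edges_def)
  qed
  have c2: "card {(i, j). {i, j} = e} = 2 \<and> finite {(i, j). {i, j} = e}" if e: "e \<in> ?F" for e
  proof -
    obtain a b where ab: "e = {a, b}" "a \<noteq> b"
      using e by (auto simp: pot_edges_def card_2_iff)
    have "{(i, j). {i, j} = e} = {(a, b), (b, a)}"
      using ab by (auto simp: doubleton_eq_iff)
    thus ?thesis using ab by simp
  qed
  have "(\<Sum>i\<in>vertices n. degree n E i) = card (SIGMA i:vertices n. {j \<in> vertices n. adj E i j})"
    by (simp add: degree_def)
  also have "\<dots> = (\<Sum>e\<in>?F. card {(i, j). {i, j} = e})"
    unfolding eq by (rule card_UN_disjoint) (use c2 in auto)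
  also have "\<dots> = (\<Sum>e\<in>?F. 2)" using c2 by (intro sum.cong) auto
  finally show ?thesis by (simp add: num_edges_def mult.commute)
qed

lemma trans_nonneg: "trans E n i j \<ge> 0"
  by (simp add: trans_def)

lemma trans_row_sum:
  assumes "degree n E i > 0"
  shows "(\<Sum>j\<in>vertices n. trans E n i j) = 1"
proof -
  have "(\<Sum>j\<in>vertices n. trans E n i j) = (\<Sum>j\<in>vertices n. of_bool (adj E i j) * (1 / real (degree n E i)))"
    by (intro sum.cong) (auto simp: trans_def)
  also have "\<dots> = 1"
    using assms by (simp only: sum_distrib_right[symmetric] real_degree[symmetric]) auto
  finally show ?thesis .
qed

lemma walk_0 [simp]: "walk n E x 0 = x"
  by (simp add: walk_def)

lemma walk_Suc: "walk n E x (Suc t) = step n E (walk n E x t)"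
  by (simp add: walk_def)

lemma walk_nonneg:
  assumes "\<And>i. x i \<ge> 0" shows "walk n E x t j \<ge> 0"
proof (induction t arbitrary: j)
  case (Suc t)
  show ?case by (simp add: walk_Suc step_def sum_nonneg Suc.IH trans_nonneg)
qed (use assms in auto)

lemma walk_mass:
  assumes "no_isolated n E"
  shows "(\<Sum>j\<in>vertices n. walk n E x t j) = (\<Sum>j\<in>vertices n. x j)"
proof (induction t)
  case (Suc t)
  have "(\<Sum>j\<in>vertices n. walk n E x (Suc t) j) =
      (\<Sum>i\<in>vertices n. \<Sum>j\<in>vertices n. walk n E x t i * trans E n i j)"
    unfolding walk_Suc step_def by (rule sum.swap)
  also have "\<dots> = (\<Sum>i\<in>vertices n. walk n E x t i)"
    using assms by (intro sum.cong refl)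
       (simp add: sum_distrib_left[symmetric] trans_row_sum no_isolated_def)
  finally show ?case using Suc by simp
qed simp

lemma dirac_sum: "finite A \<Longrightarrow> (\<Sum>i\<in>A. x i * dirac i j) = (if j \<in> A then x j else 0)"
  by (simp add: dirac_def if_distrib sum.delta' cong: if_cong)

text \<open>Linearity in the start: it reduces the supremum over initial distributions in
  \<open>Tmix\<close> to starts at a single vertex.\<close>

lemma walk_dirac_mix:
  assumes "\<And>i. i \<notin> vertices n \<Longrightarrow> x i = 0"
  shows "walk n E x t j = (\<Sum>i\<in>vertices n. x i * walk n E (dirac i) t j)"
proof (induction t arbitrary: j)
  case 0
  show ?case using assms by (simp add: dirac_sum)
next
  case (Suc t)
  have "walk n E x (Suc t) j = (\<Sum>k\<in>vertices n. (\<Sum>i\<in>vertices n. x i * walk n E (dirac i) t k) * trans E n k j)"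
    by (simp add: walk_Suc step_def Suc.IH)
  also have "\<dots> = (\<Sum>i\<in>vertices n. \<Sum>k\<in>vertices n. x i * walk n E (dirac i) t k * trans E n k j)"
    by (subst sum.swap) (simp add: sum_distrib_right)
  also have "\<dots> = (\<Sum>i\<in>vertices n. x i * walk n E (dirac i) (Suc t) j)"
    by (simp add: walk_Suc step_def sum_distrib_left mult.assoc)
  finally show ?case .
qed

lemma dirac_walk_sum:
  assumes "no_isolated n E" "i \<in> vertices n"
  shows "(\<Sum>j\<in>vertices n. walk n E (dirac i) t j) = 1"
  using assms by (simp add: walk_mass dirac_def)

lemma walk_dirac_nonneg: "walk n E (dirac i) t j \<ge> 0"
  by (rule walk_nonneg) (simp add: dirac_def)

lemma stat_nonneg: "stat n E i \<ge> 0"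
  by (simp add: stat_def)

lemma stat_sum:
  assumes "no_isolated n E" "n \<ge> 1"
  shows "(\<Sum>i\<in>vertices n. stat n E i) = 1"
proof -
  have 1: "real (\<Sum>i\<in>vertices n. degree n E i) = 2 * real (num_edges n E)"
    by (simp add: handshake del: of_nat_sum)
  have "1 \<in> vertices n" using assms by (simp add: vertices_def)
  hence "0 < (\<Sum>i\<in>vertices n. degree n E i)"
    using assms by (intro sum_pos2[of _ 1]) (auto simp: no_isolated_def)
  hence "num_edges n E > 0" by (simp add: handshake)
  thus ?thesis using 1 by (simp add: stat_def sum_divide_distrib[symmetric])
qed

lemma dTV_ge: "A \<subseteq> vertices n \<Longrightarrow> \<bar>(\<Sum>i\<in>A. p i) - (\<Sum>i\<in>A. q i)\<bar> \<le> dTV n p q"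
  unfolding dTV_def by (rule Max_ge) auto

lemma dTV_leI:
  assumes "\<And>A. A \<subseteq> vertices n \<Longrightarrow> \<bar>(\<Sum>i\<in>A. p i) - (\<Sum>i\<in>A. q i)\<bar> \<le> c"
  shows "dTV n p q \<le> c"
  unfolding dTV_def by (rule Max.boundedI) (use assms in auto)

text \<open>\<open>p - min p q\<close> and \<open>q - min p q\<close> are nonnegative with the same
  total, one minus the overlap, so on every \<open>A\<close> their difference stays within it.
  Mixing thus only needs a lower bound for the walk, and only up to the height of the stationary
  distribution.\<close>

lemma dTV_overlap:
  assumes "(\<Sum>i\<in>vertices n. p i) = 1" "(\<Sum>i\<in>vertices n. q i) = 1"
  shows "dTV n p q \<le> 1 - (\<Sum>i\<in>vertices n. min (p i) (q i))"
proof (rule dTV_leI)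
  fix A assume A: "A \<subseteq> vertices n"
  let ?V = "vertices n" and ?m = "\<lambda>i. min (p i) (q i)"
  have "(\<Sum>i\<in>A. p i - ?m i) \<le> (\<Sum>i\<in>?V. p i - ?m i)" "(\<Sum>i\<in>A. q i - ?m i) \<le> (\<Sum>i\<in>?V. q i - ?m i)"
    by (rule sum_mono2; use A in auto)+
  moreover have "0 \<le> (\<Sum>i\<in>A. p i - ?m i)" "0 \<le> (\<Sum>i\<in>A. q i - ?m i)"
    by (auto intro!: sum_nonneg)
  ultimately show "\<bar>(\<Sum>i\<in>A. p i) - (\<Sum>i\<in>A. q i)\<bar> \<le> 1 - (\<Sum>i\<in>?V. ?m i)"
    using assms by (simp add: sum_subtractf abs_le_iff)
qed

lemma dTV_mix:
  assumes x: "is_dist n x" and q: "\<And>i. i \<in> vertices n \<Longrightarrow> dTV n (r i) q \<le> c"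
  shows "dTV n (\<lambda>j. \<Sum>i\<in>vertices n. x i * r i j) q \<le> c"
proof (rule dTV_leI)
  fix A assume A: "A \<subseteq> vertices n"
  let ?V = "vertices n"
  have x1: "(\<Sum>i\<in>?V. x i) = 1" and x0: "\<And>i. x i \<ge> 0" using x by (auto simp: is_dist_def)
  have "(\<Sum>j\<in>A. \<Sum>i\<in>?V. x i * r i j) - (\<Sum>j\<in>A. q j) = (\<Sum>i\<in>?V. x i * ((\<Sum>j\<in>A. r i j) - (\<Sum>j\<in>A. q j)))"
    by (subst sum.swap) (simp add: sum_distrib_left[symmetric] right_diff_distrib sum_subtractf
         sum_distrib_right[symmetric] x1)
  hence "\<bar>(\<Sum>j\<in>A. \<Sum>i\<in>?V. x i * r i j) - (\<Sum>j\<in>A. q j)\<bar> \<le> (\<Sum>i\<in>?V. \<bar>x i * ((\<Sum>j\<in>A. r i j) - (\<Sum>j\<in>A. q j))\<bar>)"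
    by simp
  also have "\<dots> \<le> (\<Sum>i\<in>?V. x i * c)"
  proof (rule sum_mono)
    fix i assume i: "i \<in> ?V"
    have "\<bar>(\<Sum>j\<in>A. r i j) - (\<Sum>j\<in>A. q j)\<bar> \<le> c" using dTV_ge[OF A] q[OF i] order_trans by blast
    thus "\<bar>x i * ((\<Sum>j\<in>A. r i j) - (\<Sum>j\<in>A. q j))\<bar> \<le> x i * c"
      using x0[of i] by (simp add: abs_mult mult_left_mono)
  qed
  also have "\<dots> = c" by (simp add: sum_distrib_right[symmetric] x1)
  finally show "\<bar>(\<Sum>j\<in>A. \<Sum>i\<in>?V. x i * r i j) - (\<Sum>j\<in>A. q j)\<bar> \<le> c" .
qed

lemma dirac_dist: "i \<in> vertices n \<Longrightarrow> is_dist n (dirac i)"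
  by (auto simp: is_dist_def dirac_def)

text \<open>\<open>D\<close> depends on time so that one lemma covers a component (constant), a
  bipartition (alternating) and a ball (growing).\<close>

lemma walk_support:
  assumes "i \<in> D 0" "\<And>t x y. x \<in> D t \<Longrightarrow> x \<in> vertices n \<Longrightarrow> adj E x y \<Longrightarrow> y \<in> D (Suc t)"
  shows "j \<notin> D t \<Longrightarrow> walk n E (dirac i) t j = 0"
proof (induction t arbitrary: j)
  case 0
  thus ?case using assms(1) by (auto simp: dirac_def)
next
  case (Suc t)
  have "walk n E (dirac i) t x * trans E n x j = 0" if "x \<in> vertices n" for x
    using Suc.IH[of x] assms(2)[of x t j] that Suc.prems by (auto simp: trans_def)
  thus ?case unfolding walk_Suc step_def by (intro sum.neutral ballI)
qed

lemma dTV_support: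
  assumes "no_isolated n E" "i \<in> vertices n"
    and "i \<in> D 0" "\<And>t x y. x \<in> D t \<Longrightarrow> x \<in> vertices n \<Longrightarrow> adj E x y \<Longrightarrow> y \<in> D (Suc t)"
  shows "dTV n (walk n E (dirac i) t) (stat n E) \<ge> 1 - (\<Sum>j\<in>D t \<inter> vertices n. stat n E j)"
proof -
  have "(\<Sum>j\<in>D t \<inter> vertices n. walk n E (dirac i) t j) = (\<Sum>j\<in>vertices n. walk n E (dirac i) t j)"
  proof (rule sum.mono_neutral_left)
    show "\<forall>j\<in>vertices n - D t \<inter> vertices n. walk n E (dirac i) t j = 0"
      by (auto intro!: walk_support[of i D n E _ t] assms(3,4))
  qed auto
  hence "(\<Sum>j\<in>D t \<inter> vertices n. walk n E (dirac i) t j) = 1"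
    using dirac_walk_sum[OF assms(1,2)] by simp
  thus ?thesis using dTV_ge[of "D t \<inter> vertices n" n "walk n E (dirac i) t" "stat n E"] by simp
qed

lemma inverse_e_le_half: "1 / exp 1 \<le> (1/2 :: real)"
  using exp_ge_add_one_self[of 1] by (simp add: field_simps)

text \<open>A component and its complement have stationary masses adding up to 1. Walks started on
  either side never leave it, so their distances from \<open>stat\<close> add up to at least 1,
  although both are below 1/2.\<close>

lemma mixing_imp_connected:
  assumes iso: "no_isolated n E" "n \<ge> 1"
    and mix: "\<And>i. i \<in> vertices n \<Longrightarrow> dTV n (walk n E (dirac i) T) (stat n E) < 1 / exp 1"
  shows "connected_graph n E"
proof (rule ccontr)
  let ?V = "vertices n"
  let ?R = "\<lambda>x y. x \<in> ?V \<and> y \<in> ?V \<and> adj E x y"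
  assume "\<not> connected_graph n E"
  then obtain i j where ij: "i \<in> ?V" "j \<in> ?V" "\<not> ?R\<^sup>*\<^sup>* i j"
    unfolding connected_graph_def by blast
  \<comment> \<open>Non-vertices are added because \<open>adj\<close> does not confine
    \<open>y\<close> to the vertex set in the closure condition of
    \<open>dTV_support\<close>.\<close>
  define C where "C = {k. ?R\<^sup>*\<^sup>* i k \<or> k \<notin> ?V}"
  have split: "(\<Sum>k\<in>C \<inter> ?V. stat n E k) + (\<Sum>k\<in>-C \<inter> ?V. stat n E k) = 1"
    unfolding stat_sum[OF iso, symmetric] by (subst sum.union_disjoint[symmetric]) (auto intro: sum.cong)
  have 1: "1 - (\<Sum>k\<in>C \<inter> ?V. stat n E k) \<le> dTV n (walk n E (dirac i) T) (stat n E)"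
    by (rule dTV_support[OF iso(1) ij(1), of "\<lambda>_. C"])
       (auto simp: C_def intro: rtranclp.rtrancl_into_rtrancl)
  have 2: "1 - (\<Sum>k\<in>(-C \<union> -?V) \<inter> ?V. stat n E k) \<le> dTV n (walk n E (dirac j) T) (stat n E)"
  proof (rule dTV_support[OF iso(1) ij(2), of "\<lambda>_. -C \<union> -?V"])
    show "j \<in> - C \<union> - ?V" using ij by (auto simp: C_def)
    fix x y assume "x \<in> - C \<union> - ?V" "x \<in> ?V" "adj E x y"
    moreover have "?R\<^sup>*\<^sup>* i x" if "?R\<^sup>*\<^sup>* i y" "y \<in> ?V"
      by (rule rtranclp.rtrancl_into_rtrancl[OF that(1)])
         (use that \<open>x \<in> ?V\<close> \<open>adj E x y\<close> in \<open>simp add: adj_sym\<close>)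
    ultimately show "y \<in> - C \<union> - ?V" unfolding C_def by blast
  qed
  have "(-C \<union> -?V) \<inter> ?V = -C \<inter> ?V" by auto
  thus False using 1 2 split mix[OF ij(1)] mix[OF ij(2)] inverse_e_le_half by simp
qed

lemma mixing_imp_nonbipartite:
  assumes iso: "no_isolated n E" "n \<ge> 1"
    and mix: "\<And>i. i \<in> vertices n \<Longrightarrow> dTV n (walk n E (dirac i) T) (stat n E) < 1 / exp 1"
  shows "\<not> bipartite_graph n E"
proof
  let ?V = "vertices n"
  assume "bipartite_graph n E"
  then obtain c where c: "\<And>i j. i \<in> ?V \<Longrightarrow> j \<in> ?V \<Longrightarrow> adj E i j \<Longrightarrow> c i \<noteq> (c j :: bool)"
    unfolding bipartite_graph_def by blast
  let ?K = "\<lambda>b. {k. c k = b \<or> k \<notin> ?V}"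
  have un: "?K True \<inter> ?V \<union> ?K False \<inter> ?V = ?V" by auto
  have split: "(\<Sum>k\<in>?K True \<inter> ?V. stat n E k) + (\<Sum>k\<in>?K False \<inter> ?V. stat n E k) = 1"
    by (subst sum.union_disjoint[symmetric]) (auto simp only: un stat_sum[OF iso] finite_Int finite_vertices)
  have "\<exists>b. (\<Sum>k\<in>?K b \<inter> ?V. stat n E k) \<le> 1/2"
  proof (cases "(\<Sum>k\<in>?K True \<inter> ?V. stat n E k) \<le> 1/2")
    case False
    hence "(\<Sum>k\<in>?K False \<inter> ?V. stat n E k) \<le> 1/2" using split by linarith
    thus ?thesis by blast
  qed blast
  then obtain b where b: "(\<Sum>k\<in>?K b \<inter> ?V. stat n E k) \<le> 1/2" by blast
  have "1 \<in> ?V" using iso by (simp add: vertices_def)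
  hence "{j \<in> ?V. adj E 1 j} \<noteq> {}"
    using iso by (fastforce simp: no_isolated_def degree_def card_gt_0_iff)
  then obtain v where v: "v \<in> ?V" "c v \<noteq> c 1" using c \<open>1 \<in> ?V\<close> by blast
  \<comment> \<open>The parity of \<open>T\<close> decides the colour of the start, so that at time
    \<open>T\<close> the walk sits in the class \<open>b\<close> of stationary mass at most
    1/2.\<close>
  obtain i where i: "i \<in> ?V" "c i = (b = even T)"
    using v \<open>1 \<in> ?V\<close> by (cases "c 1 = (b = even T)") auto
  have "1 - (\<Sum>k\<in>?K ((b = even T) = even T) \<inter> ?V. stat n E k) \<le> dTV n (walk n E (dirac i) T) (stat n E)"
  proof (rule dTV_support[OF iso(1) i(1), of "\<lambda>t. ?K ((b = even T) = even t)"])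
    show "i \<in> ?K ((b = even T) = even (0::nat))" using i by simp
    fix t :: nat and x y assume "x \<in> ?K ((b = even T) = even t)" "x \<in> ?V" "adj E x y"
    thus "y \<in> ?K ((b = even T) = even (Suc t))" using c[of x y] by auto
  qed
  moreover have "((b = even T) = even T) = b" by auto
  ultimately show False using b mix[OF i(1)] inverse_e_le_half by simp
qed

lemma Tmix_window:
  assumes iso: "no_isolated n E" "n \<ge> 1"
    and mix: "\<And>i. i \<in> vertices n \<Longrightarrow> dTV n (walk n E (dirac i) T) (stat n E) < 1 / exp 1"
    and T: "real T \<le> L + 3"
    and low: "\<And>t. real t < L - 3 \<Longrightarrow> dTV n (walk n E (dirac 1) t) (stat n E) \<ge> 1 / exp 1"
  shows "\<bar>Tmix n E - L\<bar> \<le> 3"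
proof -
  let ?V = "vertices n"
  let ?P = "\<lambda>x t. dTV n (walk n E x t) (stat n E) < 1 / exp 1"
  let ?X = "{x. is_dist n x}"
  have V1: "1 \<in> ?V" using iso by (simp add: vertices_def)
  \<comment> \<open>A maximum over finitely many vertices keeps the inequality strict when starts
    are averaged.\<close>
  define c where "c = Max ((\<lambda>i. dTV n (walk n E (dirac i) T) (stat n E)) ` ?V)"
  have c: "c < 1 / exp 1" unfolding c_def using V1 mix by (subst Max_less_iff) auto
  have PT: "?P x T" if x: "x \<in> ?X" for x
  proof -
    have "walk n E x T = (\<lambda>j. \<Sum>i\<in>?V. x i * walk n E (dirac i) T j)"
      by (rule ext, rule walk_dirac_mix) (use x in \<open>auto simp: is_dist_def\<close>)
    moreover have "dTV n (\<lambda>j. \<Sum>i\<in>?V. x i * walk n E (dirac i) T j) (stat n E) \<le> c"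
      by (rule dTV_mix) (use x in \<open>auto simp: c_def\<close>)
    ultimately show ?thesis using c by simp
  qed
  have le: "real (LEAST t. ?P x t) \<le> real T" if "x \<in> ?X" for x
    using Least_le[of "?P x" T, OF PT[OF that]] by simp
  have d1: "dirac 1 \<in> ?X" using dirac_dist[OF V1] by simp
  have "Tmix n E \<le> real T"
    unfolding Tmix_def by (rule cSUP_least) (use d1 le in auto)
  moreover have "real (LEAST t. ?P (dirac 1) t) \<le> Tmix n E"
    unfolding Tmix_def by (rule cSUP_upper[OF d1], rule bdd_aboveI2[of _ _ "real T"], rule le)
  moreover have "real (LEAST t. ?P (dirac 1) t) \<ge> L - 3"
    using LeastI[of "?P (dirac 1)", OF PT[OF d1]] low by (meson linorder_not_le)
  ultimately show ?thesis using T by (simp add: abs_le_iff)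
qed

subsection \<open>Lower tails of truncated sums\<close>

definition star :: "nat \<Rightarrow> nat set \<Rightarrow> nat set set" where
  "star v S = (\<lambda>u. {v, u}) ` S"

lemma star_subset: "v \<in> vertices n \<Longrightarrow> S \<subseteq> vertices n \<Longrightarrow> v \<notin> S \<Longrightarrow> star v S \<subseteq> pot_edges n"
  by (auto simp: star_def intro!: pair_in_pot_edges)

lemma inj_star: "v \<notin> S \<Longrightarrow> inj_on (\<lambda>u. {v, u}) S"
  by (auto simp: inj_on_def doubleton_eq_iff)

text \<open>\<open>the_inv_into\<close> recovers the far endpoint of an edge; it turns coefficients
  on vertices into coefficients on edges, the form in which the bounds for independent edges are
  stated.\<close>

lemma star_sum:
  assumes "v \<notin> S"
  shows "(\<Sum>u\<in>S. c u * of_bool (adj E v u)) = (\<Sum>e\<in>star v S. c (the_inv_into S (\<lambda>u. {v, u}) e) * of_bool (E e))"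
  unfolding star_def using assms
  by (subst sum.reindex[OF inj_star[OF assms]]) (auto intro!: sum.cong simp: adj_def the_inv_into_f_f[OF inj_star[OF assms]])

lemma star_sum':
  assumes "v \<notin> S"
  shows "(\<Sum>e\<in>star v S. f (c (the_inv_into S (\<lambda>u. {v, u}) e))) = (\<Sum>u\<in>S. f (c u))"
  unfolding star_def using assms
  by (subst sum.reindex[OF inj_star[OF assms]]) (auto intro!: sum.cong simp: the_inv_into_f_f[OF inj_star[OF assms]])

context
  fixes n :: nat and p :: real and v S
  assumes p: "0 \<le> p" "p \<le> 1" and vS: "v \<in> vertices n" "S \<subseteq> vertices n" "v \<notin> S"
begin

lemma expect_exp_star:
  "expect (pot_edges n) p (\<lambda>E. exp (\<Sum>u\<in>S. c u * of_bool (adj E v u))) \<le> exp (p * (\<Sum>u\<in>S. exp (c u) - 1))"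
  unfolding star_sum[OF vS(3)] star_sum'[OF vS(3), where f="\<lambda>x. exp x - 1", symmetric]
  by (rule expect_exp_linear[OF finite_pot_edges star_subset[OF vS] p])

lemma expect_star:
  "expect (pot_edges n) p (\<lambda>E. \<Sum>u\<in>S. c u * of_bool (adj E v u)) = p * (\<Sum>u\<in>S. c u)"
  unfolding star_sum[OF vS(3)] star_sum'[OF vS(3), where f="\<lambda>x. x", symmetric]
  by (rule expect_linear[OF finite_pot_edges star_subset[OF vS] p])

lemma expect_variance_star:
  "expect (pot_edges n) p (\<lambda>E. ((\<Sum>u\<in>S. c u * of_bool (adj E v u)) - p * (\<Sum>u\<in>S. c u))\<^sup>2) \<le> p * (\<Sum>u\<in>S. (c u)\<^sup>2)"
  unfolding star_sum[OF vS(3)] star_sum'[OF vS(3), where f="\<lambda>x. x", symmetric]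
     star_sum'[OF vS(3), where f="\<lambda>x. x^2", symmetric]
  by (rule expect_variance[OF finite_pot_edges star_subset[OF vS] p])

end

lemma on_edges_star_sum:
  "on_edges (star v S) (\<lambda>E. \<Sum>u\<in>S. c u * of_bool (adj E v u) :: real)"
proof (rule on_edgesI, rule sum.cong[OF refl])
  fix E E' :: "nat set \<Rightarrow> bool" and u
  assume *: "\<And>e. e \<in> star v S \<Longrightarrow> E e = E' e" "u \<in> S"
  have "E {v, u} = E' {v, u}" using * by (simp add: star_def)
  thus "c u * of_bool (adj E v u) = c u * (of_bool (adj E' v u) :: real)" by (simp add: adj_def)
qed

lemma exp_minus_le_quadratic:
  fixes u :: real
  assumes "u \<ge> 0" shows "exp (- u) \<le> 1 - u + u\<^sup>2 / 2"
proof -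
  have q: "1 + u + u\<^sup>2 / 2 \<le> exp u" by (rule exp_lower_Taylor_quadratic[OF assms])
  have pos: "0 < 1 + u + u\<^sup>2 / 2" using assms by (simp add: add_pos_nonneg)
  have "exp (-u) = 1 / exp u" by (simp add: exp_minus inverse_eq_divide)
  also have "\<dots> \<le> 1 / (1 + u + u\<^sup>2 / 2)" using q pos by (simp add: frac_le)
  also have "\<dots> \<le> 1 - u + u\<^sup>2 / 2"
  proof -
    have "(1 - u + u\<^sup>2 / 2) * (1 + u + u\<^sup>2 / 2) = 1 + u^4 / 4"
      by (simp add: algebra_simps power2_eq_square power4_eq_xxxx)
    hence "1 \<le> (1 - u + u\<^sup>2 / 2) * (1 + u + u\<^sup>2 / 2)" by simp
    thus ?thesis using pos by (simp add: pos_divide_le_eq)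
  qed
  finally show ?thesis .
qed

text \<open>Chernoff's bound for many terms below a small \<open>C\<close>: since
  \<open>Y^2 \<le> C * Y\<close> and the means sum to at most 1, the second-order term is at most
  \<open>l^2 * C / 2\<close>, and a deviation of constant size has probability exponentially small
  in \<open>1 / C\<close>.\<close>

lemma lower_tail:
  assumes fin: "finite A" "finite W" and f: "\<And>w. w \<in> W \<Longrightarrow> on_edges (B w) (Y w :: _ \<Rightarrow> real)"
    and disj: "\<And>v w. v \<in> W \<Longrightarrow> w \<in> W \<Longrightarrow> v \<noteq> w \<Longrightarrow> B v \<inter> B w = {}"
    and Y: "\<And>w E. w \<in> W \<Longrightarrow> 0 \<le> Y w E" "\<And>w E. w \<in> W \<Longrightarrow> Y w E \<le> C" and C: "C > 0"
    and m: "(\<Sum>w\<in>W. expect A p (Y w)) \<le> 1" and x: "x \<ge> 0"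
    and k: "k \<le> (\<Sum>w\<in>W. expect A p (Y w)) - x"
  shows "Pr A p (\<lambda>E. (\<Sum>w\<in>W. Y w E) < k) \<le> exp (- (x\<^sup>2 / (2 * C)))"
proof -
  \<comment> \<open>Minimises \<open>- l * x + l^2 * C / 2\<close>.\<close>
  define l where "l = x / C"
  define M where "M = (\<Sum>w\<in>W. expect A p (Y w))"
  have l: "l \<ge> 0" using x C by (simp add: l_def)
  have "Pr A p (\<lambda>E. (\<Sum>w\<in>W. Y w E) < k) \<le> expect A p (\<lambda>E. exp (l * (M - x)) * (\<Prod>w\<in>W. exp (- (l * Y w E))))"
  proof (rule Pr_le_expect[OF fin(1)])
    fix E
    have "exp (l * (M - x)) * (\<Prod>w\<in>W. exp (- (l * Y w E))) = exp (l * (M - x - (\<Sum>w\<in>W. Y w E)))"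
      by (simp add: exp_sum[OF fin(2), symmetric] sum_negf sum_distrib_left[symmetric] exp_add[symmetric] algebra_simps)
    moreover have "1 \<le> exp (l * (M - x - (\<Sum>w\<in>W. Y w E)))" if "(\<Sum>w\<in>W. Y w E) < k"
      using l k that by (auto simp: M_def)
    ultimately show "of_bool ((\<Sum>w\<in>W. Y w E) < k) \<le> exp (l * (M - x)) * (\<Prod>w\<in>W. exp (- (l * Y w E)))"
      by auto
  qed
  also have "\<dots> = exp (l * (M - x)) * (\<Prod>w\<in>W. expect A p (\<lambda>E. exp (- (l * Y w E))))"
    by (subst expect_prod_indep[OF fin, where B=B and f="\<lambda>w E. exp (- (l * Y w E))", symmetric])
       (auto intro: on_edges_comp[OF f] dest: disj)
  also have "\<dots> \<le> exp (l * (M - x)) * (\<Prod>w\<in>W. exp (- l * expect A p (Y w) + l\<^sup>2 * C / 2 * expect A p (Y w)))"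
  proof (intro mult_left_mono prod_mono conjI)
    fix w assume w: "w \<in> W"
    show "0 \<le> expect A p (\<lambda>E. exp (- (l * Y w E)))" by (rule Bochner_Integration.integral_nonneg) simp
    have "expect A p (\<lambda>E. exp (- (l * Y w E))) \<le> expect A p (\<lambda>E. 1 + (- l + l\<^sup>2 * C / 2) * Y w E)"
    proof (rule expect_mono[OF fin(1)])
      fix E
      have "exp (- (l * Y w E)) \<le> 1 - l * Y w E + (l * Y w E)\<^sup>2 / 2"
        by (rule exp_minus_le_quadratic) (use l Y w in auto)
      also have "(l * Y w E)\<^sup>2 \<le> l\<^sup>2 * (C * Y w E)"
        unfolding power_mult_distrib power2_eq_square[of "Y w E"]
        using Y[OF w, of E] by (intro mult_left_mono mult_right_mono) auto
      finally show "exp (- (l * Y w E)) \<le> 1 + (- l + l\<^sup>2 * C / 2) * Y w E" by (simp add: algebra_simps)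
    qed
    also have "\<dots> = 1 + (- l + l\<^sup>2 * C / 2) * expect A p (Y w)" using fin by simp
    also have "\<dots> \<le> exp ((- l + l\<^sup>2 * C / 2) * expect A p (Y w))" by (rule exp_ge_add_one_self)
    finally show "expect A p (\<lambda>E. exp (- (l * Y w E))) \<le> exp (- l * expect A p (Y w) + l\<^sup>2 * C / 2 * expect A p (Y w))"
      by (simp add: algebra_simps)
  qed auto
  also have "\<dots> = exp (l * (M - x) + (- l * M + l\<^sup>2 * C / 2 * M))"
    unfolding exp_sum[OF fin(2), symmetric] sum.distrib sum_distrib_left[symmetric] M_def[symmetric]
      exp_add[symmetric] ..
  also have "\<dots> \<le> exp (- (l * x) + l\<^sup>2 * C / 2)"
    using mult_right_mono[OF m, of "l\<^sup>2"] C by (simp add: algebra_simps M_def[symmetric])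
  also have "- (l * x) + l\<^sup>2 * C / 2 = - (x\<^sup>2 / (2 * C))"
    using C by (simp add: l_def power2_eq_square field_simps)
  finally show ?thesis .
qed

text \<open>The parabola \<open>(z - \<mu>)^2 / (4 * g)\<close> touches the line
  \<open>z - \<mu> - g\<close> at \<open>z = \<mu> + 2 * g\<close>. In expectation it turns the mass
  lost by truncation into variance divided by \<open>4 * g\<close>.\<close>

lemma min_ge_quadratic:
  fixes z c \<mu> g :: real
  assumes "g > 0" "\<mu> + g \<le> c"
  shows "z - (z - \<mu>)\<^sup>2 / (4 * g) \<le> min z c"
proof -
  have "z - c \<le> (z - \<mu>)\<^sup>2 / (4 * g)"
  proof -
    have "0 \<le> (z - \<mu> - 2 * g)\<^sup>2" by simp
    hence "4 * g * (z - \<mu> - g) \<le> (z - \<mu>)\<^sup>2" by (simp add: power2_eq_square algebra_simps)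
    hence "z - \<mu> - g \<le> (z - \<mu>)\<^sup>2 / (4 * g)" using assms by (simp add: field_simps)
    thus ?thesis using assms by linarith
  qed
  moreover have "0 \<le> (z - \<mu>)\<^sup>2 / (4 * g)" using assms by simp
  ultimately show ?thesis by (simp add: min_def)
qed

text \<open>One step of a walk from \<open>S\<close> to fresh vertices.  Truncating the arriving mass at
  \<open>c w\<close> costs a fraction of its variance (by the AM-GM inequality above) but makes Chernoff's
  bound available.\<close>

lemma spread:
  fixes b :: "nat \<Rightarrow> real" and c :: "nat \<Rightarrow> real"
  assumes p: "0 \<le> p" "p \<le> 1" and W: "W \<subseteq> vertices n"
    and S: "\<And>w. w \<in> W \<Longrightarrow> S w \<subseteq> vertices n" "\<And>w. w \<in> W \<Longrightarrow> w \<notin> S w"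
    and disj: "\<And>v w. v \<in> W \<Longrightarrow> w \<in> W \<Longrightarrow> v \<noteq> w \<Longrightarrow> \<not> (v \<in> S w \<and> w \<in> S v)"
    and b: "\<And>u. b u \<ge> 0" and V: "\<And>w. w \<in> W \<Longrightarrow> (\<Sum>u\<in>S w. (b u)\<^sup>2) \<le> V"
    and g: "g > 0" "\<And>w. w \<in> W \<Longrightarrow> p * (\<Sum>u\<in>S w. b u) + g \<le> c w"
    and C: "\<And>w. w \<in> W \<Longrightarrow> c w \<le> C" "C > 0" and m: "(\<Sum>w\<in>W. p * (\<Sum>u\<in>S w. b u)) \<le> 1" and x: "x \<ge> 0"
    and k: "k \<le> (\<Sum>w\<in>W. p * (\<Sum>u\<in>S w. b u)) - real (card W) * (p * V / (4 * g)) - x"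
  shows "Pr (pot_edges n) p (\<lambda>E. (\<Sum>w\<in>W. min (\<Sum>u\<in>S w. b u * of_bool (adj E w u)) (c w)) < k)
     \<le> exp (- (x\<^sup>2 / (2 * C)))"
proof -
  let ?A = "pot_edges n"
  let ?Z = "\<lambda>w E. \<Sum>u\<in>S w. b u * of_bool (adj E w u)"
  let ?Y = "\<lambda>w E. min (?Z w E) (c w)"
  have fW: "finite W" using W finite_subset finite_vertices by metis
  have mu: "p * (\<Sum>u\<in>S w. b u) - p * V / (4 * g) \<le> expect ?A p (?Y w)"
       "expect ?A p (?Y w) \<le> p * (\<Sum>u\<in>S w. b u)" if w: "w \<in> W" for w
  proof -
    note vS = p subsetD[OF W w] S(1)[OF w] S(2)[OF w]
    let ?mu = "p * (\<Sum>u\<in>S w. b u)"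
    have "?mu - p * V / (4 * g) \<le> ?mu - expect ?A p (\<lambda>E. (?Z w E - ?mu)\<^sup>2) / (4 * g)"
      using order_trans[OF expect_variance_star[OF vS] mult_left_mono[OF V[OF w] p(1)]] g(1)
      by (simp add: divide_right_mono)
    also have "\<dots> = expect ?A p (?Z w) - expect ?A p (\<lambda>E. (?Z w E - ?mu)\<^sup>2 / (4 * g))"
      by (subst expect_star[OF vS]) simp
    also have "\<dots> = expect ?A p (\<lambda>E. ?Z w E - (?Z w E - ?mu)\<^sup>2 / (4 * g))"
      by (rule Bochner_Integration.integral_diff[symmetric]) auto
    also have "\<dots> \<le> expect ?A p (?Y w)"
      by (intro expect_mono finite_pot_edges min_ge_quadratic g(1) g(2)[OF w])
    finally show "?mu - p * V / (4 * g) \<le> expect ?A p (?Y w)" .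
    have "expect ?A p (?Y w) \<le> expect ?A p (?Z w)" by (intro expect_mono finite_pot_edges) simp
    thus "expect ?A p (?Y w) \<le> ?mu" unfolding expect_star[OF vS] .
  qed
  show ?thesis
  proof (rule lower_tail[OF finite_pot_edges fW, where B="\<lambda>w. star w (S w)"])
    fix w assume w: "w \<in> W"
    show "on_edges (star w (S w)) (?Y w)"
      by (rule on_edges_comp[OF on_edges_star_sum, where g="\<lambda>z. min z (c w)"])
    have "0 \<le> p * (\<Sum>u\<in>S w. b u)" using p b by (simp add: sum_nonneg)
    hence "0 \<le> c w" using g w by force
    thus "0 \<le> ?Y w E" for E using b by (simp add: sum_nonneg)
    show "?Y w E \<le> C" for E using C w by (simp add: min.coboundedI2)
  next
    fix v w assume vw: "v \<in> W" "w \<in> W" "v \<noteq> w"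
    \<comment> \<open>Stars with different centres can share only the edge joining the centres, and
      only if each centre lies in the set of the other.\<close>
    show "star v (S v) \<inter> star w (S w) = {}"
      using disj[OF vw] vw(3) by (auto simp: star_def doubleton_eq_iff)
  next
    show "(\<Sum>w\<in>W. expect ?A p (?Y w)) \<le> 1"
      using m sum_mono[of W "\<lambda>w. expect ?A p (?Y w)" "\<lambda>w. p * (\<Sum>u\<in>S w. b u)"] mu by force
    show "k \<le> (\<Sum>w\<in>W. expect ?A p (?Y w)) - x"
      using k sum_mono[of W "\<lambda>w. p * (\<Sum>u\<in>S w. b u) - p * V / (4 * g)" "\<lambda>w. expect ?A p (?Y w)"] mu
      by (force simp: sum_subtractf)
  qed (use C x in auto)
qed

subsection \<open>Exploration of a neighbourhood\<close>

text \<open>\<open>PP\<close> are the processed vertices, whose edges have all been revealed; \<open>RR\<close> the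
  discovered ones; \<open>TT\<close> those discovered vertices that still carry mass \<open>wt\<close>, at distance
  \<open>lev\<close> from the start along their unique path.  A vertex that is hit a second time leaves
  \<open>TT\<close> and its mass is lost; hence every vertex of \<open>TT\<close> has exactly one processed neighbour
  and its degree is known when its turn comes.\<close>

record st =
  PP :: "nat set"
  RR :: "nat set"
  TT :: "nat set"
  wt :: "nat \<Rightarrow> real"
  lev :: "nat \<Rightarrow> nat"

definition edges_off :: "nat set \<Rightarrow> nat set set" where
  "edges_off P = {e. e \<inter> P = {}}"

text \<open>The exploration stops at level \<open>t1\<close>, or when more than \<open>Rm\<close> vertices are
  discovered; \<open>l1\<close> is the rate of the exponential moment that controls the lost mass.\<close>

locale exploration =
  fixes n t1 :: nat and p d Rm l1 :: real
  assumes p: "0 \<le> p" "p \<le> 1" and d: "d = p * real n" "16 \<le> d"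
    and Rm: "Rm * d \<le> real n" "0 \<le> Rm" and l1: "0 \<le> l1" and t1: "1 \<le> t1"
begin

definition cur :: "st \<Rightarrow> nat" where
  "cur \<sigma> = Min {u \<in> TT \<sigma>. lev \<sigma> u < t1}"

definition active :: "st \<Rightarrow> bool" where
  "active \<sigma> \<longleftrightarrow> (\<exists>u\<in>TT \<sigma>. lev \<sigma> u < t1) \<and> real (card (RR \<sigma>)) \<le> Rm"

text \<open>\<open>N\<close> is the set of unprocessed neighbours of \<open>u\<close>, so
  \<open>1 + card N\<close> is its degree, the 1 standing for the parent. If fewer than
  \<open>d / 2\<close> of them are new, the mass is given up altogether; this makes the bound on
  \<open>wt\<close> in \<open>valid\<close> hold without exception.\<close>

definition upd :: "st \<Rightarrow> nat \<Rightarrow> nat set \<Rightarrow> st" where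
  "upd \<sigma> u N = \<lparr>PP = insert u (PP \<sigma>), RR = RR \<sigma> \<union> N,
     TT = (TT \<sigma> - {u} - N) \<union> (if d / 2 \<le> real (card (N - RR \<sigma>)) then N - RR \<sigma> else {}),
     wt = (\<lambda>v. if v \<in> N - RR \<sigma> then wt \<sigma> u / (1 + real (card N)) else wt \<sigma> v),
     lev = (\<lambda>v. if v \<in> N - RR \<sigma> then Suc (lev \<sigma> u) else lev \<sigma> v)\<rparr>"

definition nb :: "st \<Rightarrow> nat \<Rightarrow> (nat set \<Rightarrow> bool) \<Rightarrow> nat set" where
  "nb \<sigma> u E = {v \<in> vertices n - PP \<sigma> - {u}. adj E u v}"

definition nxt :: "st \<Rightarrow> (nat set \<Rightarrow> bool) \<Rightarrow> st" where
  "nxt \<sigma> E = upd \<sigma> (cur \<sigma>) (nb \<sigma> (cur \<sigma>) E)"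

fun run :: "nat \<Rightarrow> st \<Rightarrow> (nat set \<Rightarrow> bool) \<Rightarrow> st" where
  "run 0 \<sigma> E = \<sigma>"
| "run (Suc k) \<sigma> E = (if active \<sigma> then run k (nxt \<sigma> E) E else \<sigma>)"

text \<open>The weight bound starts from \<open>1 / card N \<le> 100 / d\<close> at level 1, and
  each generation divides by at least \<open>d / 2\<close>. The relation to the actual graph is kept
  separately, in \<open>walk_inv\<close>.\<close>

definition valid :: "st \<Rightarrow> bool" where
  "valid \<sigma> \<longleftrightarrow> PP \<sigma> \<subseteq> RR \<sigma> \<and> RR \<sigma> \<subseteq> vertices n \<and> TT \<sigma> \<subseteq> RR \<sigma> - PP \<sigma>
     \<and> (\<forall>v\<in>TT \<sigma>. 1 \<le> lev \<sigma> v \<and> lev \<sigma> v \<le> t1 \<and> 0 \<le> wt \<sigma> v \<and> wt \<sigma> v \<le> 50 * (2 / d) ^ lev \<sigma> v)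
     \<and> (\<Sum>v\<in>TT \<sigma>. wt \<sigma> v) \<le> 1"

lemma dpos: "d > 0" "p > 0" "n > 0"
proof -
  show "d > 0" using d(2) by simp
  hence "p * real n \<noteq> 0" using d(1) by linarith
  hence "p \<noteq> 0" "n \<noteq> 0" by auto
  thus "p > 0" "n > 0" using p(1) by simp_all
qed

lemma finite_sub: "A \<subseteq> vertices n \<Longrightarrow> finite A"
  by (rule finite_subset[OF _ finite_vertices])

lemma validD:
  assumes "valid \<sigma>"
  shows "PP \<sigma> \<subseteq> RR \<sigma>" "RR \<sigma> \<subseteq> vertices n" "TT \<sigma> \<subseteq> RR \<sigma>" "TT \<sigma> \<inter> PP \<sigma> = {}"
    "finite (TT \<sigma>)" "finite (RR \<sigma>)" "finite (PP \<sigma>)"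
    "\<And>v. v \<in> TT \<sigma> \<Longrightarrow> 1 \<le> lev \<sigma> v" "\<And>v. v \<in> TT \<sigma> \<Longrightarrow> lev \<sigma> v \<le> t1"
    "\<And>v. v \<in> TT \<sigma> \<Longrightarrow> 0 \<le> wt \<sigma> v" "\<And>v. v \<in> TT \<sigma> \<Longrightarrow> wt \<sigma> v \<le> 50 * (2 / d) ^ lev \<sigma> v"
    "(\<Sum>v\<in>TT \<sigma>. wt \<sigma> v) \<le> 1"
proof -
  show "finite (TT \<sigma>)" "finite (RR \<sigma>)" "finite (PP \<sigma>)"
    by (rule finite_sub; use assms in \<open>force simp: valid_def\<close>)+
qed (use assms in \<open>auto simp: valid_def\<close>)

lemma wt_le_A:
  assumes "valid \<sigma>" "v \<in> TT \<sigma>" shows "wt \<sigma> v \<le> 100 / d"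
proof -
  have "(2 / d) ^ lev \<sigma> v \<le> (2 / d) ^ 1"
    using validD(8)[OF assms] d by (intro power_decreasing) (auto simp: field_simps)
  thus ?thesis using validD(11)[OF assms] by simp
qed

lemma cur_in:
  assumes "valid \<sigma>" "active \<sigma>"
  shows "cur \<sigma> \<in> TT \<sigma>" "lev \<sigma> (cur \<sigma>) < t1"
proof -
  have "cur \<sigma> \<in> {u \<in> TT \<sigma>. lev \<sigma> u < t1}"
    unfolding cur_def using assms validD(5)[OF assms(1)] by (intro Min_in) (auto simp: active_def)
  thus "cur \<sigma> \<in> TT \<sigma>" "lev \<sigma> (cur \<sigma>) < t1" by auto
qed

text \<open>Balance equation for an arbitrary additive functional of weights and levels:
  \<open>u\<close> and the hit vertices leave, the new vertices enter. It is applied alike to mass,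
  squared mass, offspring counts and remaining levels.\<close>

lemma TT_sum:
  fixes \<phi> :: "real \<Rightarrow> nat \<Rightarrow> real"
  assumes "valid \<sigma>" "u \<in> TT \<sigma>" "finite N" "u \<notin> N"
  shows "(\<Sum>v\<in>TT (upd \<sigma> u N). \<phi> (wt (upd \<sigma> u N) v) (lev (upd \<sigma> u N) v))
    = (\<Sum>v\<in>TT \<sigma>. \<phi> (wt \<sigma> v) (lev \<sigma> v)) - \<phi> (wt \<sigma> u) (lev \<sigma> u) - (\<Sum>v\<in>TT \<sigma> \<inter> N. \<phi> (wt \<sigma> v) (lev \<sigma> v))
     + (if d / 2 \<le> real (card (N - RR \<sigma>)) then real (card (N - RR \<sigma>)) * \<phi> (wt \<sigma> u / (1 + real (card N))) (Suc (lev \<sigma> u)) else 0)"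
    (is "?L = ?S - _ - ?I + ?B")
proof -
  note v = validD[OF assms(1)]
  let ?f = "\<lambda>v. \<phi> (wt (upd \<sigma> u N) v) (lev (upd \<sigma> u N) v)"
  let ?C = "if d / 2 \<le> real (card (N - RR \<sigma>)) then N - RR \<sigma> else {}"
  have "?L = sum ?f (TT \<sigma> - {u} - N) + sum ?f ?C"
    unfolding upd_def by (simp, subst sum.union_disjoint) (use v assms in auto)
  also have "sum ?f (TT \<sigma> - {u} - N) = (\<Sum>v\<in>TT \<sigma> - {u} - N. \<phi> (wt \<sigma> v) (lev \<sigma> v))"
    by (rule sum.cong) (use v(3) in \<open>auto simp: upd_def\<close>)
  also have "sum ?f ?C = ?B" by (auto simp: upd_def)
  finally have 1: "?L = (\<Sum>v\<in>TT \<sigma> - {u} - N. \<phi> (wt \<sigma> v) (lev \<sigma> v)) + ?B" .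
  have "?S = (\<Sum>v\<in>TT \<sigma> - {u} - N. \<phi> (wt \<sigma> v) (lev \<sigma> v)) + (\<Sum>v\<in>insert u (TT \<sigma> \<inter> N). \<phi> (wt \<sigma> v) (lev \<sigma> v))"
  proof (subst sum.union_disjoint[symmetric])
    have "TT \<sigma> = TT \<sigma> - {u} - N \<union> insert u (TT \<sigma> \<inter> N)" using assms(2) by blast
    thus "?S = (\<Sum>v\<in>TT \<sigma> - {u} - N \<union> insert u (TT \<sigma> \<inter> N). \<phi> (wt \<sigma> v) (lev \<sigma> v))" by simp
  qed (use v in auto)
  also have "(\<Sum>v\<in>insert u (TT \<sigma> \<inter> N). \<phi> (wt \<sigma> v) (lev \<sigma> v)) = \<phi> (wt \<sigma> u) (lev \<sigma> u) + ?I"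
    using assms v by simp
  finally show ?thesis using 1 by simp
qed

lemma nb_props:
  assumes "valid \<sigma>" "active \<sigma>"
  shows "finite (nb \<sigma> u E)" "nb \<sigma> u E \<subseteq> vertices n" "u \<notin> nb \<sigma> u E" "nb \<sigma> u E \<inter> PP \<sigma> = {}"
  by (auto simp: nb_def)

lemma valid_upd:
  assumes v: "valid \<sigma>" and u: "u \<in> TT \<sigma>" "lev \<sigma> u < t1"
    and N: "N \<subseteq> vertices n" "u \<notin> N" "N \<inter> PP \<sigma> = {}"
  shows "valid (upd \<sigma> u N)"
proof -
  note vd = validD[OF v]
  have fN: "finite N" by (rule finite_sub[OF N(1)])
  let ?\<sigma> = "upd \<sigma> u N"
  let ?C = "N - RR \<sigma>"
  have cN: "real (card ?C) \<le> real (card N)" using card_mono[OF fN, of ?C] by simp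
  have a0: "0 \<le> wt \<sigma> u" using vd(10)[OF u(1)] .
  have wtv: "1 \<le> lev ?\<sigma> v \<and> lev ?\<sigma> v \<le> t1 \<and> 0 \<le> wt ?\<sigma> v \<and> wt ?\<sigma> v \<le> 50 * (2 / d) ^ lev ?\<sigma> v"
    if t: "v \<in> TT ?\<sigma>" for v
  proof (cases "v \<in> ?C")
    case True
    have h: "d / 2 \<le> real (card ?C)" using t True vd(3) by (auto simp: upd_def split: if_splits)
    have "wt \<sigma> u / (1 + real (card N)) \<le> wt \<sigma> u / (d / 2)"
      using h cN dpos a0 by (intro divide_left_mono) (auto intro!: mult_pos_pos)
    also have "\<dots> \<le> (50 * (2 / d) ^ lev \<sigma> u) * (2 / d)"
      using mult_right_mono[OF vd(11)[OF u(1)], of "2 / d"] dpos by (simp add: field_simps)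
    finally show ?thesis using True u a0 by (simp add: upd_def mult_ac)
  next
    case False
    hence "v \<in> TT \<sigma>" using t by (auto simp: upd_def split: if_splits)
    moreover have "wt ?\<sigma> v = wt \<sigma> v" "lev ?\<sigma> v = lev \<sigma> v" using False by (auto simp: upd_def)
    ultimately show ?thesis using vd(8-11)[of v] by simp
  qed
  have "(\<Sum>v\<in>TT ?\<sigma>. wt ?\<sigma> v) \<le> (\<Sum>v\<in>TT \<sigma>. wt \<sigma> v)"
  proof -
    have "0 \<le> (\<Sum>v\<in>TT \<sigma> \<inter> N. wt \<sigma> v)" using vd by (intro sum_nonneg) auto
    moreover have "real (card ?C) * (wt \<sigma> u / (1 + real (card N))) \<le> wt \<sigma> u"
      using mult_right_mono[OF cN a0] a0 by (simp add: field_simps)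
    ultimately show ?thesis using TT_sum[OF v u(1) fN N(2), of "\<lambda>x _. x"] a0 by simp
  qed
  hence s: "(\<Sum>v\<in>TT ?\<sigma>. wt ?\<sigma> v) \<le> 1" using vd(12) by simp
  have "PP ?\<sigma> \<subseteq> RR ?\<sigma>" "RR ?\<sigma> \<subseteq> vertices n" "TT ?\<sigma> \<subseteq> RR ?\<sigma> - PP ?\<sigma>"
    using vd u N by (auto simp: upd_def)
  thus ?thesis unfolding valid_def using wtv s by blast
qed

lemma valid_nxt:
  assumes "valid \<sigma>" "active \<sigma>" shows "valid (nxt \<sigma> E)"
  unfolding nxt_def by (rule valid_upd[OF assms(1) cur_in[OF assms] nb_props(2-4)[OF assms]])

lemma valid_run: "valid \<sigma> \<Longrightarrow> valid (run k \<sigma> E)"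
  by (induction k arbitrary: \<sigma>) (auto simp: valid_nxt)

lemma PP_nxt: "PP (nxt \<sigma> E) = insert (cur \<sigma>) (PP \<sigma>)"
  by (simp add: nxt_def upd_def)

lemma on_edges_nxt: "on_edges (star (cur \<sigma>) (vertices n - PP \<sigma> - {cur \<sigma>})) (nxt \<sigma>)"
proof (rule on_edgesI)
  fix E E' :: "nat set \<Rightarrow> bool"
  assume *: "\<And>e. e \<in> star (cur \<sigma>) (vertices n - PP \<sigma> - {cur \<sigma>}) \<Longrightarrow> E e = E' e"
  have "nb \<sigma> (cur \<sigma>) E = nb \<sigma> (cur \<sigma>) E'"
    using * by (auto simp: nb_def adj_def star_def)
  thus "nxt \<sigma> E = nxt \<sigma> E'" by (simp add: nxt_def)
qed

lemma star_off:
  assumes "valid \<sigma>" "active \<sigma>"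
  shows "star (cur \<sigma>) (vertices n - PP \<sigma> - {cur \<sigma>}) \<subseteq> edges_off (PP \<sigma>)"
  using cur_in[OF assms] validD(4)[OF assms(1)] by (auto simp: star_def edges_off_def)

lemma on_edges_run:
  assumes "valid \<sigma>" shows "on_edges (edges_off (PP \<sigma>)) (run k \<sigma>)"
  using assms
proof (induction k arbitrary: \<sigma>)
  case 0 show ?case by (rule on_edgesI) simp
next
  case (Suc k)
  show ?case
  proof (cases "active \<sigma>")
    case True
    show ?thesis
    proof (rule on_edgesI)
      fix E E' :: "nat set \<Rightarrow> bool" assume *: "\<And>e. e \<in> edges_off (PP \<sigma>) \<Longrightarrow> E e = E' e"
      have 1: "nxt \<sigma> E = nxt \<sigma> E'"
        by (rule on_edgesD[OF on_edges_nxt]) (use * star_off[OF Suc.prems True] in blast)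
      have "run k (nxt \<sigma> E) E = run k (nxt \<sigma> E) E'"
        by (rule on_edgesD[OF Suc.IH[OF valid_nxt[OF Suc.prems True]]])
           (rule *, auto simp: edges_off_def PP_nxt)
      thus "run (Suc k) \<sigma> E = run (Suc k) \<sigma> E'" using 1 True by simp
    qed
  next
    case False show ?thesis by (rule on_edgesI) (simp add: False)
  qed
qed

lemma PP_run: "PP \<sigma> \<subseteq> PP (run k \<sigma> E)"
proof (induction k arbitrary: \<sigma>)
  case (Suc k) show ?case using Suc[of "nxt \<sigma> E"] by (auto simp: PP_nxt)
qed simp

lemma on_edges_run_comp:
  assumes v: "valid \<sigma>" and G: "\<And>\<sigma>. valid \<sigma> \<Longrightarrow> on_edges (edges_off (PP \<sigma>)) (G \<sigma>)"
  shows "on_edges (edges_off (PP \<sigma>)) (\<lambda>E. G (run k \<sigma> E) E)"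
proof (rule on_edgesI)
  fix E1 E2 :: "nat set \<Rightarrow> bool"
  assume *: "\<And>e. e \<in> edges_off (PP \<sigma>) \<Longrightarrow> E1 e = E2 e"
  have 1: "run k \<sigma> E1 = run k \<sigma> E2"
    by (rule on_edgesD[OF on_edges_run[OF v]]) (rule *)
  have "edges_off (PP (run k \<sigma> E2)) \<subseteq> edges_off (PP \<sigma>)" using PP_run[of \<sigma> k E2] by (force simp: edges_off_def)
  hence "G (run k \<sigma> E2) E1 = G (run k \<sigma> E2) E2"
    by (intro on_edgesD[OF G[OF valid_run[OF v]]]) (use * in blast)
  thus "G (run k \<sigma> E1) E1 = G (run k \<sigma> E2) E2" using 1 by simp
qed

text \<open>\<open>G\<close> may inspect the edges that the exploration has not revealed, so this bounds failures
  of the exploration and of the steps that follow it at the same time.\<close>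

lemma run_supermartingale:
  assumes v: "valid \<sigma>" and k: "card (vertices n - PP \<sigma>) \<le> k"
    and G: "\<And>\<sigma>. valid \<sigma> \<Longrightarrow> on_edges (edges_off (PP \<sigma>)) (G \<sigma> :: _ \<Rightarrow> real)"
    and last: "\<And>\<sigma>. valid \<sigma> \<Longrightarrow> \<not> active \<sigma> \<Longrightarrow> expect (pot_edges n) p (G \<sigma>) \<le> \<Phi> \<sigma>"
    and step: "\<And>\<sigma>. valid \<sigma> \<Longrightarrow> active \<sigma> \<Longrightarrow> expect (pot_edges n) p (\<lambda>E. \<Phi> (nxt \<sigma> E)) \<le> \<Phi> \<sigma>"
  shows "expect (pot_edges n) p (\<lambda>E. G (run k \<sigma> E) E) \<le> \<Phi> \<sigma>"
  using v k
proof (induction k arbitrary: \<sigma>)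
  case 0
  \<comment> \<open>\<open>k\<close> bounds the number of unprocessed vertices; with none left there
    is no current vertex.\<close>
  have "\<not> active \<sigma>"
  proof
    assume a: "active \<sigma>"
    have "cur \<sigma> \<in> vertices n - PP \<sigma>" using cur_in[OF 0(1) a] validD[OF 0(1)] by blast
    moreover have "vertices n - PP \<sigma> = {}" using 0(2) by simp
    ultimately show False by blast
  qed
  thus ?case using last[OF 0(1)] by simp
next
  case (Suc k)
  show ?case
  proof (cases "active \<sigma>")
    case False thus ?thesis using last[OF Suc.prems(1)] by simp
  next
    case True
    note vn = valid_nxt[OF Suc.prems(1) True]
    have c: "cur \<sigma> \<in> vertices n - PP \<sigma>"
      using cur_in[OF Suc.prems(1) True] validD[OF Suc.prems(1)] by blast
    have "vertices n - PP (nxt \<sigma> E) = (vertices n - PP \<sigma>) - {cur \<sigma>}" for E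
      by (auto simp: PP_nxt)
    hence k: "card (vertices n - PP (nxt \<sigma> E)) \<le> k" for E
      using Suc.prems(2) c by (simp add: card_Diff_singleton)
    have "expect (pot_edges n) p (\<lambda>E. G (run (Suc k) \<sigma> E) E) = expect (pot_edges n) p (\<lambda>E. G (run k (nxt \<sigma> E) E) E)"
      using True by simp
    also have "\<dots> = expect (pot_edges n) p (\<lambda>E. expect (pot_edges n) p (\<lambda>E'. G (run k (nxt \<sigma> E) E') E'))"
    proof (rule expect_two_stage[OF finite_pot_edges on_edges_nxt, where G="\<lambda>\<sigma> E. G (run k \<sigma> E) E" and C="\<lambda>\<sigma>. edges_off (PP \<sigma>)"])
      fix E
      show "on_edges (edges_off (PP (nxt \<sigma> E))) (\<lambda>E'. G (run k (nxt \<sigma> E) E') E')"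
        by (rule on_edges_run_comp[OF vn G])
      show "star (cur \<sigma>) (vertices n - PP \<sigma> - {cur \<sigma>}) \<inter> edges_off (PP (nxt \<sigma> E)) = {}"
        by (auto simp: star_def edges_off_def PP_nxt)
    qed
    also have "\<dots> \<le> expect (pot_edges n) p (\<lambda>E. \<Phi> (nxt \<sigma> E))"
      by (rule expect_mono[OF finite_pot_edges]) (rule Suc.IH[OF vn k])
    also have "\<dots> \<le> \<Phi> \<sigma>" by (rule step[OF Suc.prems(1) True])
    finally show ?thesis .
  qed
qed

end

section \<open>Exponential and inverse moments of the number of new neighbours\<close>

lemma exp_le_quadratic:
  fixes x :: real assumes "0 \<le> x" "x \<le> 1" shows "exp x \<le> 1 + x + x\<^sup>2"
  using exp_bound[OF assms] by simp

text \<open>The chord of \<open>exp\<close> over \<open>[0, l * A]\<close>, by convexity. Being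
  linear in \<open>c\<close>, it lets a sum over vertices be bounded by their total mass instead of
  their number.\<close>

lemma exp_chord:
  fixes l c A :: real assumes "0 \<le> l" "0 \<le> c" "c \<le> A" "0 < A"
  shows "exp (l * c) - 1 \<le> c / A * exp (l * A)"
proof (cases "l = 0")
  case True thus ?thesis using assms by simp
next
  case False
  have conv: "convex_on UNIV (exp :: real \<Rightarrow> real)" by (rule exp_convex)
  have "exp ((1 - c / A) *\<^sub>R 0 + (c / A) *\<^sub>R (l * A)) \<le> (1 - c / A) * exp 0 + (c / A) * exp (l * A)"
    by (rule convex_onD[OF conv]) (use assms in auto)
  hence "exp (l * c) \<le> 1 - c / A + c / A * exp (l * A)" using assms by (simp add: mult_ac)
  thus ?thesis using assms by (smt (verit) divide_nonneg_pos)
qed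

context exploration
begin

lemma pn: "p * real (card S) \<le> d" if "S \<subseteq> vertices n"
  using card_mono[OF finite_vertices that] mult_left_mono[of "real (card S)" "real n" p] p d by simp

context
  fixes v :: nat and S :: "nat set"
  assumes vS: "v \<in> vertices n" "S \<subseteq> vertices n" "v \<notin> S"
begin

abbreviation (input) DD :: "(nat set \<Rightarrow> bool) \<Rightarrow> real" where
  "DD E \<equiv> (\<Sum>u\<in>S. of_bool (adj E v u))"

lemma exp_D:
  assumes "0 \<le> \<theta>" "\<theta> \<le> 1"
  shows "expect (pot_edges n) p (\<lambda>E. exp (\<theta> * DD E)) \<le> exp (d * (\<theta> + \<theta>\<^sup>2))"
proof -
  have "expect (pot_edges n) p (\<lambda>E. exp (\<theta> * DD E)) \<le> exp (p * (\<Sum>u\<in>S. exp \<theta> - 1))"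
    using expect_exp_star[OF p vS, of "\<lambda>_. \<theta>"] by (simp add: sum_distrib_left)
  also have "p * (\<Sum>u\<in>S. exp \<theta> - 1) = (p * real (card S)) * (exp \<theta> - 1)" by simp
  also have "\<dots> \<le> d * (exp \<theta> - 1)" using pn[OF vS(2)] assms by (intro mult_right_mono) auto
  also have "\<dots> \<le> d * (\<theta> + \<theta>\<^sup>2)"
    using exp_le_quadratic[OF assms] dpos by (intro mult_left_mono) auto
  finally show ?thesis by simp
qed

context
  assumes lb: "d - 1 \<le> p * real (card S)"
begin

lemma low_D: "Pr (pot_edges n) p (\<lambda>E. DD E < d / 2) \<le> exp (- (d / 10))"
proof -
  have "Pr (pot_edges n) p (\<lambda>E. DD E < d / 2) \<le> expect (pot_edges n) p (\<lambda>E. exp (d / 4) * exp (\<Sum>u\<in>S. -(1/2) * of_bool (adj E v u)))"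
  proof (rule Pr_le_expect[OF finite_pot_edges])
    fix E
    have "exp (d / 4) * exp (\<Sum>u\<in>S. -(1/2) * of_bool (adj E v u)) = exp ((d / 2 - DD E) / 2)"
      by (simp add: exp_add[symmetric] sum_negf sum_divide_distrib[symmetric] diff_divide_distrib)
    moreover have "1 \<le> exp ((d / 2 - DD E) / 2)" if "DD E < d / 2" using that by simp
    ultimately show "of_bool (DD E < d / 2) \<le> exp (d / 4) * exp (\<Sum>u\<in>S. -(1/2) * of_bool (adj E v u))"
      by (auto simp del: one_le_exp_iff)
  qed
  also have "\<dots> \<le> exp (d / 4) * exp (p * (\<Sum>u\<in>S. exp (- (1 / 2)) - 1))"
    using expect_exp_star[OF p vS, of "\<lambda>_. -(1/2)"] by simp
  also have "\<dots> = exp (d / 4 - p * real (card S) * (1 - exp (- (1/2))))"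
    by (simp add: exp_add[symmetric] algebra_simps)
  \<comment> \<open>\<open>d / 4 - (d - 1) * 3 / 8 = 3 / 8 - d / 8\<close>, which is at most
    \<open>- d / 10\<close> since \<open>d \<ge> 16\<close>.\<close>
  also have "\<dots> \<le> exp (- (d / 10))"
  proof -
    have "3 / 8 \<le> 1 - exp (- (1/2) :: real)"
      using exp_minus_le_quadratic[of "1/2"] by (simp add: power2_eq_square)
    hence "(d - 1) * (3 / 8) \<le> p * real (card S) * (1 - exp (- (1/2)))"
      using lb d(2) by (intro mult_mono) auto
    thus ?thesis using d(2) by simp
  qed
  finally show ?thesis .
qed

text \<open>The mean inverse degree is \<open>1 / d\<close> up to a relative error of order
  \<open>1 / d\<close>, which over at most \<open>d / ln d\<close> levels accumulates only to a
  constant; the pointwise bound 2 would accumulate to \<open>2^t1\<close>. The correction 6 is the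
  origin of \<open>d - 6\<close> in \<open>ww\<close>.\<close>

lemma inv_D: "expect (pot_edges n) p (\<lambda>E. if d / 2 \<le> DD E then d / DD E else 0) \<le> 1 + 6 / d"
proof -
  let ?m = "p * real (card S)"
  have m: "d - 1 \<le> ?m" "?m \<le> d" using lb pn[OF vS(2)] by auto
  have pw: "(if d / 2 \<le> DD E then d / DD E else 0) \<le> 2 - DD E / d + 4 / d\<^sup>2 * ((DD E - ?m)\<^sup>2 + (d - ?m)\<^sup>2)" for E
  proof -
    define y where "y = DD E / d"
    have y0: "y \<ge> 0" using dpos by (simp add: y_def sum_nonneg)
    have *: "(DD E - d)\<^sup>2 \<le> 2 * ((DD E - ?m)\<^sup>2 + (d - ?m)\<^sup>2)"
      using sum_squares_ge_zero[of "(DD E - ?m) + (d - ?m)" 0] by (simp add: power2_eq_square algebra_simps)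
    hence q: "2 * (y - 1)\<^sup>2 \<le> 4 / d\<^sup>2 * ((DD E - ?m)\<^sup>2 + (d - ?m)\<^sup>2)"
    proof -
      have "y - 1 = (DD E - d) / d" using dpos by (simp add: y_def diff_divide_distrib)
      hence "2 * (y - 1)\<^sup>2 = 2 / d\<^sup>2 * (DD E - d)\<^sup>2" by (simp add: power_divide)
      also have "\<dots> \<le> 2 / d\<^sup>2 * (2 * ((DD E - ?m)\<^sup>2 + (d - ?m)\<^sup>2))"
        using * by (rule mult_left_mono) simp
      finally show ?thesis by simp
    qed
    \<comment> \<open>A parabola touching \<open>1 / y\<close> at 1: the difference, times
      \<open>y\<close>, is \<open>(y - 1)^2 * (2 * y - 1)\<close>, which is where the cut-off at
      \<open>d / 2\<close> is needed.\<close>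
    have "(if d / 2 \<le> DD E then d / DD E else 0) \<le> 1 - (y - 1) + 2 * (y - 1)\<^sup>2"
    proof (cases "d / 2 \<le> DD E")
      case True
      hence y: "1 / 2 \<le> y" using dpos by (simp add: y_def field_simps)
      have "1 \<le> (1 - (y - 1) + 2 * (y - 1)\<^sup>2) * y"
      proof -
        have "(1 - (y - 1) + 2 * (y - 1)\<^sup>2) * y - 1 = (y - 1)\<^sup>2 * (2 * y - 1)"
          by (simp add: power2_eq_square algebra_simps)
        moreover have "0 \<le> (y - 1)\<^sup>2 * (2 * y - 1)" using y by simp
        ultimately show ?thesis by linarith
      qed
      hence "1 / y \<le> 1 - (y - 1) + 2 * (y - 1)\<^sup>2" using y by (simp add: field_simps)
      thus ?thesis using True dpos by (simp add: y_def)
    next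
      case False
      hence "y \<le> 1 / 2" using dpos by (simp add: y_def field_simps)
      moreover have "0 \<le> (y - 1)\<^sup>2" by simp
      ultimately show ?thesis using False by auto
    qed
    thus ?thesis using q by (simp add: y_def)
  qed
  have var: "expect (pot_edges n) p (\<lambda>E. (DD E - ?m)\<^sup>2) \<le> d"
    using expect_variance_star[OF p vS, of "\<lambda>_. 1"] m by simp
  have mean: "expect (pot_edges n) p (\<lambda>E. DD E) = ?m"
    using expect_star[OF p vS, of "\<lambda>_. 1"] by simp
  have "expect (pot_edges n) p (\<lambda>E. if d / 2 \<le> DD E then d / DD E else 0)
      \<le> expect (pot_edges n) p (\<lambda>E. 2 - DD E / d + 4 / d\<^sup>2 * ((DD E - ?m)\<^sup>2 + (d - ?m)\<^sup>2))"
    by (intro expect_mono finite_pot_edges pw)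
  also have "\<dots> = 2 - ?m / d + 4 / d\<^sup>2 * (expect (pot_edges n) p (\<lambda>E. (DD E - ?m)\<^sup>2) + (d - ?m)\<^sup>2)"
    by (simp add: mean)
  also have "\<dots> \<le> 2 - (d - 1) / d + 4 / d\<^sup>2 * (d + 1)"
  proof -
    have "(d - ?m)\<^sup>2 \<le> 1\<^sup>2" using m by (intro power_mono) auto
    hence "4 / d\<^sup>2 * (expect (pot_edges n) p (\<lambda>E. (DD E - ?m)\<^sup>2) + (d - ?m)\<^sup>2) \<le> 4 / d\<^sup>2 * (d + 1)"
      using var by (intro mult_left_mono) auto
    moreover have "(d - 1) / d \<le> ?m / d" using m dpos by (intro divide_right_mono) auto
    ultimately show ?thesis by linarith
  qed
  \<comment> \<open>The excess over 1 is \<open>5 / d + 4 / d^2\<close>.\<close>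
  also have "\<dots> \<le> 1 + 6 / d"
    using d(2) by (simp add: field_simps power2_eq_square)
  finally show ?thesis .
qed

end
end

lemma card_new:
  assumes "valid \<sigma>" "u \<in> RR \<sigma>"
  shows "real (card (nb \<sigma> u E - RR \<sigma>)) = (\<Sum>v\<in>vertices n - RR \<sigma>. of_bool (adj E u v))"
proof -
  have "nb \<sigma> u E - RR \<sigma> = {v \<in> vertices n - RR \<sigma>. adj E u v}"
    using validD(1)[OF assms(1)] assms(2) by (auto simp: nb_def)
  moreover have "(\<Sum>v\<in>vertices n - RR \<sigma>. of_bool (adj E u v)) = (\<Sum>v\<in>{v \<in> vertices n - RR \<sigma>. adj E u v}. 1 :: real)"
    by (rule sum.mono_neutral_cong_right) auto
  ultimately show ?thesis by simp
qed

lemma sum_known: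
  assumes "valid \<sigma>"
  shows "(\<Sum>v\<in>nb \<sigma> u E \<inter> RR \<sigma>. c v) = (\<Sum>v\<in>RR \<sigma> - PP \<sigma> - {u}. c v * of_bool (adj E u v) :: real)"
proof -
  have "nb \<sigma> u E \<inter> RR \<sigma> = {v \<in> RR \<sigma> - PP \<sigma> - {u}. adj E u v}"
    using validD(2)[OF assms] by (auto simp: nb_def)
  thus ?thesis using validD(6)[OF assms] by (simp add: sum.inter_filter[symmetric] if_distrib of_bool_def cong: if_cong)
qed

text \<open>\<open>ff s\<close> dominates the expected number of descendants of a vertex at level \<open>s\<close>, and
  \<open>ww s\<close> is the rate at which the squared mass decays.  The factors \<open>2 + 2^(-s)\<close> and
  \<open>1 + 2^(-s)\<close> are decreasing in \<open>s\<close> in order to absorb the second-order terms of the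
  exponential moments.  In \<open>F1\<close>, the terms with \<open>k1\<close> and \<open>k2\<close> compensate the mass lost
  per unit of processed mass and per processed vertex.\<close>

definition ff :: "nat \<Rightarrow> real" where "ff s = (2 + (1/2)^s) * d ^ (t1 - s) - 2"
definition l3 :: real where "l3 = 1 / (18 * d ^ (t1 - 1))"
definition F3 :: "st \<Rightarrow> real" where
  "F3 \<sigma> = l3 * (real (card (RR \<sigma>)) + (\<Sum>v\<in>TT \<sigma>. ff (lev \<sigma> v)) - Rm)"

definition ww :: "nat \<Rightarrow> real" where "ww s = (d - 6) ^ s * (1 + (1/2)^s)"
definition l2 :: real where "l2 = d / 320000"
definition F2 :: "st \<Rightarrow> real" where
  "F2 \<sigma> = l2 * ((\<Sum>v\<in>TT \<sigma>. (wt \<sigma> v)\<^sup>2 * ww (lev \<sigma> v)) - 10 ^ 6)"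

definition k2 :: real where "k2 = p * exp (200 * l1 / d) * d / 200"
definition k1 :: real where "k1 = 2 * l1 / d + exp (- (d / 10)) * exp (100 * l1 / d) * d / 100 + k2 * (2 / d) * Rm"
definition F1 :: "st \<Rightarrow> real" where
  "F1 \<sigma> = l1 * (1 - (\<Sum>v\<in>TT \<sigma>. wt \<sigma> v) - 1 / 100)
     + k1 * (\<Sum>v\<in>TT \<sigma>. wt \<sigma> v * (real t1 - real (lev \<sigma> v))) + k2 * (Rm - real (card (PP \<sigma>)))"

definition \<Phi> :: "st \<Rightarrow> real" where
  "\<Phi> \<sigma> = exp (F1 \<sigma>) + exp (F2 \<sigma>) + exp (F3 \<sigma>)"

lemma d1: "1 \<le> d" "2 \<le> d" using d(2) by auto

lemma ff_nonneg: "s \<le> t1 \<Longrightarrow> 0 \<le> ff s"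
proof -
  have "1 \<le> d ^ (t1 - s)" using d1 by simp
  hence "2 * 1 \<le> (2 + (1/2)^s) * d ^ (t1 - s)" by (intro mult_mono) auto
  thus ?thesis by (simp add: ff_def)
qed

lemma l3_pos: "0 < l3" using dpos by (simp add: l3_def)

text \<open>\<open>l3 * (1 + ff (Suc s))\<close> is the amount by which one new vertex at level
  \<open>Suc s\<close> raises \<open>F3\<close>. It is at most \<open>1 / (6 * d^s)\<close>, so the
  quadratic term of the exponential moment is paid by the drop of the factor from
  \<open>2 + (1/2)^s\<close> to \<open>2 + (1/2)^(s+1)\<close>; the \<open>- 2\<close> in
  \<open>ff\<close> absorbs the added 1.\<close>

lemma ff_step:
  assumes "1 \<le> s" "s < t1"
  shows "0 \<le> l3 * (1 + ff (Suc s))" "l3 * (1 + ff (Suc s)) \<le> 1"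
    "d * (l3 * (1 + ff (Suc s)) + (l3 * (1 + ff (Suc s)))\<^sup>2) \<le> l3 * ff s"
proof -
  define X where "X = d ^ (t1 - Suc s)"
  define y where "y = (1/2 :: real) ^ s"
  define \<theta> where "\<theta> = l3 * (1 + ff (Suc s))"
  have X1: "1 \<le> X" using d1 by (simp add: X_def)
  have ts: "t1 - s = Suc (t1 - Suc s)" using assms by simp
  have ff1: "1 + ff (Suc s) = (2 + y / 2) * X - 1" by (simp add: ff_def X_def y_def)
  have ff0: "ff s = (2 + y) * (d * X) - 2" by (simp add: ff_def ts X_def y_def)
  have y: "0 < y" "y \<le> 1/2" using assms power_decreasing[of 1 s "1/2::real"] by (auto simp: y_def)
  have "t1 - 1 = (t1 - Suc s) + s" using assms by simp
  hence l3X: "l3 * X = 1 / (18 * d ^ s)" using dpos by (simp add: l3_def X_def power_add)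
  have dy: "1 / d ^ s \<le> y"
    unfolding y_def power_one_over[symmetric] using d1 by (intro power_mono) (auto simp: field_simps)
  \<comment> \<open>\<open>r \<le> y / 6\<close> is just enough for
    \<open>(2 + y / 2) * (1 + r) \<le> 2 + y\<close>.\<close>
  define r where "r = 3 * (l3 * X)"
  have r: "r \<le> y / 6" using dy by (simp add: r_def l3X)
  show nn: "0 \<le> l3 * (1 + ff (Suc s))" using ff_nonneg[of "Suc s"] assms l3_pos by simp
  have "(2 + y / 2) * X - 1 \<le> 3 * X" using y X1 by (simp add: algebra_simps mult_right_mono add_increasing)
  hence "\<theta> \<le> l3 * (3 * X)" unfolding \<theta>_def ff1 using l3_pos by (intro mult_left_mono) auto
  hence th: "\<theta> \<le> r" by (simp add: r_def)
  thus "l3 * (1 + ff (Suc s)) \<le> 1" using r y by (simp add: \<theta>_def)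
  have r0: "0 \<le> r" using th nn by (simp add: \<theta>_def)
  have A: "0 \<le> (2 + y / 2) * X - 1" using ff_nonneg[of "Suc s"] ff1 assms by simp
  have "d * (((2 + y / 2) * X - 1) * (1 + \<theta>)) \<le> d * (((2 + y / 2) * X - 1) * (1 + r))"
    using th A dpos by (intro mult_left_mono) auto
  also have "\<dots> \<le> d * ((2 + y / 2) * X * (1 + r) - 1)"
    using r0 dpos by (intro mult_left_mono) (auto simp: algebra_simps)
  also have "\<dots> \<le> d * ((2 + y) * X - 1)"
  proof (intro mult_left_mono diff_mono order_refl)
    have "(2 + y / 2) * (1 + r) \<le> 2 + y"
    proof -
      have "y / 2 * r \<le> 1 * r" using y r0 by (intro mult_right_mono) auto
      moreover have "(2 + y / 2) * (1 + r) = 2 + 2 * r + y / 2 + y / 2 * r" by (simp add: algebra_simps)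
      ultimately show ?thesis using r by linarith
    qed
    thus "(2 + y / 2) * X * (1 + r) \<le> (2 + y) * X"
      using X1 mult_right_mono[of "(2 + y / 2) * (1 + r)" "2 + y" X] by (simp add: mult_ac)
  qed (use dpos in auto)
  also have "\<dots> \<le> ff s" using d1 by (simp add: ff0 algebra_simps)
  finally have "l3 * (d * (((2 + y / 2) * X - 1) * (1 + \<theta>))) \<le> l3 * ff s" using l3_pos by simp
  moreover have "l3 * (d * (((2 + y / 2) * X - 1) * (1 + \<theta>))) = d * (\<theta> + \<theta>\<^sup>2)"
  proof -
    have "l3 * ((2 + y / 2) * X - 1) = \<theta>" by (simp add: \<theta>_def ff1)
    hence "d * (\<theta> + \<theta>\<^sup>2) = d * (l3 * ((2 + y / 2) * X - 1) * (1 + \<theta>))" by (simp add: power2_eq_square algebra_simps)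
    thus ?thesis by (simp only: mult_ac)
  qed
  ultimately have "d * (\<theta> + \<theta>\<^sup>2) \<le> l3 * ff s" by linarith
  thus "d * (l3 * (1 + ff (Suc s)) + (l3 * (1 + ff (Suc s)))\<^sup>2) \<le> l3 * ff s"
    by (simp only: \<theta>_def)
qed

lemma ww_nonneg: "0 \<le> ww s" using d(2) by (simp add: ww_def)

text \<open>\<open>(d - 6) * (1 + 6 / d) < d\<close> compensates the loss in \<open>inv_D\<close>.
  With \<open>y = (1/2)^s\<close>, the correction falling from \<open>1 + y\<close> to
  \<open>1 + y / 2\<close> leaves the spare factor \<open>1 - y / 4\<close>, which
  \<open>step2\<close> spends on its second-order term.\<close>

lemma ww_step:
  shows "ww (Suc s) * (1 + 6 / d) / d \<le> ww s * (1 - (1/2)^s / 4)"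
proof -
  define y where "y = (1/2 :: real) ^ s"
  have y: "0 < y" "y \<le> 1" by (auto simp: y_def power_le_one)
  have g: "0 \<le> (d - 6) ^ s" using d(2) by simp
  have "(d - 6) * (1 + 6 / d) / d \<le> 1" using dpos by (simp add: field_simps)
  hence 1: "((d - 6) * (1 + 6 / d) / d) * (1 + y / 2) \<le> 1 * (1 + y / 2)" using y by (intro mult_right_mono) auto
  have "y * y \<le> y" using y by (simp add: mult_left_le)
  moreover have "(1 + y) * (1 - y / 4) = 1 + 3 * y / 4 - y * y / 4" by (simp add: field_simps)
  ultimately have 2: "1 + y / 2 \<le> (1 + y) * (1 - y / 4)" by linarith
  have "(d - 6) ^ s * (((d - 6) * (1 + 6 / d) / d) * (1 + y / 2)) \<le> (d - 6) ^ s * ((1 + y) * (1 - y / 4))"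
    using g 1 2 by (intro mult_left_mono) auto
  thus ?thesis by (simp add: ww_def y_def mult_ac)
qed

section \<open>One-step drift of the three potentials\<close>

context
  fixes \<sigma> assumes va: "valid \<sigma>" "active \<sigma>"
begin

abbreviation (input) "cur_v \<equiv> cur \<sigma>"
abbreviation (input) "waiting \<equiv> RR \<sigma> - PP \<sigma> - {cur \<sigma>}"
abbreviation (input) "unseen \<equiv> vertices n - RR \<sigma>"
abbreviation (input) "new_deg E \<equiv> (\<Sum>v\<in>vertices n - RR \<sigma>. of_bool (adj E cur_v v) :: real)"

lemma u_facts: "cur_v \<in> TT \<sigma>" "lev \<sigma> cur_v < t1" "1 \<le> lev \<sigma> cur_v" "cur_v \<in> RR \<sigma>" "cur_v \<in> vertices n" "cur_v \<notin> PP \<sigma>"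
    "0 \<le> wt \<sigma> cur_v" "wt \<sigma> cur_v \<le> 50 * (2 / d) ^ lev \<sigma> cur_v" "wt \<sigma> cur_v \<le> 100 / d" "wt \<sigma> cur_v \<le> 1"
proof -
  show cur_v: "cur_v \<in> TT \<sigma>" "lev \<sigma> cur_v < t1" using cur_in[OF va] by auto
  note v = validD[OF va(1)]
  show "1 \<le> lev \<sigma> cur_v" "cur_v \<in> RR \<sigma>" "cur_v \<in> vertices n" "cur_v \<notin> PP \<sigma>" "0 \<le> wt \<sigma> cur_v" "wt \<sigma> cur_v \<le> 50 * (2 / d) ^ lev \<sigma> cur_v"
    using cur_v v by auto
  show "wt \<sigma> cur_v \<le> 100 / d" by (rule wt_le_A[OF va(1) cur_v(1)])
  have "wt \<sigma> cur_v \<le> (\<Sum>v\<in>TT \<sigma>. wt \<sigma> v)" using cur_v v by (intro member_le_sum) auto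
  thus "wt \<sigma> cur_v \<le> 1" using v(12) by simp
qed

text \<open>Discovered vertices lower the mean number of new neighbours by at most
  \<open>p * Rm\<close>, which is at most 1 because \<open>Rm * d \<le> n\<close>.\<close>

lemma S_facts: "cur_v \<in> vertices n" "unseen \<subseteq> vertices n" "cur_v \<notin> unseen" "d - 1 \<le> p * real (card unseen)"
proof -
  show "cur_v \<in> vertices n" "unseen \<subseteq> vertices n" "cur_v \<notin> unseen" using u_facts by auto
  have "real (card unseen) = real n - real (card (RR \<sigma>))"
    using validD(2,6)[OF va(1)] card_mono[OF finite_vertices validD(2)[OF va(1)]]
    by (subst card_Diff_subset) auto
  moreover have "real (card (RR \<sigma>)) \<le> Rm" using va(2) by (simp add: active_def)
  ultimately have "p * (real n - Rm) \<le> p * real (card unseen)" using p by (intro mult_left_mono) auto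
  moreover have "p * Rm \<le> 1"
  proof -
    have "(p * Rm) * d \<le> d" using mult_left_mono[OF Rm(1) p(1)] d(1) by (simp add: mult_ac)
    thus ?thesis using dpos by simp
  qed
  ultimately show "d - 1 \<le> p * real (card unseen)" using d(1) by (simp add: algebra_simps)
qed

lemma D_card: "real (card (nb \<sigma> cur_v E - RR \<sigma>)) = new_deg E"
  by (rule card_new[OF va(1) u_facts(4)])

lemma D_nonneg: "0 \<le> new_deg E" by (simp add: sum_nonneg)

lemma nb_card: "real (card (nb \<sigma> cur_v E)) = new_deg E + (\<Sum>v\<in>RR \<sigma> - PP \<sigma> - {cur_v}. of_bool (adj E cur_v v))"
proof -
  have "card (nb \<sigma> cur_v E) = card (nb \<sigma> cur_v E - RR \<sigma>) + card (nb \<sigma> cur_v E \<inter> RR \<sigma>)"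
    using nb_props(1)[OF va] by (subst card_Un_disjoint[symmetric]) (auto intro!: arg_cong[where f=card])
  moreover have "real (card (nb \<sigma> cur_v E \<inter> RR \<sigma>)) = (\<Sum>v\<in>RR \<sigma> - PP \<sigma> - {cur_v}. of_bool (adj E cur_v v))"
    using sum_known[OF va(1), of "\<lambda>_. 1"] by simp
  ultimately show ?thesis using D_card by simp
qed

lemma nxt_sum:
  fixes \<phi> :: "real \<Rightarrow> nat \<Rightarrow> real"
  shows "(\<Sum>v\<in>TT (nxt \<sigma> E). \<phi> (wt (nxt \<sigma> E) v) (lev (nxt \<sigma> E) v))
    = (\<Sum>v\<in>TT \<sigma>. \<phi> (wt \<sigma> v) (lev \<sigma> v)) - \<phi> (wt \<sigma> cur_v) (lev \<sigma> cur_v) - (\<Sum>v\<in>TT \<sigma> \<inter> nb \<sigma> cur_v E. \<phi> (wt \<sigma> v) (lev \<sigma> v))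
     + (if d / 2 \<le> new_deg E then new_deg E * \<phi> (wt \<sigma> cur_v / (1 + real (card (nb \<sigma> cur_v E)))) (Suc (lev \<sigma> cur_v)) else 0)"
  unfolding nxt_def using TT_sum[OF va(1) u_facts(1) nb_props(1,3)[OF va]] by (simp only: D_card)

lemma card_RR_nxt: "real (card (RR (nxt \<sigma> E))) = real (card (RR \<sigma>)) + new_deg E"
proof -
  have "RR (nxt \<sigma> E) = RR \<sigma> \<union> (nb \<sigma> cur_v E - RR \<sigma>)" by (auto simp: nxt_def upd_def)
  hence "card (RR (nxt \<sigma> E)) = card (RR \<sigma>) + card (nb \<sigma> cur_v E - RR \<sigma>)"
    using validD(6)[OF va(1)] nb_props(1)[OF va] by (simp only:) (subst card_Un_disjoint, auto)
  thus ?thesis using D_card by simp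
qed

lemma step3: "expect (pot_edges n) p (\<lambda>E. exp (F3 (nxt \<sigma> E))) \<le> exp (F3 \<sigma>)"
proof -
  define s where "s = lev \<sigma> cur_v"
  define \<theta> where "\<theta> = l3 * (1 + ff (Suc s))"
  have s: "1 \<le> s" "s < t1" using u_facts by (auto simp: s_def)
  note fs = ff_step[OF s, folded \<theta>_def]
  have "F3 (nxt \<sigma> E) \<le> F3 \<sigma> - l3 * ff s + \<theta> * new_deg E" for E
  proof -
    have "0 \<le> (\<Sum>v\<in>TT \<sigma> \<inter> nb \<sigma> cur_v E. ff (lev \<sigma> v))"
      using validD(9)[OF va(1)] by (intro sum_nonneg ff_nonneg) auto
    moreover have "(if d / 2 \<le> new_deg E then new_deg E * ff (Suc s) else 0) \<le> new_deg E * ff (Suc s)"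
      using ff_nonneg[of "Suc s"] s D_nonneg by simp
    ultimately have "(\<Sum>v\<in>TT (nxt \<sigma> E). ff (lev (nxt \<sigma> E) v)) \<le> (\<Sum>v\<in>TT \<sigma>. ff (lev \<sigma> v)) - ff s + new_deg E * ff (Suc s)"
      using nxt_sum[of "\<lambda>_. ff" E, folded s_def] by linarith
    hence "l3 * (real (card (RR (nxt \<sigma> E))) + (\<Sum>v\<in>TT (nxt \<sigma> E). ff (lev (nxt \<sigma> E) v)) - Rm)
       \<le> l3 * (real (card (RR \<sigma>)) + new_deg E + ((\<Sum>v\<in>TT \<sigma>. ff (lev \<sigma> v)) - ff s + new_deg E * ff (Suc s)) - Rm)"
      using l3_pos card_RR_nxt[of E] by (intro mult_left_mono) auto
    thus ?thesis by (simp add: F3_def \<theta>_def algebra_simps)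
  qed
  hence "expect (pot_edges n) p (\<lambda>E. exp (F3 (nxt \<sigma> E))) \<le> expect (pot_edges n) p (\<lambda>E. exp (F3 \<sigma> - l3 * ff s) * exp (\<theta> * new_deg E))"
    by (intro expect_mono finite_pot_edges) (simp add: exp_add[symmetric])
  also have "\<dots> \<le> exp (F3 \<sigma> - l3 * ff s) * exp (d * (\<theta> + \<theta>\<^sup>2))"
    using exp_D[OF S_facts(1-3) fs(1,2)] by simp
  also have "\<dots> \<le> exp (F3 \<sigma>)" using fs(3) by (simp add: exp_add[symmetric])
  finally show ?thesis .
qed

lemma step2: "expect (pot_edges n) p (\<lambda>E. exp (F2 (nxt \<sigma> E))) \<le> exp (F2 \<sigma>)"
proof -
  define s where "s = lev \<sigma> cur_v"
  define a where "a = wt \<sigma> cur_v"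
  \<comment> \<open>Coefficient of the normalised inverse degree \<open>d / new_deg\<close> in the
    bound for the increment of \<open>F2\<close>.\<close>
  define \<kappa> where "\<kappa> = l2 * a\<^sup>2 * ww (Suc s) / d"
  have s: "1 \<le> s" "s < t1" using u_facts by (auto simp: s_def)
  have a: "0 \<le> a" "a \<le> 50 * (2 / d) ^ s" using u_facts by (auto simp: s_def a_def)
  have l2: "0 \<le> l2" using dpos by (simp add: l2_def)
  have k0: "0 \<le> \<kappa>" using l2 ww_nonneg dpos by (simp add: \<kappa>_def)
  \<comment> \<open>From \<open>a \<le> 50 * (2 / d)^s\<close> and
    \<open>ww (Suc s) \<le> 2 * d^(s+1)\<close> one gets
    \<open>\<kappa> \<le> 5000 * l2 * (4 / d)^s\<close>; the denominator 320000 in \<open>l2\<close>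
    is \<open>5000 * 8 * 8\<close>.\<close>
  have ksmall: "\<kappa> \<le> (1/2)^s / 8"
  proof -
    have "a\<^sup>2 \<le> (50 * (2 / d) ^ s)\<^sup>2" using a by (intro power_mono) auto
    also have "\<dots> = 2500 * (4 / d\<^sup>2) ^ s"
      by (simp add: power_mult_distrib power_divide power_mult[symmetric] mult.commute[of s 2] power_mult[of _ 2 s, symmetric])
         (simp add: power_mult)
    finally have a2: "a\<^sup>2 \<le> 2500 * (4 / d\<^sup>2) ^ s" .
    have w: "ww (Suc s) \<le> d ^ Suc s * 2"
    proof -
      have "(1/2 :: real) ^ Suc s \<le> 1" by (intro power_le_one) auto
      thus ?thesis unfolding ww_def using d(2) by (intro mult_mono power_mono) auto
    qed
    have "\<kappa> \<le> l2 * (2500 * (4 / d\<^sup>2) ^ s) * (d ^ Suc s * 2) / d"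
      unfolding \<kappa>_def using a2 w l2 ww_nonneg dpos by (intro divide_right_mono mult_mono) auto
    also have "\<dots> = l2 * 5000 * (4 / d) ^ s"
      using dpos by (simp add: power_divide power2_eq_square power_mult_distrib)
    also have "(4 / d) ^ s = (1/2)^s * (8 / d) ^ s" by (simp add: power_mult_distrib[symmetric])
    also have "l2 * 5000 * ((1/2)^s * (8 / d) ^ s) \<le> l2 * 5000 * ((1/2)^s * (8 / d) ^ 1)"
      using s d(2) l2 by (intro mult_left_mono power_decreasing) auto
    also have "\<dots> = (1/2)^s / 8" using dpos by (simp add: l2_def)
    finally show ?thesis .
  qed
  have half: "(1/2::real)^s \<le> 1/2" using s power_decreasing[of 1 s "1/2::real"] by simp
  let ?z = "\<lambda>E. if d / 2 \<le> new_deg E then d / new_deg E else 0"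
  have "F2 (nxt \<sigma> E) \<le> F2 \<sigma> - l2 * a\<^sup>2 * ww s + \<kappa> * ?z E" for E
  proof -
    have "0 \<le> (\<Sum>v\<in>TT \<sigma> \<inter> nb \<sigma> cur_v E. (wt \<sigma> v)\<^sup>2 * ww (lev \<sigma> v))"
      using ww_nonneg by (intro sum_nonneg mult_nonneg_nonneg) auto
    moreover have "(if d / 2 \<le> new_deg E then new_deg E * ((a / (1 + real (card (nb \<sigma> cur_v E))))\<^sup>2 * ww (Suc s)) else 0) \<le> a\<^sup>2 * ww (Suc s) / d * ?z E"
    proof (cases "d / 2 \<le> new_deg E")
      case True
      have D0: "0 < new_deg E" using True dpos by linarith
      have "new_deg E \<le> 1 + real (card (nb \<sigma> cur_v E))" using nb_card[of E] by (simp add: sum_nonneg)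
      hence "(a / (1 + real (card (nb \<sigma> cur_v E))))\<^sup>2 \<le> (a / new_deg E)\<^sup>2"
        using a D0 by (intro power_mono divide_left_mono) auto
      hence "new_deg E * ((a / (1 + real (card (nb \<sigma> cur_v E))))\<^sup>2 * ww (Suc s)) \<le> new_deg E * ((a / new_deg E)\<^sup>2 * ww (Suc s))"
        using D0 ww_nonneg by (intro mult_left_mono mult_right_mono) auto
      also have "\<dots> = a\<^sup>2 * ww (Suc s) / d * (d / new_deg E)"
        using D0 dpos by (simp add: power_divide power2_eq_square field_simps)
      finally show ?thesis using True by simp
    qed simp
    ultimately have "(\<Sum>v\<in>TT (nxt \<sigma> E). (wt (nxt \<sigma> E) v)\<^sup>2 * ww (lev (nxt \<sigma> E) v))
      \<le> (\<Sum>v\<in>TT \<sigma>. (wt \<sigma> v)\<^sup>2 * ww (lev \<sigma> v)) - a\<^sup>2 * ww s + a\<^sup>2 * ww (Suc s) / d * ?z E"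
      using nxt_sum[of "\<lambda>x l. x\<^sup>2 * ww l" E, folded s_def a_def] by linarith
    hence "F2 (nxt \<sigma> E) \<le> l2 * ((\<Sum>v\<in>TT \<sigma>. (wt \<sigma> v)\<^sup>2 * ww (lev \<sigma> v)) - a\<^sup>2 * ww s + a\<^sup>2 * ww (Suc s) / d * ?z E - 10 ^ 6)"
      unfolding F2_def using l2 by (intro mult_left_mono) auto
    thus ?thesis by (simp add: F2_def \<kappa>_def algebra_simps)
  qed
  hence "expect (pot_edges n) p (\<lambda>E. exp (F2 (nxt \<sigma> E))) \<le> expect (pot_edges n) p (\<lambda>E. exp (F2 \<sigma> - l2 * a\<^sup>2 * ww s) * exp (\<kappa> * ?z E))"
    by (intro expect_mono finite_pot_edges) (simp only: exp_add[symmetric] exp_le_cancel_iff)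
  also have "\<dots> \<le> expect (pot_edges n) p (\<lambda>E. exp (F2 \<sigma> - l2 * a\<^sup>2 * ww s) * (1 + \<kappa> * (1 + 2 * \<kappa>) * ?z E))"
  proof (intro expect_mono finite_pot_edges mult_left_mono)
    fix E
    define z where "z = ?z E"
    have z: "0 \<le> z" "z \<le> 2"
      using dpos D_nonneg[of E] by (auto simp: z_def field_simps)
    have kz: "\<kappa> * z \<le> 1" using mult_mono[of \<kappa> "1/16" z 2] ksmall half k0 z by simp
    have "exp (\<kappa> * z) \<le> 1 + \<kappa> * z + (\<kappa> * z)\<^sup>2" using k0 z kz by (intro exp_le_quadratic) auto
    also have "(\<kappa> * z)\<^sup>2 \<le> \<kappa> * (2 * \<kappa>) * z"
      using mult_left_mono[OF z(2), of "\<kappa> * \<kappa> * z"] k0 z by (simp add: power2_eq_square mult_ac)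
    finally show "exp (\<kappa> * ?z E) \<le> 1 + \<kappa> * (1 + 2 * \<kappa>) * ?z E" by (simp add: z_def algebra_simps)
  qed simp
  also have "\<dots> = exp (F2 \<sigma> - l2 * a\<^sup>2 * ww s) * (1 + \<kappa> * (1 + 2 * \<kappa>) * expect (pot_edges n) p ?z)"
    by (subst integral_mult_right_zero, subst Bochner_Integration.integral_add) auto
  also have "\<dots> \<le> exp (F2 \<sigma> - l2 * a\<^sup>2 * ww s) * (1 + l2 * a\<^sup>2 * ww s)"
  proof (intro mult_left_mono add_left_mono)
    have "\<kappa> * (1 + 2 * \<kappa>) * expect (pot_edges n) p ?z \<le> \<kappa> * (1 + 2 * \<kappa>) * (1 + 6 / d)"
      using inv_D[OF S_facts] k0 by (intro mult_left_mono) auto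
    also have "\<dots> = l2 * a\<^sup>2 * (ww (Suc s) * (1 + 6 / d) / d) * (1 + 2 * \<kappa>)" by (simp add: \<kappa>_def)
    also have "\<dots> \<le> l2 * a\<^sup>2 * (ww s * (1 - (1/2)^s / 4)) * (1 + 2 * \<kappa>)"
      using ww_step k0 l2 by (intro mult_right_mono mult_left_mono) auto
    also have "\<dots> = l2 * a\<^sup>2 * ww s * ((1 - (1/2)^s / 4) * (1 + 2 * \<kappa>))" by simp
    also have "\<dots> \<le> l2 * a\<^sup>2 * ww s * 1"
    proof (intro mult_left_mono)
      have "(1 - (1/2)^s / 4) * (1 + 2 * \<kappa>) \<le> (1 - (1/2)^s / 4) * (1 + (1/2)^s / 4)"
        using ksmall half by (intro mult_left_mono) auto
      also have "\<dots> = 1 - ((1/2)^s / 4)\<^sup>2" by (simp add: power2_eq_square algebra_simps)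
      also have "\<dots> \<le> 1" by simp
      finally show "(1 - (1/2)^s / 4) * (1 + 2 * \<kappa>) \<le> 1" .
    qed (use l2 ww_nonneg in auto)
    finally show "\<kappa> * (1 + 2 * \<kappa>) * expect (pot_edges n) p ?z \<le> l2 * a\<^sup>2 * ww s" by simp
  qed simp
  also have "\<dots> \<le> exp (F2 \<sigma> - l2 * a\<^sup>2 * ww s) * exp (l2 * a\<^sup>2 * ww s)"
    by (intro mult_left_mono exp_ge_add_one_self) simp
  also have "\<dots> = exp (F2 \<sigma>)" by (simp add: exp_add[symmetric])
  finally show ?thesis .
qed

lemma step1: "expect (pot_edges n) p (\<lambda>E. exp (F1 (nxt \<sigma> E))) \<le> exp (F1 \<sigma>)"
proof -
  define s where "s = lev \<sigma> cur_v"
  define a where "a = wt \<sigma> cur_v"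
  \<comment> \<open>What one edge from the current vertex to the waiting vertex \<open>v\<close> can
    cost: it enlarges the degree, losing at most \<open>2 / d * a\<close> of the current mass, and
    it removes \<open>v\<close> from \<open>TT\<close> together with its own mass.\<close>
  define c where "c = (\<lambda>v. 2 / d * a + (if v \<in> TT \<sigma> then wt \<sigma> v else 0))"
  define A where "A = 100 / d"
  \<comment> \<open>Rate, per unit of current mass, charged for the event of fewer than
    \<open>d / 2\<close> new neighbours; \<open>A\<close> bounds every single weight, and
    \<open>exp (l1 * A) / A\<close> comes from \<open>exp_chord\<close>.\<close>
  define q where "q = exp (- (d / 10)) * exp (l1 * A) / A"
  note vd = validD[OF va(1)]
  note uf = u_facts
  have s: "1 \<le> s" "s < t1" using uf by (auto simp: s_def)
  have a: "0 \<le> a" "a \<le> A" using uf by (auto simp: a_def A_def)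
  have A: "0 < A" using dpos by (simp add: A_def)
  have k2: "0 \<le> k2" using p dpos by (simp add: k2_def)
  have k2A: "k2 = p / (2 * A) * exp (l1 * (2 * A))" using dpos by (simp add: k2_def A_def mult_ac)
  have k1: "0 \<le> k1" using l1 dpos k2 Rm by (simp add: k1_def add_nonneg_nonneg)
  have k1A: "k1 = l1 * (2 / d) + q + k2 * (2 / d) * Rm"
    using dpos by (simp add: k1_def q_def A_def mult_ac)
  have c: "0 \<le> c v" "c v \<le> 2 * A" for v
  proof -
    show "0 \<le> c v" using a dpos vd(10) by (auto simp: c_def)
    have "2 / d * a \<le> 1 * A" using a d1 by (intro mult_mono) (auto simp: field_simps)
    moreover have "(if v \<in> TT \<sigma> then wt \<sigma> v else 0) \<le> A" using wt_le_A[OF va(1)] A by (auto simp: A_def)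
    ultimately show "c v \<le> 2 * A" unfolding c_def by linarith
  qed
  have KV: "waiting \<subseteq> vertices n" "cur_v \<notin> waiting" using vd(2) by auto
  have fK: "finite waiting" using vd(6) by auto
  have sumc: "(\<Sum>v\<in>waiting. c v) \<le> 2 / d * a * Rm + 1"
  proof -
    have "(\<Sum>v\<in>waiting. c v) = real (card waiting) * (2 / d * a) + (\<Sum>v\<in>waiting. if v \<in> TT \<sigma> then wt \<sigma> v else 0)"
      by (simp add: c_def sum.distrib)
    moreover have "(\<Sum>v\<in>waiting. if v \<in> TT \<sigma> then wt \<sigma> v else 0) \<le> 1"
    proof -
      have "(\<Sum>v\<in>waiting. if v \<in> TT \<sigma> then wt \<sigma> v else 0) = (\<Sum>v\<in>waiting \<inter> TT \<sigma>. wt \<sigma> v)"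
        using fK by (simp add: sum.inter_restrict)
      also have "\<dots> \<le> (\<Sum>v\<in>TT \<sigma>. wt \<sigma> v)" using vd by (intro sum_mono2) auto
      finally show ?thesis using vd(12) by simp
    qed
    moreover have "real (card waiting) * (2 / d * a) \<le> Rm * (2 / d * a)"
    proof (intro mult_right_mono)
      have "real (card waiting) \<le> real (card (RR \<sigma>))" using card_mono[OF vd(6), of waiting] by auto
      thus "real (card waiting) \<le> Rm" using va(2) by (simp add: active_def)
    qed (use a dpos in auto)
    ultimately show ?thesis by (simp add: mult_ac)
  qed
  let ?B = "\<lambda>E. of_bool (new_deg E < d / 2) :: real"
  let ?C = "\<lambda>E. \<Sum>v\<in>waiting. c v * of_bool (adj E cur_v v)"
  have bnd: "F1 (nxt \<sigma> E) \<le> F1 \<sigma> + l1 * (2 / d * a + a * ?B E + ?C E) - k1 * a - k2" for E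
  proof -
    let ?N = "nb \<sigma> cur_v E"
    let ?x = "a / (1 + real (card ?N))"
    let ?k = "\<Sum>v\<in>waiting. of_bool (adj E cur_v v) :: real"
    let ?I = "\<Sum>v\<in>TT \<sigma> \<inter> ?N. wt \<sigma> v"
    have cN: "real (card ?N) = new_deg E + ?k" by (rule nb_card)
    have k0: "0 \<le> ?k" by (simp add: sum_nonneg)
    note D0 = D_nonneg[of E]
    let ?G = "if d / 2 \<le> new_deg E then new_deg E * ?x else 0"
    have m: "(\<Sum>v\<in>TT (nxt \<sigma> E). wt (nxt \<sigma> E) v) = (\<Sum>v\<in>TT \<sigma>. wt \<sigma> v) - a - ?I + ?G"
      using nxt_sum[of "\<lambda>x _. x" E] by (simp add: a_def)
    have Ceq: "?C E = 2 / d * a * ?k + ?I"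
    proof -
      have "?I = (\<Sum>v\<in>?N \<inter> RR \<sigma>. if v \<in> TT \<sigma> then wt \<sigma> v else 0)"
        using nb_props(1)[OF va, of cur_v E] vd(3)
        by (subst sum.inter_restrict[symmetric]) (auto intro!: sum.cong)
      also have "\<dots> = (\<Sum>v\<in>waiting. (if v \<in> TT \<sigma> then wt \<sigma> v else 0) * of_bool (adj E cur_v v))"
        by (rule sum_known[OF va(1)])
      finally show ?thesis by (simp add: c_def distrib_right sum.distrib sum_distrib_left)
    qed
    \<comment> \<open>The mass sent to new vertices falls short by the fraction
      \<open>(1 + ?k) / (1 + new_deg E + ?k)\<close>: the 1 is the step back to the parent,
      \<open>?k\<close> counts the edges to waiting vertices.\<close>
    have G: "a - ?G \<le> 2 / d * a + a * ?B E + 2 / d * a * ?k"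
    proof (cases "d / 2 \<le> new_deg E")
      case True
      have pos: "0 < 1 + new_deg E + ?k" using D0 k0 by linarith
      have "a - new_deg E * ?x = a * (1 + ?k) / (1 + new_deg E + ?k)"
        unfolding cN using pos by (simp add: field_simps)
      also have "\<dots> \<le> a * (1 + ?k) / (d / 2)"
        using True a k0 dpos by (intro divide_left_mono) (auto intro!: mult_pos_pos)
      also have "a * (1 + ?k) / (d / 2) = 2 / d * a + 2 / d * a * ?k"
        by (simp add: algebra_simps add_divide_distrib)
      finally have "a - new_deg E * ?x \<le> 2 / d * a + 2 / d * a * ?k" .
      moreover have "?G = new_deg E * ?x" "?B E = 0" using True by auto
      ultimately show ?thesis by simp
    next
      case False
      thus ?thesis using a dpos k0 by simp
    qed
    have G1: "?G \<le> a"
    proof -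
      have "new_deg E * a \<le> a * (1 + new_deg E + ?k)" using a D0 k0 by (simp add: algebra_simps)
      thus ?thesis unfolding cN using a D0 k0 by (simp add: field_simps)
    qed
    have H: "(\<Sum>v\<in>TT (nxt \<sigma> E). wt (nxt \<sigma> E) v * (real t1 - real (lev (nxt \<sigma> E) v)))
       \<le> (\<Sum>v\<in>TT \<sigma>. wt \<sigma> v * (real t1 - real (lev \<sigma> v))) - a"
    proof -
      have "0 \<le> (\<Sum>v\<in>TT \<sigma> \<inter> ?N. wt \<sigma> v * (real t1 - real (lev \<sigma> v)))"
        using vd(9,10) by (intro sum_nonneg) auto
      moreover have "(if d / 2 \<le> new_deg E then new_deg E * (?x * (real t1 - real (Suc s))) else 0) \<le> a * (real t1 - real s - 1)"
      proof -
        have "real t1 - real (Suc s) = real t1 - real s - 1" by simp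
        hence "(if d / 2 \<le> new_deg E then new_deg E * (?x * (real t1 - real (Suc s))) else 0) = ?G * (real t1 - real s - 1)"
          by (simp only: if_distrib[of "\<lambda>x. x * _"] mult.assoc mult_zero_left)
        also have "\<dots> \<le> a * (real t1 - real s - 1)" using G1 s by (intro mult_right_mono) auto
        finally show ?thesis .
      qed
      ultimately show ?thesis
        using nxt_sum[of "\<lambda>x l. x * (real t1 - real l)" E, folded s_def a_def] by (simp add: algebra_simps)
    qed
    have P: "real (card (PP (nxt \<sigma> E))) = real (card (PP \<sigma>)) + 1"
      using uf(6) vd(7) by (simp add: PP_nxt)
    have "F1 (nxt \<sigma> E) \<le> l1 * (1 - ((\<Sum>v\<in>TT \<sigma>. wt \<sigma> v) - a - ?I + ?G) - 1 / 100)
       + k1 * ((\<Sum>v\<in>TT \<sigma>. wt \<sigma> v * (real t1 - real (lev \<sigma> v))) - a) + k2 * (Rm - (real (card (PP \<sigma>)) + 1))"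
      unfolding F1_def m P using mult_left_mono[OF H k1] by simp
    also have "\<dots> = F1 \<sigma> + l1 * ((a - ?G) + ?I) - k1 * a - k2"
      by (simp add: F1_def algebra_simps)
    also have "\<dots> \<le> F1 \<sigma> + l1 * (2 / d * a + a * ?B E + ?C E) - k1 * a - k2"
      using mult_left_mono[of "(a - ?G) + ?I" "2 / d * a + a * ?B E + ?C E" l1] G Ceq l1 by simp
    finally show ?thesis .
  qed
  have "expect (pot_edges n) p (\<lambda>E. exp (F1 (nxt \<sigma> E)))
     \<le> expect (pot_edges n) p (\<lambda>E. exp (F1 \<sigma> + l1 * (2 / d * a) - k1 * a - k2) * (exp (l1 * a * ?B E) * exp (\<Sum>v\<in>waiting. l1 * c v * of_bool (adj E cur_v v))))"
  proof (intro expect_mono finite_pot_edges)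
    fix E
    have "exp (F1 (nxt \<sigma> E)) \<le> exp (F1 \<sigma> + l1 * (2 / d * a + a * ?B E + ?C E) - k1 * a - k2)"
      using bnd by simp
    also have "\<dots> = exp (F1 \<sigma> + l1 * (2 / d * a) - k1 * a - k2) * (exp (l1 * a * ?B E) * exp (\<Sum>v\<in>waiting. l1 * c v * of_bool (adj E cur_v v)))"
      by (simp only: exp_add[symmetric]) (simp add: algebra_simps sum_distrib_left)
    finally show "exp (F1 (nxt \<sigma> E)) \<le> exp (F1 \<sigma> + l1 * (2 / d * a) - k1 * a - k2) * (exp (l1 * a * ?B E) * exp (\<Sum>v\<in>waiting. l1 * c v * of_bool (adj E cur_v v)))" .
  qed
  also have "\<dots> = exp (F1 \<sigma> + l1 * (2 / d * a) - k1 * a - k2) *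
      (expect (pot_edges n) p (\<lambda>E. exp (l1 * a * ?B E)) * expect (pot_edges n) p (\<lambda>E. exp (\<Sum>v\<in>waiting. l1 * c v * of_bool (adj E cur_v v))))"
  proof -
    have o: "on_edges (star cur_v unseen) new_deg" using on_edges_star_sum[of cur_v unseen "\<lambda>_. 1"] by simp
    have "expect (pot_edges n) p (\<lambda>E. exp (l1 * a * ?B E) * exp (\<Sum>v\<in>waiting. l1 * c v * of_bool (adj E cur_v v)))
      = expect (pot_edges n) p (\<lambda>E. exp (l1 * a * ?B E)) * expect (pot_edges n) p (\<lambda>E. exp (\<Sum>v\<in>waiting. l1 * c v * of_bool (adj E cur_v v)))"
    proof (rule expect_indep[OF finite_pot_edges])
      show "on_edges (star cur_v unseen) (\<lambda>E. exp (l1 * a * ?B E))"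
        by (rule on_edges_comp[OF o, where g="\<lambda>x. exp (l1 * a * of_bool (x < d / 2))"])
      show "on_edges (star cur_v waiting) (\<lambda>E. exp (\<Sum>v\<in>waiting. l1 * c v * of_bool (adj E cur_v v)))"
        by (rule on_edges_comp[OF on_edges_star_sum])
      show "star cur_v unseen \<inter> star cur_v waiting = {}" by (auto simp: star_def doubleton_eq_iff)
    qed
    thus ?thesis by simp
  qed
  also have "\<dots> \<le> exp (F1 \<sigma> + l1 * (2 / d * a) - k1 * a - k2) * (exp (q * a) * exp (k2 * (2 / d * a * Rm + 1)))"
  proof (intro mult_left_mono mult_mono)
    have "expect (pot_edges n) p (\<lambda>E. exp (l1 * a * ?B E)) = expect (pot_edges n) p (\<lambda>E. 1 + (exp (l1 * a) - 1) * ?B E)"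
      by (rule expect_cong) auto
    also have "\<dots> = 1 + (exp (l1 * a) - 1) * Pr (pot_edges n) p (\<lambda>E. new_deg E < d / 2)"
      by (simp add: expect_indicator)
    also have "\<dots> \<le> 1 + (a / A * exp (l1 * A)) * exp (- (d / 10))"
      using exp_chord[OF l1 a A] low_D[OF S_facts] a l1 A by (intro add_left_mono mult_mono) auto
    also have "\<dots> = 1 + q * a" by (simp add: q_def)
    also have "\<dots> \<le> exp (q * a)" by (rule exp_ge_add_one_self)
    finally show "expect (pot_edges n) p (\<lambda>E. exp (l1 * a * ?B E)) \<le> exp (q * a)" .
    have "expect (pot_edges n) p (\<lambda>E. exp (\<Sum>v\<in>waiting. l1 * c v * of_bool (adj E cur_v v))) \<le> exp (p * (\<Sum>v\<in>waiting. exp (l1 * c v) - 1))"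
      by (rule expect_exp_star[OF p uf(5) KV])
    also have "\<dots> \<le> exp (p * (\<Sum>v\<in>waiting. c v / (2 * A) * exp (l1 * (2 * A))))"
      using p c A l1 by (simp only: exp_le_cancel_iff) (intro mult_left_mono sum_mono exp_chord, auto)
    also have "p * (\<Sum>v\<in>waiting. c v / (2 * A) * exp (l1 * (2 * A))) = k2 * (\<Sum>v\<in>waiting. c v)"
      by (simp add: k2A sum_distrib_left sum_distrib_right sum_divide_distrib mult_ac)
    also have "exp \<dots> \<le> exp (k2 * (2 / d * a * Rm + 1))"
      using sumc k2 by (simp add: mult_left_mono)
    finally show "expect (pot_edges n) p (\<lambda>E. exp (\<Sum>v\<in>waiting. l1 * c v * of_bool (adj E cur_v v))) \<le> exp (k2 * (2 / d * a * Rm + 1))" .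
  qed (auto intro!: Bochner_Integration.integral_nonneg)
  \<comment> \<open>\<open>k1\<close> is the sum of the three rates proportional to
    \<open>a\<close>, and the decrease by \<open>k2\<close> pays for the constant 1, so the
    exponents cancel exactly.\<close>
  also have "\<dots> = exp (F1 \<sigma>)"
    by (simp only: exp_add[symmetric]) (simp add: k1A algebra_simps)
  finally show ?thesis .
qed

lemma step_\<Phi>: "expect (pot_edges n) p (\<lambda>E. \<Phi> (nxt \<sigma> E)) \<le> \<Phi> \<sigma>"
  unfolding \<Phi>_def using step1 step2 step3 by (simp add: Bochner_Integration.integral_add)

end

end

subsection \<open>The last three steps\<close>

definition capped_flow :: "nat set \<Rightarrow> (nat \<Rightarrow> nat set) \<Rightarrow> (nat \<Rightarrow> real) \<Rightarrow> (nat \<Rightarrow> real) \<Rightarrow> (nat set \<Rightarrow> bool) \<Rightarrow> nat \<Rightarrow> real" where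
  "capped_flow W S c b E w = (if w \<in> W then min (\<Sum>u\<in>S w. b u * of_bool (adj E w u)) (c w) else 0)"

text \<open>Rescales only when the total exceeds 1, so it never raises a value;
  \<open>spread\<close> asks for a total mean of at most 1.\<close>

definition unit_mass :: "nat set \<Rightarrow> (nat \<Rightarrow> real) \<Rightarrow> nat \<Rightarrow> real" where
  "unit_mass W r w = r w / max 1 (sum r W)"

lemma on_edges_capped_flow: "on_edges (\<Union>w\<in>W. star w (S w)) (capped_flow W S c b)"
proof (rule on_edgesI, rule ext)
  fix E E' :: "nat set \<Rightarrow> bool" and w
  assume *: "\<And>e. e \<in> (\<Union>w\<in>W. star w (S w)) \<Longrightarrow> E e = E' e"
  show "capped_flow W S c b E w = capped_flow W S c b E' w"
  proof (cases "w \<in> W")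
    case True
    have "(\<Sum>u\<in>S w. b u * of_bool (adj E w u)) = (\<Sum>u\<in>S w. b u * of_bool (adj E' w u))"
      by (rule on_edgesD[OF on_edges_star_sum]) (use * True in blast)
    thus ?thesis by (simp add: capped_flow_def)
  qed (simp add: capped_flow_def)
qed

lemma capped_flow_nonneg:
  assumes "\<And>u. 0 \<le> b u" "\<And>w. w \<in> W \<Longrightarrow> 0 \<le> c w" shows "0 \<le> capped_flow W S c b E w"
  using assms by (auto simp: capped_flow_def intro!: sum_nonneg)

text \<open>The last claim carries the iteration: a pointwise cap together with total mass at most 1
  bounds the squared norm, so the cap of one step is the variance bound of the next.\<close>

lemma unit_mass:
  assumes r: "\<And>w. 0 \<le> r w" "\<And>w. r w \<le> c" and c: "0 \<le> c"
  shows "0 \<le> unit_mass W r w" "unit_mass W r w \<le> r w" "unit_mass W r w \<le> c" "sum (unit_mass W r) W \<le> 1"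
    "k \<le> 1 \<Longrightarrow> k \<le> sum r W \<Longrightarrow> k \<le> sum (unit_mass W r) W"
    "finite W \<Longrightarrow> (\<Sum>w\<in>W. (unit_mass W r w)\<^sup>2) \<le> c"
proof -
  let ?s = "sum r W"
  have s0: "0 \<le> ?s" using r by (simp add: sum_nonneg)
  show 1: "0 \<le> unit_mass W r w" for w using r by (simp add: unit_mass_def)
  show 2: "unit_mass W r w \<le> r w" for w
  proof -
    have "r w / max 1 ?s \<le> r w / 1" by (rule divide_left_mono) (use r in auto)
    thus ?thesis by (simp add: unit_mass_def)
  qed
  show 3: "unit_mass W r w \<le> c" for w using 2 r order_trans by blast
  have eq: "sum (unit_mass W r) W = ?s / max 1 ?s"
    by (simp add: unit_mass_def sum_divide_distrib)
  show 4: "sum (unit_mass W r) W \<le> 1" unfolding eq by (simp add: max_def)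
  show "k \<le> 1 \<Longrightarrow> k \<le> ?s \<Longrightarrow> k \<le> sum (unit_mass W r) W" unfolding eq by (simp add: max_def)
  have "(\<Sum>w\<in>W. (unit_mass W r w)\<^sup>2) \<le> (\<Sum>w\<in>W. c * unit_mass W r w)"
    unfolding power2_eq_square by (intro sum_mono mult_right_mono 1 3)
  also have "\<dots> \<le> c" using mult_left_mono[OF 4 c] by (simp add: sum_distrib_left)
  finally show "(\<Sum>w\<in>W. (unit_mass W r w)\<^sup>2) \<le> c" .
qed

text \<open>\<open>M\<close>, \<open>cap1\<close> and \<open>cap2\<close> bound the squared norm
  before each of the three steps. The conditions \<open>cA\<close>, \<open>cB\<close> and
  \<open>cC\<close> make the mass lost by truncation at most 1/200 per estimate; \<open>Rs\<close>
  keeps at least 99/100 of the vertices available.\<close>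

locale final_steps = exploration +
  fixes M cap1 cap2 smax :: real
  assumes caps: "0 < cap1" "0 < cap2" and M: "0 \<le> M"
    and n200: "200 \<le> n"
    and cA: "M \<le> d * cap1 / 100" "2 \<le> real n * cap1"
    and cB: "cap1 \<le> d * cap2 / 100" "2 \<le> real n * cap2"
    and cC: "real n * cap2 \<le> d / 2000"
    and Rs: "200 * Rm \<le> real n" "200 * smax \<le> real n"
begin

text \<open>Mass \<open>wt\<close> on \<open>TT\<close> moves to \<open>b1\<close> on \<open>S1\<close>, then to \<open>b2\<close> and \<open>r3\<close> on the
  vertices outside \<open>S1\<close>, every vertex being treated as if it had degree \<open>21/20 d\<close>.  The last
  step takes place inside a single set of vertices; there, \<open>lo\<close> and \<open>hi\<close> separate the
  edges to smaller and to larger neighbours, so that either sum has independent terms.\<close>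

definition bt :: real where "bt = 20 / (21 * d)"

definition UU :: "st \<Rightarrow> nat set" where "UU \<sigma> = vertices n - RR \<sigma>"
definition S1 :: "st \<Rightarrow> (nat set \<Rightarrow> bool) \<Rightarrow> nat set" where
  "S1 \<sigma> E = {w \<in> UU \<sigma>. \<exists>u\<in>TT \<sigma>. adj E w u}"
definition r1 where "r1 \<sigma> E = capped_flow (UU \<sigma>) (\<lambda>_. TT \<sigma>) (\<lambda>_. cap1) (\<lambda>u. bt * (if u \<in> TT \<sigma> then wt \<sigma> u else 0)) E"
definition b1 where "b1 \<sigma> E = unit_mass (UU \<sigma>) (r1 \<sigma> E)"
definition r2 where "r2 \<sigma> S b E = capped_flow (UU \<sigma> - S) (\<lambda>_. S) (\<lambda>_. cap2) (\<lambda>w. bt * b w) E"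
definition b2 where "b2 \<sigma> S b E = unit_mass (UU \<sigma> - S) (r2 \<sigma> S b E)"
definition lo where "lo U b E = capped_flow U (\<lambda>y. {v\<in>U. v < y}) (\<lambda>y. p * (\<Sum>v\<in>{v\<in>U. v < y}. bt * b v) + 1 / (40 * real n)) (\<lambda>v. bt * b v) E"
definition hi where "hi U b E = capped_flow U (\<lambda>y. {v\<in>U. y < v}) (\<lambda>y. p * (\<Sum>v\<in>{v\<in>U. y < v}. bt * b v) + 1 / (40 * real n)) (\<lambda>v. bt * b v) E"
definition r3 where "r3 U b E y = lo U b E y + hi U b E y"

lemma bt: "0 < bt" "p * bt = 20 / (21 * real n)" "p * bt\<^sup>2 \<le> 1 / (real n * d)"
proof -
  show "0 < bt" using dpos by (simp add: bt_def)
  have pe: "p = d / real n" using d(1) dpos by (simp add: field_simps)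
  show "p * bt = 20 / (21 * real n)" using dpos unfolding bt_def by (subst pe) (simp add: field_simps)
  hence "p * bt\<^sup>2 = 20 / (21 * real n) * bt" by (simp add: power2_eq_square mult.assoc[symmetric])
  hence "p * bt\<^sup>2 = 20 / (21 * real n) * (20 / (21 * d))" by (simp add: bt_def)
  also have "\<dots> \<le> 1 / (real n * d)" using dpos by (simp add: field_simps)
  finally show "p * bt\<^sup>2 \<le> 1 / (real n * d)" .
qed

lemma spread_stage:
  assumes W: "W \<subseteq> vertices n" "\<rho> * real n \<le> real (card W)" and S: "S \<subseteq> vertices n" "W \<inter> S = {}"
    and b: "\<And>u. 0 \<le> b u" "sum b S \<le> 1" "m \<le> sum b S" "(\<Sum>u\<in>S. (b u)\<^sup>2) \<le> V"
    and c: "0 < c" "2 \<le> real n * c" "V \<le> d * c / 100" and m: "0 \<le> m" "0 \<le> \<rho>" "k \<le> 20 / 21 * \<rho> * m - 1 / 100"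
  shows "Pr (pot_edges n) p (\<lambda>E. sum (capped_flow W (\<lambda>_. S) (\<lambda>_. c) (\<lambda>u. bt * b u) E) W < k) \<le> exp (- (1 / (80000 * c)))"
proof -
  have n0: "0 < real n" using dpos by simp
  have mu: "p * (\<Sum>u\<in>S. bt * b u) = 20 / (21 * real n) * sum b S"
    using bt(2) by (simp add: sum_distrib_left[symmetric] mult.assoc[symmetric])
  have mu1: "p * (\<Sum>u\<in>S. bt * b u) \<le> 20 / (21 * real n) * 1"
    unfolding mu using b(2) by (intro mult_left_mono) auto
  have c2: "20 / (21 * real n) * 1 \<le> c / 2" using c n0 by (simp add: field_simps)
  have cW: "real (card W) \<le> real n" using card_mono[OF finite_vertices W(1)] by simp
  have V2: "(\<Sum>u\<in>S. (bt * b u)\<^sup>2) \<le> bt\<^sup>2 * V"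
    using b(4) by (simp add: power_mult_distrib sum_distrib_left[symmetric] mult_left_mono)
  have V0: "0 \<le> V" using b(4) sum_nonneg[of S "\<lambda>u. (b u)\<^sup>2"] by force
  \<comment> \<open>A vertex receives mean mass at most \<open>20 / (21 * n) \<le> c / 2\<close>, so
    half the cap is available as the gap \<open>g\<close>. Truncation and deviation may cost 1/200
    each, which is the 1/100 in the bound for \<open>k\<close>.\<close>
  have "Pr (pot_edges n) p (\<lambda>E. (\<Sum>w\<in>W. min (\<Sum>u\<in>S. (bt * b u) * of_bool (adj E w u)) c) < k)
     \<le> exp (- ((1/200)\<^sup>2 / (2 * c)))"
  proof (rule spread[OF p W(1), where g="c / 2" and V="bt\<^sup>2 * V" and S="\<lambda>_. S" and c="\<lambda>_. c"])
    show "p * (\<Sum>u\<in>S. bt * b u) + c / 2 \<le> c" using mu1 c2 by linarith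
    have "(\<Sum>w\<in>W. p * (\<Sum>u\<in>S. bt * b u)) = real (card W) * (p * (\<Sum>u\<in>S. bt * b u))" by simp
    also have "\<dots> \<le> real n * (20 / (21 * real n) * 1)"
      by (rule mult_mono[OF cW mu1]) (use bt(1) b(1) p in \<open>auto intro!: mult_nonneg_nonneg sum_nonneg\<close>)
    also have "\<dots> \<le> 1" using n0 by simp
    finally show "(\<Sum>w\<in>W. p * (\<Sum>u\<in>S. bt * b u)) \<le> 1" .
    have l1: "20 / 21 * \<rho> * m \<le> (\<Sum>w\<in>W. p * (\<Sum>u\<in>S. bt * b u))"
    proof -
      have "20 / (21 * real n) * ((\<rho> * real n) * m) \<le> 20 / (21 * real n) * (real (card W) * sum b S)"
        using W(2) b m n0 by (intro mult_left_mono mult_mono) auto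
      thus ?thesis using n0 by (simp add: mu mult_ac)
    qed
    have "real (card W) * (p * (bt\<^sup>2 * V) / (4 * (c / 2))) \<le> real n * ((1 / (real n * d)) * V / (2 * c))"
    proof (rule mult_mono[OF cW])
      have "p * (bt\<^sup>2 * V) \<le> 1 / (real n * d) * V" using mult_right_mono[OF bt(3) V0] by (simp add: mult_ac)
      thus "p * (bt\<^sup>2 * V) / (4 * (c / 2)) \<le> 1 / (real n * d) * V / (2 * c)"
        using divide_right_mono[of "p * (bt\<^sup>2 * V)" "1 / (real n * d) * V" "2 * c"] c(1) by simp
    qed (use V0 c p in auto)
    also have "\<dots> \<le> 1 / 200" using c dpos n0 by (simp add: field_simps)
    finally show "k \<le> (\<Sum>w\<in>W. p * (\<Sum>u\<in>S. bt * b u)) - real (card W) * (p * (bt\<^sup>2 * V) / (4 * (c / 2))) - 1 / 200"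
      using l1 m by linarith
  qed (use S W b bt c V2 in auto)
  moreover have "sum (capped_flow W (\<lambda>_. S) (\<lambda>_. c) (\<lambda>u. bt * b u) E) W = (\<Sum>w\<in>W. min (\<Sum>u\<in>S. (bt * b u) * of_bool (adj E w u)) c)" for E
    by (simp add: capped_flow_def)
  ultimately show ?thesis by (simp add: power2_eq_square)
qed

text \<open>The caps exceed the mean by only \<open>1 / (40 * n)\<close>: the arriving mass must not
  much exceed \<open>1 / n\<close> at any vertex, because only mass below the stationary
  distribution counts in the end. So the variance per vertex has to be a small multiple of
  \<open>1 / n^2\<close>, which \<open>cC\<close> provides.\<close>

lemma last_stage:
  assumes U: "U \<subseteq> vertices n" "99 / 100 * real n \<le> real (card U)"
    and b: "\<And>u. 0 \<le> b u" "sum b U \<le> 1" "85 / 100 \<le> sum b U" "(\<Sum>u\<in>U. (b u)\<^sup>2) \<le> cap2"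
  shows "Pr (pot_edges n) p (\<lambda>E. sum (r3 U b E) U < 76 / 100) \<le> 2 * exp (- (real n / 80000))"
proof -
  have n0: "0 < real n" using dpos by simp
  have fU: "finite U" by (rule finite_sub[OF U(1)])
  have cU: "real (card U) \<le> real n" using card_mono[OF finite_vertices U(1)] by simp
  define loss where "loss = real (card U) * (p * (bt\<^sup>2 * cap2) / (4 * (1 / (40 * real n))))"
  have loss: "loss \<le> 1 / 200"
  proof -
    have "loss \<le> real n * ((1 / (real n * d)) * cap2 / (4 * (1 / (40 * real n))))"
      unfolding loss_def
    proof (rule mult_mono[OF cU])
      have "p * (bt\<^sup>2 * cap2) \<le> 1 / (real n * d) * cap2"
        using mult_right_mono[OF bt(3), of cap2] caps by (simp add: mult_ac)
      thus "p * (bt\<^sup>2 * cap2) / (4 * (1 / (40 * real n))) \<le> 1 / (real n * d) * cap2 / (4 * (1 / (40 * real n)))"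
        using n0 by (intro divide_right_mono) auto
    qed (use caps p n0 in auto)
    also have "\<dots> = 10 * (real n * cap2) / d" using n0 dpos by (simp add: field_simps)
    also have "\<dots> \<le> 1 / 200" using cC dpos by (simp add: field_simps)
    finally show ?thesis .
  qed
  have part: "Pr (pot_edges n) p (\<lambda>E. sum (capped_flow U S (\<lambda>y. p * (\<Sum>v\<in>S y. bt * b v) + 1 / (40 * real n)) (\<lambda>v. bt * b v) E) U
       < (\<Sum>y\<in>U. p * (\<Sum>v\<in>S y. bt * b v)) - 1 / 100) \<le> exp (- (real n / 80000))"
    if S: "\<And>y. S y \<subseteq> U" "\<And>y. y \<notin> S y" "\<And>v w. \<not> (v \<in> S w \<and> w \<in> S v)" for S
  proof -
    have mu: "p * (\<Sum>v\<in>S y. bt * b v) \<le> 20 / (21 * real n)" for y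
    proof -
      have "sum b (S y) \<le> sum b U" by (rule sum_mono2[OF fU S(1)]) (use b in auto)
      hence "20 / (21 * real n) * sum b (S y) \<le> 20 / (21 * real n) * 1" using b by (intro mult_left_mono) auto
      moreover have "p * (\<Sum>v\<in>S y. bt * b v) = 20 / (21 * real n) * sum b (S y)"
        using bt(2) by (simp add: sum_distrib_left[symmetric] mult.assoc[symmetric])
      ultimately show ?thesis by simp
    qed
    have mu0: "0 \<le> p * (\<Sum>v\<in>S y. bt * b v)" for y
      using p bt b by (intro mult_nonneg_nonneg sum_nonneg) auto
    have "Pr (pot_edges n) p (\<lambda>E. (\<Sum>w\<in>U. min (\<Sum>u\<in>S w. (bt * b u) * of_bool (adj E w u)) (p * (\<Sum>v\<in>S w. bt * b v) + 1 / (40 * real n)))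
        < (\<Sum>y\<in>U. p * (\<Sum>v\<in>S y. bt * b v)) - 1 / 100) \<le> exp (- ((1/200)\<^sup>2 / (2 * (1 / real n))))"
    proof (rule spread[OF p U(1), where g="1 / (40 * real n)" and V="bt\<^sup>2 * cap2"])
      fix w assume w: "w \<in> U"
      show "S w \<subseteq> vertices n" using S(1) U(1) by blast
      have "(\<Sum>u\<in>S w. (b u)\<^sup>2) \<le> (\<Sum>u\<in>U. (b u)\<^sup>2)" by (rule sum_mono2[OF fU S(1)]) auto
      thus "(\<Sum>u\<in>S w. (bt * b u)\<^sup>2) \<le> bt\<^sup>2 * cap2"
        using b(4) by (simp add: power_mult_distrib sum_distrib_left[symmetric] mult_left_mono)
      have "p * (\<Sum>v\<in>S w. bt * b v) + 1 / (40 * real n) \<le> 20 / (21 * real n) + 1 / (40 * real n)"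
        by (intro add_right_mono mu)
      also have "\<dots> \<le> 1 / real n" using n0 by (simp add: field_simps)
      finally show "p * (\<Sum>v\<in>S w. bt * b v) + 1 / (40 * real n) \<le> 1 / real n" .
    next
      have "(\<Sum>w\<in>U. p * (\<Sum>u\<in>S w. bt * b u)) \<le> (\<Sum>w\<in>U. 20 / (21 * real n))" by (intro sum_mono mu)
      also have "\<dots> \<le> 1" using cU n0 by (simp add: field_simps)
      finally show "(\<Sum>w\<in>U. p * (\<Sum>u\<in>S w. bt * b u)) \<le> 1" .
    qed (use S bt b n0 loss in \<open>auto simp: loss_def\<close>)
    thus ?thesis using n0 by (simp add: capped_flow_def power2_eq_square)
  qed
  let ?L = "\<Sum>y\<in>U. p * (\<Sum>v\<in>{v\<in>U. v < y}. bt * b v)"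
  let ?H = "\<Sum>y\<in>U. p * (\<Sum>v\<in>{v\<in>U. y < v}. bt * b v)"
  \<comment> \<open>A vertex receives from all of \<open>U\<close> but itself, hence
    \<open>card U - 1\<close> in place of \<open>card U\<close>. The product is about 0.797, and two
    losses of 1/100 leave more than 0.76.\<close>
  have tot: "?L + ?H \<ge> 20 / 21 * (985 / 1000) * (85 / 100)"
  proof -
    have "?L + ?H = (\<Sum>y\<in>U. 20 / (21 * real n) * (sum b U - b y))"
      unfolding sum.distrib[symmetric]
    proof (intro sum.cong refl)
      fix y assume y: "y \<in> U"
      have "sum b U = sum b {v\<in>U. v < y} + sum b {v\<in>U. y < v} + b y"
      proof -
        have "U = {v\<in>U. v < y} \<union> ({v\<in>U. y < v} \<union> {y})" using y by auto
        hence "sum b U = sum b ({v\<in>U. v < y} \<union> ({v\<in>U. y < v} \<union> {y}))" by simp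
        also have "\<dots> = sum b {v\<in>U. v < y} + (sum b {v\<in>U. y < v} + sum b {y})"
          using fU by (subst sum.union_disjoint; (subst sum.union_disjoint)?) auto
        finally show ?thesis by simp
      qed
      thus "p * (\<Sum>v\<in>{v\<in>U. v < y}. bt * b v) + p * (\<Sum>v\<in>{v\<in>U. y < v}. bt * b v) = 20 / (21 * real n) * (sum b U - b y)"
        unfolding bt(2)[symmetric] by (simp add: sum_distrib_left[symmetric] algebra_simps)
    qed
    also have "\<dots> = 20 / (21 * real n) * ((real (card U) - 1) * sum b U)"
      unfolding sum_distrib_left[symmetric] sum_subtractf by (simp add: left_diff_distrib)
    also have "\<dots> \<ge> 20 / (21 * real n) * ((985 / 1000 * real n) * (85 / 100))"
    proof (intro mult_left_mono mult_mono)
      show "985 / 1000 * real n \<le> real (card U) - 1" using U(2) n200 by simp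
    qed (use b U(2) n200 in auto)
    finally show ?thesis using n0 by simp
  qed
  have "Pr (pot_edges n) p (\<lambda>E. sum (r3 U b E) U < 76 / 100) \<le>
    Pr (pot_edges n) p (\<lambda>E. sum (lo U b E) U < ?L - 1 / 100 \<or> sum (hi U b E) U < ?H - 1 / 100)"
    by (rule Pr_mono) (use tot in \<open>auto simp: r3_def sum.distrib\<close>)
  also have "\<dots> \<le> Pr (pot_edges n) p (\<lambda>E. sum (lo U b E) U < ?L - 1 / 100) + Pr (pot_edges n) p (\<lambda>E. sum (hi U b E) U < ?H - 1 / 100)"
    by (rule Pr_disj)
  also have "\<dots> \<le> exp (- (real n / 80000)) + exp (- (real n / 80000))"
    unfolding lo_def hi_def by (intro add_mono part) auto
  finally show ?thesis by simp
qed

definition \<delta>2 :: real where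
  "\<delta>2 = exp (- (1 / (80000 * cap1))) + exp (- (1 / (80000 * cap2))) + 2 * exp (- (real n / 80000))"

definition good :: "st \<Rightarrow> bool" where
  "good \<sigma> \<longleftrightarrow> real (card (RR \<sigma>)) \<le> Rm \<and> 99 / 100 \<le> sum (wt \<sigma>) (TT \<sigma>) \<and> (\<Sum>u\<in>TT \<sigma>. (wt \<sigma> u)\<^sup>2) \<le> M
     \<and> (\<forall>v\<in>TT \<sigma>. lev \<sigma> v = t1)"

text \<open>A large \<open>S1\<close> does not count as failure here; it is excluded in
  \<open>mix_from\<close> by the bound on the maximum degree.\<close>

definition fin_fail :: "st \<Rightarrow> (nat set \<Rightarrow> bool) \<Rightarrow> bool" where
  "fin_fail \<sigma> E \<longleftrightarrow> real (card (S1 \<sigma> E)) \<le> smax \<and>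
     sum (r3 (UU \<sigma> - S1 \<sigma> E) (b2 \<sigma> (S1 \<sigma> E) (b1 \<sigma> E) E) E) (UU \<sigma> - S1 \<sigma> E) < 76 / 100"

lemma r2_on: "S \<subseteq> UU \<sigma> \<Longrightarrow> on_edges (\<Union>v\<in>UU \<sigma> - S. star v S) (r2 \<sigma> S b)"
  unfolding r2_def by (rule on_edges_capped_flow)

lemma b2_on: "S \<subseteq> UU \<sigma> \<Longrightarrow> on_edges (\<Union>v\<in>UU \<sigma> - S. star v S) (b2 \<sigma> S b)"
  unfolding b2_def by (rule on_edges_comp[OF r2_on, where g="unit_mass (UU \<sigma> - S)"])

lemma r3_on: "on_edges {e. e \<subseteq> U} (r3 U b)"
proof (rule on_edgesI, rule ext)
  fix E E' :: "nat set \<Rightarrow> bool" and y assume *: "\<And>e. e \<in> {e. e \<subseteq> U} \<Longrightarrow> E e = E' e"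
  have "lo U b E = lo U b E'" "hi U b E = hi U b E'"
    unfolding lo_def hi_def by (rule on_edgesD[OF on_edges_capped_flow], rule *, auto simp: star_def)+
  thus "r3 U b E y = r3 U b E' y" by (simp add: r3_def)
qed

lemma r1_on: "on_edges (\<Union>w\<in>UU \<sigma>. star w (TT \<sigma>)) (r1 \<sigma>)"
  unfolding r1_def by (rule on_edges_capped_flow)

lemma S1_on: "on_edges (\<Union>w\<in>UU \<sigma>. star w (TT \<sigma>)) (S1 \<sigma>)"
proof (rule on_edgesI)
  fix E E' :: "nat set \<Rightarrow> bool" assume *: "\<And>e. e \<in> (\<Union>w\<in>UU \<sigma>. star w (TT \<sigma>)) \<Longrightarrow> E e = E' e"
  have "adj E w u = adj E' w u" if "w \<in> UU \<sigma>" "u \<in> TT \<sigma>" for w u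
  proof -
    have "E {w, u} = E' {w, u}" by (rule *) (use that in \<open>auto simp: star_def\<close>)
    thus ?thesis by (simp add: adj_def)
  qed
  thus "S1 \<sigma> E = S1 \<sigma> E'" by (auto simp: S1_def)
qed

lemma S1_b1_on: "on_edges (\<Union>w\<in>UU \<sigma>. star w (TT \<sigma>)) (\<lambda>E. (S1 \<sigma> E, b1 \<sigma> E))"
proof (rule on_edgesI)
  fix E E' :: "nat set \<Rightarrow> bool" assume *: "\<And>e. e \<in> (\<Union>w\<in>UU \<sigma>. star w (TT \<sigma>)) \<Longrightarrow> E e = E' e"
  have "r1 \<sigma> E = r1 \<sigma> E'" by (rule on_edgesD[OF r1_on]) (rule *)
  moreover have "S1 \<sigma> E = S1 \<sigma> E'" by (rule on_edgesD[OF S1_on]) (rule *)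
  ultimately show "(S1 \<sigma> E, b1 \<sigma> E) = (S1 \<sigma> E', b1 \<sigma> E')" by (simp add: b1_def)
qed

lemma r1_props:
  assumes "valid \<sigma>"
  shows "0 \<le> r1 \<sigma> E w" "r1 \<sigma> E w \<le> cap1" "w \<notin> S1 \<sigma> E \<Longrightarrow> r1 \<sigma> E w = 0"
proof -
  show "0 \<le> r1 \<sigma> E w" unfolding r1_def
    by (rule capped_flow_nonneg) (use bt caps validD(10)[OF assms] in auto)
  show "r1 \<sigma> E w \<le> cap1" using caps by (simp add: r1_def capped_flow_def)
  assume w: "w \<notin> S1 \<sigma> E"
  have "(\<Sum>u\<in>TT \<sigma>. bt * (if u \<in> TT \<sigma> then wt \<sigma> u else 0) * of_bool (adj E w u)) = 0" if "w \<in> UU \<sigma>"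
    using w that by (intro sum.neutral) (auto simp: S1_def)
  thus "r1 \<sigma> E w = 0" using caps by (simp add: r1_def capped_flow_def)
qed

lemma r2_props:
  assumes "\<And>w. 0 \<le> b w"
  shows "0 \<le> r2 \<sigma> S b E w" "r2 \<sigma> S b E w \<le> cap2"
  using caps bt assms by (auto simp: r2_def capped_flow_def intro!: sum_nonneg)

lemma UU_card:
  assumes "valid \<sigma>" "good \<sigma>"
  shows "real (card (UU \<sigma>)) \<ge> real n - Rm"
proof -
  have "real (card (UU \<sigma>)) = real n - real (card (RR \<sigma>))"
    using validD(2,6)[OF assms(1)] card_mono[OF finite_vertices validD(2)[OF assms(1)]]
    unfolding UU_def by (subst card_Diff_subset) auto
  thus ?thesis using assms(2) by (simp add: good_def)
qed

text \<open>Two nested conditionings: \<open>S1\<close> and \<open>b1\<close> read the edges between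
  \<open>TT\<close> and the undiscovered vertices, \<open>b2\<close> those between \<open>S1\<close>
  and the rest, \<open>r3\<close> those inside the rest. Each step multiplies the mass by 20/21 and
  by the fraction of available vertices, and loses 1/100 per estimate; hence the thresholds 0.99,
  0.92, 0.85, 0.76.\<close>

lemma fin_fail_prob:
  assumes v: "valid \<sigma>" "good \<sigma>"
  shows "Pr (pot_edges n) p (fin_fail \<sigma>) \<le> \<delta>2"
proof -
  let ?A = "pot_edges n"
  let ?U = "UU \<sigma>" and ?T = "TT \<sigma>"
  note vd = validD[OF v(1)]
  have UV: "?U \<subseteq> vertices n" by (auto simp: UU_def)
  have fU: "finite ?U" by (rule finite_sub[OF UV])
  have UT: "?U \<inter> ?T = {}" "?T \<subseteq> vertices n" using vd by (auto simp: UU_def)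
  define Q where "Q = (\<lambda>(S, b) E. real (card S) \<le> smax \<and> 92 / 100 \<le> sum b S \<and>
      sum (r3 (?U - S) (b2 \<sigma> S b E) E) (?U - S) < 76 / 100)"
  have A: "Pr ?A p (\<lambda>E. sum (r1 \<sigma> E) ?U < 92 / 100) \<le> exp (- (1 / (80000 * cap1)))"
    unfolding r1_def
  proof (rule spread_stage[OF UV, where \<rho>="199/200" and m="99/100" and V=M])
    show "199 / 200 * real n \<le> real (card ?U)" using UU_card[OF v] Rs by simp
    have "sum (\<lambda>u. if u \<in> ?T then wt \<sigma> u else 0) ?T = sum (wt \<sigma>) ?T" by simp
    thus "sum (\<lambda>u. if u \<in> ?T then wt \<sigma> u else 0) ?T \<le> 1"
      "99/100 \<le> sum (\<lambda>u. if u \<in> ?T then wt \<sigma> u else 0) ?T" using vd v(2) by (auto simp: good_def)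
    show "(\<Sum>u\<in>?T. (if u \<in> ?T then wt \<sigma> u else 0)\<^sup>2) \<le> M" using v(2) by (simp add: good_def)
  qed (use UT vd(10) caps cA in auto)
  have B: "Pr ?A p (\<lambda>E. sum (r2 \<sigma> S b E) (?U - S) < 85 / 100) \<le> exp (- (1 / (80000 * cap2)))"
    and C: "Pr ?A p (\<lambda>E. 85 / 100 \<le> sum (b2 \<sigma> S b E) (?U - S) \<and> sum (r3 (?U - S) (b2 \<sigma> S b E) E) (?U - S) < 76 / 100)
        \<le> 2 * exp (- (real n / 80000))"
    if S: "S \<subseteq> ?U" "real (card S) \<le> smax" and b: "\<And>w. 0 \<le> b w" "sum b S \<le> 1" "92 / 100 \<le> sum b S" "(\<Sum>u\<in>S. (b u)\<^sup>2) \<le> cap1" for S b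
  proof -
    have SU: "?U - S \<subseteq> vertices n" using UV by blast
    have fS: "finite S" using S(1) fU finite_subset by blast
    have cU: "99 / 100 * real n \<le> real (card (?U - S))"
    proof -
      have "real (card (?U - S)) = real (card ?U) - real (card S)"
        using card_mono[OF fU S(1)] by (subst card_Diff_subset[OF fS S(1)]) auto
      thus ?thesis using UU_card[OF v] Rs S(2) by simp
    qed
    show "Pr ?A p (\<lambda>E. sum (r2 \<sigma> S b E) (?U - S) < 85 / 100) \<le> exp (- (1 / (80000 * cap2)))"
      unfolding r2_def
      by (rule spread_stage[OF SU cU, where m="92/100" and V=cap1]) (use S b UV caps cB in auto)
    let ?U' = "?U - S"
    define R where "R = (\<lambda>c E. 85 / 100 \<le> sum c ?U' \<and> sum (r3 ?U' c E) ?U' < 76 / 100)"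
    have "Pr ?A p (\<lambda>E. R (b2 \<sigma> S b E) E) \<le> 2 * exp (- (real n / 80000))"
    proof (rule Pr_two_stage_le[OF finite_pot_edges b2_on[OF S(1)], where C="\<lambda>_. {e. e \<subseteq> ?U'}"])
      fix E
      show "on_edges {e. e \<subseteq> ?U'} (R (b2 \<sigma> S b E))"
        unfolding R_def
        by (rule on_edges_comp[OF r3_on, where g="\<lambda>r. 85 / 100 \<le> sum (b2 \<sigma> S b E) ?U' \<and> sum r ?U' < 76 / 100"])
      show "(\<Union>v\<in>?U'. star v S) \<inter> {e. e \<subseteq> ?U'} = {}" by (auto simp: star_def)
      note um = unit_mass(1,4,6)[of "r2 \<sigma> S b E" cap2 ?U', OF r2_props[OF b(1)] less_imp_le[OF caps(2)], folded b2_def]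
      show "Pr ?A p (R (b2 \<sigma> S b E)) \<le> 2 * exp (- (real n / 80000))"
      proof (cases "85 / 100 \<le> sum (b2 \<sigma> S b E) ?U'")
        case True
        have "Pr ?A p (R (b2 \<sigma> S b E)) \<le> Pr ?A p (\<lambda>E'. sum (r3 ?U' (b2 \<sigma> S b E) E') ?U' < 76 / 100)"
          by (rule Pr_mono) (simp add: R_def)
        also have "\<dots> \<le> 2 * exp (- (real n / 80000))"
          by (rule last_stage[OF SU cU]) (use um True fU in auto)
        finally show ?thesis .
      qed (simp add: R_def)
    qed
    thus "Pr ?A p (\<lambda>E. 85 / 100 \<le> sum (b2 \<sigma> S b E) ?U' \<and> sum (r3 ?U' (b2 \<sigma> S b E) E) ?U' < 76 / 100) \<le> 2 * exp (- (real n / 80000))"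
      by (simp add: R_def)
  qed
  have um: "0 \<le> b1 \<sigma> E w" "sum (b1 \<sigma> E) ?U \<le> 1" "k \<le> 1 \<Longrightarrow> k \<le> sum (r1 \<sigma> E) ?U \<Longrightarrow> k \<le> sum (b1 \<sigma> E) ?U"
      "(\<Sum>w\<in>?U. (b1 \<sigma> E w)\<^sup>2) \<le> cap1" for E w k
    using unit_mass(1,4,6)[of "r1 \<sigma> E" cap1 ?U, OF r1_props(1,2)[OF v(1)] less_imp_le[OF caps(1)], folded b1_def]
      unit_mass(5)[of "r1 \<sigma> E" cap1 k ?U, OF r1_props(1,2)[OF v(1)] less_imp_le[OF caps(1)], folded b1_def] fU by auto
  have S1U: "S1 \<sigma> E \<subseteq> ?U" for E by (auto simp: S1_def)
  \<comment> \<open>No mass reaches a vertex outside \<open>S1\<close>, so sums over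
    \<open>S1\<close> and over all undiscovered vertices agree.\<close>
  have b1S: "sum (\<lambda>w. f (b1 \<sigma> E w)) (S1 \<sigma> E) = sum (\<lambda>w. f (b1 \<sigma> E w)) ?U" if "f 0 = 0" for f :: "real \<Rightarrow> real" and E
    by (rule sum.mono_neutral_left[OF fU S1U]) (use that in \<open>auto simp: b1_def unit_mass_def r1_props(3)[OF v(1)]\<close>)
  have QQ: "Pr ?A p (\<lambda>E. Q (S1 \<sigma> E, b1 \<sigma> E) E) \<le> exp (- (1 / (80000 * cap2))) + 2 * exp (- (real n / 80000))"
  proof (rule Pr_two_stage_le[OF finite_pot_edges S1_b1_on, where C="\<lambda>_. {e. e \<subseteq> ?U}"])
    fix E
    let ?S = "S1 \<sigma> E" and ?b = "b1 \<sigma> E"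
    let ?U' = "?U - ?S"
    show "(\<Union>w\<in>?U. star w ?T) \<inter> {e. e \<subseteq> ?U} = {}" using UT by (auto simp: star_def)
    show "on_edges {e. e \<subseteq> ?U} (Q (?S, ?b))"
    proof (rule on_edgesI)
      fix E1 E2 :: "nat set \<Rightarrow> bool" assume *: "\<And>e. e \<in> {e. e \<subseteq> ?U} \<Longrightarrow> E1 e = E2 e"
      have 1: "b2 \<sigma> ?S ?b E1 = b2 \<sigma> ?S ?b E2"
        by (rule on_edgesD[OF b2_on[OF S1U]], rule *) (use S1U in \<open>auto simp: star_def\<close>)
      have "r3 ?U' (b2 \<sigma> ?S ?b E2) E1 = r3 ?U' (b2 \<sigma> ?S ?b E2) E2"
        by (rule on_edgesD[OF r3_on], rule *) auto
      thus "Q (?S, ?b) E1 = Q (?S, ?b) E2" using 1 by (simp add: Q_def)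
    qed
    show "Pr ?A p (Q (?S, ?b)) \<le> exp (- (1 / (80000 * cap2))) + 2 * exp (- (real n / 80000))"
    proof (cases "real (card ?S) \<le> smax \<and> 92 / 100 \<le> sum ?b ?S")
      case True
      have sb: "sum ?b ?S \<le> 1" "(\<Sum>u\<in>?S. (?b u)\<^sup>2) \<le> cap1"
        using b1S[of "\<lambda>x. x" E] b1S[of "\<lambda>x. x\<^sup>2" E] um by auto
      have "Pr ?A p (Q (?S, ?b)) \<le> Pr ?A p (\<lambda>E'. sum (r2 \<sigma> ?S ?b E') ?U' < 85 / 100 \<or>
         (85 / 100 \<le> sum (b2 \<sigma> ?S ?b E') ?U' \<and> sum (r3 ?U' (b2 \<sigma> ?S ?b E') E') ?U' < 76 / 100))"
      proof (rule Pr_mono)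
        fix E' assume q: "Q (?S, ?b) E'"
        have "85 / 100 \<le> sum (b2 \<sigma> ?S ?b E') ?U'" if "\<not> sum (r2 \<sigma> ?S ?b E') ?U' < 85 / 100"
          using that unit_mass(5)[of "r2 \<sigma> ?S ?b E'" cap2 "85/100" ?U', OF r2_props[OF um(1)] less_imp_le[OF caps(2)], folded b2_def]
          by simp
        thus "sum (r2 \<sigma> ?S ?b E') ?U' < 85 / 100 \<or>
         (85 / 100 \<le> sum (b2 \<sigma> ?S ?b E') ?U' \<and> sum (r3 ?U' (b2 \<sigma> ?S ?b E') E') ?U' < 76 / 100)"
          using q by (auto simp: Q_def)
      qed
      also have "\<dots> \<le> Pr ?A p (\<lambda>E'. sum (r2 \<sigma> ?S ?b E') ?U' < 85 / 100) +
         Pr ?A p (\<lambda>E'. 85 / 100 \<le> sum (b2 \<sigma> ?S ?b E') ?U' \<and> sum (r3 ?U' (b2 \<sigma> ?S ?b E') E') ?U' < 76 / 100)"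
        by (rule Pr_disj)
      also have "\<dots> \<le> exp (- (1 / (80000 * cap2))) + 2 * exp (- (real n / 80000))"
        by (intro add_mono B C S1U um(1) sb) (use True in auto)
      finally show ?thesis .
    next
      case False
      hence "Q (?S, ?b) = (\<lambda>_. False)" by (auto simp: Q_def)
      thus ?thesis by (simp add: add_nonneg_nonneg)
    qed
  qed
  have "Pr ?A p (fin_fail \<sigma>) \<le> Pr ?A p (\<lambda>E. sum (r1 \<sigma> E) ?U < 92 / 100 \<or> Q (S1 \<sigma> E, b1 \<sigma> E) E)"
  proof (rule Pr_mono)
    fix E assume f: "fin_fail \<sigma> E"
    have "92 / 100 \<le> sum (b1 \<sigma> E) (S1 \<sigma> E)" if "\<not> sum (r1 \<sigma> E) ?U < 92 / 100"
      using um(3)[of "92/100" E] that b1S[of "\<lambda>x. x" E] by simp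
    thus "sum (r1 \<sigma> E) ?U < 92 / 100 \<or> Q (S1 \<sigma> E, b1 \<sigma> E) E" using f by (auto simp: Q_def fin_fail_def)
  qed
  also have "\<dots> \<le> Pr ?A p (\<lambda>E. sum (r1 \<sigma> E) ?U < 92 / 100) + Pr ?A p (\<lambda>E. Q (S1 \<sigma> E, b1 \<sigma> E) E)"
    by (rule Pr_disj)
  also have "\<dots> \<le> \<delta>2" using A QQ by (simp add: \<delta>2_def)
  finally show ?thesis .
qed

lemma fin_fail_on:
  assumes "valid \<sigma>" shows "on_edges (edges_off (PP \<sigma>)) (fin_fail \<sigma>)"
proof (rule on_edgesI)
  fix E1 E2 :: "nat set \<Rightarrow> bool" assume *: "\<And>e. e \<in> edges_off (PP \<sigma>) \<Longrightarrow> E1 e = E2 e"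
  note vd = validD[OF assms]
  have U: "UU \<sigma> \<inter> PP \<sigma> = {}" using vd by (auto simp: UU_def)
  have "(S1 \<sigma> E1, b1 \<sigma> E1) = (S1 \<sigma> E2, b1 \<sigma> E2)"
    by (rule on_edgesD[OF S1_b1_on], rule *) (use U vd(4) in \<open>auto simp: star_def edges_off_def\<close>)
  hence 1: "S1 \<sigma> E1 = S1 \<sigma> E2" "b1 \<sigma> E1 = b1 \<sigma> E2" by auto
  have S: "S1 \<sigma> E2 \<subseteq> UU \<sigma>" by (auto simp: S1_def)
  have 2: "b2 \<sigma> (S1 \<sigma> E2) (b1 \<sigma> E2) E1 = b2 \<sigma> (S1 \<sigma> E2) (b1 \<sigma> E2) E2"
    by (rule on_edgesD[OF b2_on[OF S]], rule *) (use U S in \<open>auto simp: star_def edges_off_def\<close>)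
  have "r3 (UU \<sigma> - S1 \<sigma> E2) b E1 = r3 (UU \<sigma> - S1 \<sigma> E2) b E2" for b
    by (rule on_edgesD[OF r3_on], rule *) (use U in \<open>auto simp: edges_off_def\<close>)
  thus "fin_fail \<sigma> E1 = fin_fail \<sigma> E2" by (simp add: fin_fail_def 1 2)
qed

text \<open>Each way of stopping badly makes one exponent nonnegative: too many vertices
  \<open>F3\<close>, lost mass \<open>F1\<close>, a large squared norm \<open>F2\<close>.\<close>

lemma bad_terminal:
  assumes v: "valid \<sigma>" "\<not> active \<sigma>" "\<not> good \<sigma>" and Mw: "10 ^ 6 \<le> M * (d - 6) ^ t1"
  shows "1 \<le> \<Phi> \<sigma>"
proof -
  note vd = validD[OF v(1)]
  have "0 \<le> F1 \<sigma> \<or> 0 \<le> F2 \<sigma> \<or> 0 \<le> F3 \<sigma>"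
  proof (cases "real (card (RR \<sigma>)) \<le> Rm")
    case False
    have "0 \<le> (\<Sum>v\<in>TT \<sigma>. ff (lev \<sigma> v))" using vd(9) by (intro sum_nonneg ff_nonneg) auto
    thus ?thesis using False l3_pos by (simp add: F3_def)
  next
    case True
    hence lev: "\<forall>v\<in>TT \<sigma>. lev \<sigma> v = t1" using v(2) vd(9) unfolding active_def by force
    consider "sum (wt \<sigma>) (TT \<sigma>) < 99 / 100" | "M < (\<Sum>u\<in>TT \<sigma>. (wt \<sigma> u)\<^sup>2)"
      using v(3) True lev by (auto simp: good_def)
    thus ?thesis
    proof cases
      case 1
      have "real (card (PP \<sigma>)) \<le> Rm" using card_mono[OF vd(6,1)] True by simp
      moreover have "0 \<le> k2" using p dpos by (simp add: k2_def)
      moreover have "(\<Sum>v\<in>TT \<sigma>. wt \<sigma> v * (real t1 - real (lev \<sigma> v))) = 0" using lev by simp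
      ultimately have "0 \<le> F1 \<sigma>" using 1 l1 by (simp add: F1_def)
      thus ?thesis by simp
    next
      case 2
      have w: "(d - 6) ^ t1 \<le> ww t1" using d(2) by (simp add: ww_def mult_le_cancel_left1)
      have "10 ^ 6 \<le> M * (d - 6) ^ t1" by (rule Mw)
      also have "\<dots> \<le> (\<Sum>u\<in>TT \<sigma>. (wt \<sigma> u)\<^sup>2) * ww t1"
        using 2 w M d(2) by (intro mult_mono sum_nonneg) auto
      also have "\<dots> = (\<Sum>v\<in>TT \<sigma>. (wt \<sigma> v)\<^sup>2 * ww (lev \<sigma> v))" using lev by (simp add: sum_distrib_right)
      finally have "0 \<le> F2 \<sigma>" using dpos by (simp add: F2_def l2_def)
      thus ?thesis by simp
    qed
  qed
  thus ?thesis unfolding \<Phi>_def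
    using exp_ge_zero[of "F1 \<sigma>"] exp_ge_zero[of "F2 \<sigma>"] exp_ge_zero[of "F3 \<sigma>"]
      one_le_exp_iff[of "F1 \<sigma>"] one_le_exp_iff[of "F2 \<sigma>"] one_le_exp_iff[of "F3 \<sigma>"] by linarith
qed

lemma explore_fail:
  assumes v: "valid \<sigma>" and k: "card (vertices n - PP \<sigma>) \<le> k" and Mw: "10 ^ 6 \<le> M * (d - 6) ^ t1"
  shows "Pr (pot_edges n) p (\<lambda>E. \<not> good (run k \<sigma> E) \<or> fin_fail (run k \<sigma> E) E) \<le> \<Phi> \<sigma> + \<delta>2"
proof -
  let ?A = "pot_edges n"
  have \<delta>: "0 \<le> \<delta>2" by (simp add: \<delta>2_def)
  have \<Phi>: "0 \<le> \<Phi> \<sigma>" for \<sigma> by (simp add: \<Phi>_def add_nonneg_nonneg)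
  have "expect ?A p (\<lambda>E. of_bool (\<not> good (run k \<sigma> E) \<or> fin_fail (run k \<sigma> E) E)) \<le> \<Phi> \<sigma> + \<delta>2"
  proof (rule run_supermartingale[OF v k, where G="\<lambda>\<sigma> E. of_bool (\<not> good \<sigma> \<or> fin_fail \<sigma> E)" and \<Phi>="\<lambda>\<sigma>. \<Phi> \<sigma> + \<delta>2"])
    fix \<sigma> assume va: "valid \<sigma>"
    show "on_edges (edges_off (PP \<sigma>)) (\<lambda>E. of_bool (\<not> good \<sigma> \<or> fin_fail \<sigma> E) :: real)"
      by (rule on_edges_comp[OF fin_fail_on[OF va], where g="\<lambda>b. of_bool (\<not> good \<sigma> \<or> b)"])
    show "expect ?A p (\<lambda>E. of_bool (\<not> good \<sigma> \<or> fin_fail \<sigma> E)) \<le> \<Phi> \<sigma> + \<delta>2" if "\<not> active \<sigma>"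
    proof (cases "good \<sigma>")
      case True
      thus ?thesis using fin_fail_prob[OF va True] \<Phi>[of \<sigma>] by (simp add: expect_indicator)
    next
      case False
      thus ?thesis using bad_terminal[OF va that False Mw] \<delta> by simp
    qed
    show "expect ?A p (\<lambda>E. \<Phi> (nxt \<sigma> E) + \<delta>2) \<le> \<Phi> \<sigma> + \<delta>2" if "active \<sigma>"
      using step_\<Phi>[OF va that] by (subst Bochner_Integration.integral_add) auto
  qed
  thus ?thesis by (simp only: expect_indicator)
qed

end

subsection \<open>Mixing from one vertex\<close>

definition nbrs :: "nat \<Rightarrow> (nat set \<Rightarrow> bool) \<Rightarrow> nat \<Rightarrow> nat set" where
  "nbrs n E z = {v \<in> vertices n. adj E z v}"

lemma nbrs: "finite (nbrs n E z)" "nbrs n E z \<subseteq> vertices n" "z \<notin> nbrs n E z" "card (nbrs n E z) = degree n E z"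
  by (auto simp: nbrs_def degree_def adj_def)

lemma walk_Suc_ge: "i \<in> vertices n \<Longrightarrow> walk n E (dirac z) t i * trans E n i j \<le> walk n E (dirac z) (Suc t) j"
  unfolding walk_Suc step_def
  by (rule member_le_sum[of i _ "\<lambda>i. walk n E (dirac z) t i * trans E n i j"])
     (auto intro!: mult_nonneg_nonneg walk_dirac_nonneg trans_nonneg)

lemma walk_dirac_Suc0:
  assumes "z \<in> vertices n" shows "walk n E (dirac z) (Suc 0) j = trans E n z j"
  using assms by (simp add: walk_Suc step_def dirac_def if_distrib[of "\<lambda>x. x * _"] cong: if_cong)

definition heavy :: "nat \<Rightarrow> real \<Rightarrow> (nat set \<Rightarrow> bool) \<Rightarrow> nat set" where
  "heavy n d E = {v \<in> vertices n. 21 / 20 * d < real (degree n E v)}"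

section \<open>The exploration as a lower bound for the walk, and its initial state\<close>

context exploration
begin

text \<open>By the first clause the degree of a vertex of \<open>TT\<close> is at most
  \<open>1 + card N\<close>, so dividing by this number can only underestimate the walk. By the
  second, a new vertex has no processed neighbour except the current one, which preserves the
  first.\<close>

definition walk_inv :: "nat \<Rightarrow> st \<Rightarrow> (nat set \<Rightarrow> bool) \<Rightarrow> bool" where
  "walk_inv z \<sigma> E \<longleftrightarrow> (\<forall>v\<in>TT \<sigma>. card {x \<in> PP \<sigma>. adj E x v} \<le> 1)
     \<and> (\<forall>x\<in>PP \<sigma>. \<forall>v\<in>vertices n. adj E x v \<longrightarrow> v \<in> RR \<sigma>)
     \<and> (\<forall>v\<in>TT \<sigma>. wt \<sigma> v \<le> walk n E (dirac z) (lev \<sigma> v) v)"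

lemma walk_inv_nxt:
  assumes va: "valid \<sigma>" "active \<sigma>" and g: "walk_inv z \<sigma> E"
  shows "walk_inv z (nxt \<sigma> E) E"
proof -
  define u where "u = cur \<sigma>"
  define N where "N = nb \<sigma> u E"
  note vd = validD[OF va(1)]
  note np = nb_props[OF va, of u E, folded N_def]
  have u: "u \<in> TT \<sigma>" "u \<in> vertices n" "u \<in> RR \<sigma>" "u \<notin> PP \<sigma>"
    using u_facts[OF va] by (auto simp: u_def)
  have n: "nxt \<sigma> E = upd \<sigma> u N" by (simp add: nxt_def u_def N_def)
  have Nadj: "v \<in> N \<longleftrightarrow> v \<in> vertices n \<and> v \<notin> PP \<sigma> \<and> adj E u v" for v
    by (auto simp: N_def nb_def adj_def)
  have old: "v \<in> TT \<sigma> \<and> v \<noteq> u \<and> v \<notin> N \<or> v \<in> N - RR \<sigma>" if "v \<in> TT (upd \<sigma> u N)" for v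
    using that by (auto simp: upd_def split: if_splits)
  have 1: "card {x \<in> insert u (PP \<sigma>). adj E x v} \<le> 1" if "v \<in> TT (upd \<sigma> u N)" for v
    using old[OF that]
  proof
    assume v: "v \<in> TT \<sigma> \<and> v \<noteq> u \<and> v \<notin> N"
    hence "v \<in> vertices n" "v \<notin> PP \<sigma>" using vd by auto
    hence "\<not> adj E u v" using v Nadj by blast
    hence "{x \<in> insert u (PP \<sigma>). adj E x v} = {x \<in> PP \<sigma>. adj E x v}" by auto
    thus ?thesis using g v by (simp add: walk_inv_def)
  next
    assume v: "v \<in> N - RR \<sigma>"
    hence "{x \<in> insert u (PP \<sigma>). adj E x v} \<subseteq> {u}" using g np(2) by (auto simp: walk_inv_def)
    thus ?thesis using card_mono[of "{u}" "{x \<in> insert u (PP \<sigma>). adj E x v}"] by simp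
  qed
  have 2: "v \<in> RR \<sigma> \<union> N" if "x \<in> insert u (PP \<sigma>)" "v \<in> vertices n" "adj E x v" for x v
    using that g vd(1) Nadj[of v] by (auto simp: walk_inv_def)
  have deg: "real (degree n E u) \<le> 1 + real (card N)"
  proof -
    have "{j \<in> vertices n. adj E u j} \<subseteq> N \<union> {x \<in> PP \<sigma>. adj E x u}" using Nadj by (auto simp: adj_sym)
    hence "degree n E u \<le> card (N \<union> {x \<in> PP \<sigma>. adj E x u})"
      unfolding degree_def by (intro card_mono) (use np vd in auto)
    also have "\<dots> \<le> card N + card {x \<in> PP \<sigma>. adj E x u}" by (rule card_Un_le)
    also have "\<dots> \<le> card N + 1" using g u(1) by (simp add: walk_inv_def)
    finally show ?thesis by linarith
  qed
  have 3: "wt (upd \<sigma> u N) v \<le> walk n E (dirac z) (lev (upd \<sigma> u N) v) v" if "v \<in> TT (upd \<sigma> u N)" for v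
    using old[OF that]
  proof
    assume "v \<in> TT \<sigma> \<and> v \<noteq> u \<and> v \<notin> N"
    thus ?thesis using g by (simp add: walk_inv_def upd_def)
  next
    assume v: "v \<in> N - RR \<sigma>"
    hence a: "adj E u v" using Nadj by blast
    hence "v \<in> {j \<in> vertices n. adj E u j}" using v np by auto
    hence d0: "0 < degree n E u" unfolding degree_def by (subst card_gt_0_iff) auto
    have "wt \<sigma> u / (1 + real (card N)) \<le> walk n E (dirac z) (lev \<sigma> u) u / real (degree n E u)"
      using g u(1) deg d0 vd(10)[OF u(1)] by (intro frac_le) (auto simp: walk_inv_def)
    also have "\<dots> = walk n E (dirac z) (lev \<sigma> u) u * trans E n u v" using a by (simp add: trans_def)
    also have "\<dots> \<le> walk n E (dirac z) (Suc (lev \<sigma> u)) v" by (rule walk_Suc_ge[OF u(2)])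
    finally show ?thesis using v by (simp add: upd_def)
  qed
  show ?thesis unfolding n walk_inv_def using 1 2 3 by (simp add: upd_def)
qed

lemma walk_inv_run: "valid \<sigma> \<Longrightarrow> walk_inv z \<sigma> E \<Longrightarrow> walk_inv z (run k \<sigma> E) E"
  by (induction k arbitrary: \<sigma>) (auto simp: valid_nxt walk_inv_nxt)

definition init :: "nat \<Rightarrow> nat set \<Rightarrow> st" where
  "init z N = \<lparr>PP = {z}, RR = insert z N, TT = N, wt = (\<lambda>_. 1 / real (card N)), lev = (\<lambda>_. 1)\<rparr>"

lemma valid_init:
  assumes "z \<in> vertices n" "N \<subseteq> vertices n" "z \<notin> N" "d / 100 \<le> real (card N)"
  shows "valid (init z N)"
proof -
  have c: "0 < real (card N)" using assms(4) dpos by linarith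
  have "1 / real (card N) \<le> 1 / (d / 100)" using assms(4) dpos c by (intro divide_left_mono) auto
  thus ?thesis using assms c t1 by (simp add: valid_def init_def)
qed

lemma walk_inv_init:
  assumes "z \<in> vertices n" shows "walk_inv z (init z (nbrs n E z)) E"
proof -
  have "card {x. x = z \<and> adj E x v} \<le> 1" for v
    using card_mono[of "{z}" "{x. x = z \<and> adj E x v}"] by auto
  moreover have "1 / real (card (nbrs n E z)) \<le> walk n E (dirac z) (Suc 0) v" if "v \<in> nbrs n E z" for v
  proof -
    have "adj E z v" using that by (simp add: nbrs_def)
    thus ?thesis by (simp only: walk_dirac_Suc0[OF assms] nbrs(4)) (simp add: trans_def)
  qed
  ultimately show ?thesis by (auto simp: walk_inv_def init_def nbrs_def)
qed

lemma \<Phi>_init: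
  assumes N: "finite N" "z \<notin> N" "d / 100 \<le> real (card N)" "real (card N) \<le> 6 * d"
    and R: "100 * d ^ t1 \<le> Rm" and F: "- (l1 / 100) + k1 * real t1 + k2 * Rm \<le> - (3 * d)"
  shows "\<Phi> (init z N) \<le> 3 * exp (- (3 * d))"
proof -
  have c: "0 < real (card N)" using N(3) dpos by linarith
  have k2: "0 \<le> k2" using p dpos by (simp add: k2_def)
  have k1: "0 \<le> k1" using l1 dpos k2 Rm by (simp add: k1_def add_nonneg_nonneg)
  have "F1 (init z N) = - (l1 / 100) + k1 * (real t1 - 1) + k2 * (Rm - 1)"
    using c by (simp add: F1_def init_def sum_distrib_right[symmetric])
  also have "\<dots> \<le> - (l1 / 100) + k1 * real t1 + k2 * Rm"
    using k1 k2 by (intro add_mono mult_left_mono) auto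
  finally have 1: "F1 (init z N) \<le> - (3 * d)" using F by linarith
  \<comment> \<open>An initial sum of at most 150 is set against the threshold
    \<open>10 ^ 6\<close>, and \<open>(10 ^ 6 - 150) / 320000\<close> is above 3.\<close>
  have 2: "F2 (init z N) \<le> - (3 * d)"
  proof -
    have "(\<Sum>v\<in>N. (1 / real (card N))\<^sup>2 * ww 1) = ww 1 / real (card N)"
      using c by (simp add: power2_eq_square)
    also have "\<dots> \<le> (d * (3/2)) / (d / 100)"
      using N(3) dpos d(2) by (intro frac_le) (auto simp: ww_def)
    also have "\<dots> = 150" using dpos by simp
    finally have "(\<Sum>v\<in>N. (1 / real (card N))\<^sup>2 * ww 1) \<le> 150" .
    moreover have "F2 (init z N) = l2 * ((\<Sum>v\<in>N. (1 / real (card N))\<^sup>2 * ww 1) - 10^6)"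
      by (simp add: F2_def init_def)
    ultimately have "F2 (init z N) \<le> l2 * (150 - 10^6)"
      using dpos by (simp only:) (intro mult_left_mono, auto simp: l2_def)
    thus ?thesis using dpos by (simp add: l2_def)
  qed
  \<comment> \<open>At most \<open>1 + 15 * d^t1\<close> is present initially, against
    \<open>Rm \<ge> 100 * d^t1\<close>; a deficit of \<open>54 * d^t1\<close> at the rate
    \<open>l3\<close>, with its factor 18, gives \<open>3 * d\<close>.\<close>
  have 3: "F3 (init z N) \<le> - (3 * d)"
  proof -
    have D: "d ^ t1 = d * d ^ (t1 - 1)" using t1 by (cases t1) auto
    have D1: "1 \<le> d ^ (t1 - 1)" using d1 by simp
    have "real (card N) * (1 + ff 1) \<le> (6 * d) * (5/2 * d ^ (t1 - 1))"
      using N(4) ff_nonneg[of 1] t1 dpos by (intro mult_mono) (auto simp: ff_def)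
    hence "real (card (insert z N)) + (\<Sum>v\<in>N. ff 1) - Rm \<le> 1 + 15 * (d * d ^ (t1 - 1)) - 100 * (d * d ^ (t1 - 1))"
      using N R D by (simp add: algebra_simps)
    also have "\<dots> \<le> - (54 * (d * d ^ (t1 - 1)))" using mult_mono[OF d1(1) D1] d1 by simp
    finally have "F3 (init z N) \<le> l3 * - (54 * (d * d ^ (t1 - 1)))"
      unfolding F3_def using l3_pos by (intro mult_left_mono) (auto simp: init_def)
    also have "\<dots> = - (3 * d)" using dpos by (simp add: l3_def)
    finally show ?thesis .
  qed
  show ?thesis unfolding \<Phi>_def using 1 2 3
    exp_le_cancel_iff[of "F1 (init z N)" "- (3 * d)"] exp_le_cancel_iff[of "F2 (init z N)" "- (3 * d)"]
    exp_le_cancel_iff[of "F3 (init z N)" "- (3 * d)"] by linarith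
qed

end

context final_steps
begin

text \<open>The degree bounds keep exceptional starts out of the event: those of small degree are
  reached through their neighbours, and those of large degree are excluded by the maximum
  degree.\<close>

definition bad_start :: "nat \<Rightarrow> (nat set \<Rightarrow> bool) \<Rightarrow> bool" where
  "bad_start z E \<longleftrightarrow> (let N = nbrs n E z; \<sigma> = run n (init z N) E in
     d / 100 \<le> real (card N) \<and> real (card N) \<le> 6 * d \<and> (\<not> good \<sigma> \<or> fin_fail \<sigma> E))"

lemma bad_start_prob:
  assumes z: "z \<in> vertices n" and Mw: "10 ^ 6 \<le> M * (d - 6) ^ t1"
    and R: "100 * d ^ t1 \<le> Rm" and F: "- (l1 / 100) + k1 * real t1 + k2 * Rm \<le> - (3 * d)"
  shows "Pr (pot_edges n) p (bad_start z) \<le> 3 * exp (- (3 * d)) + \<delta>2"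
proof -
  let ?A = "pot_edges n"
  define Q where "Q = (\<lambda>N E. d / 100 \<le> real (card N) \<and> real (card N) \<le> 6 * d \<and>
      (\<not> good (run n (init z N) E) \<or> fin_fail (run n (init z N) E) E))"
  have nonneg: "0 \<le> 3 * exp (- (3 * d)) + \<delta>2" by (simp add: \<delta>2_def add_nonneg_nonneg)
  have "Pr ?A p (\<lambda>E. Q (nbrs n E z) E) \<le> 3 * exp (- (3 * d)) + \<delta>2"
  proof (rule Pr_two_stage_le[OF finite_pot_edges, where B="star z (vertices n - {z})" and h="\<lambda>E. nbrs n E z" and C="\<lambda>_. edges_off {z}"])
    show "on_edges (star z (vertices n - {z})) (\<lambda>E. nbrs n E z)"
      by (rule on_edgesI) (auto simp: nbrs_def adj_def star_def)
    show "star z (vertices n - {z}) \<inter> edges_off {z} = {}" by (auto simp: star_def edges_off_def)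
    fix E
    let ?N = "nbrs n E z"
    note N = nbrs(1-3)[where n=n and E=E and z=z]
    have "on_edges (edges_off {z}) (Q ?N) \<and> Pr ?A p (Q ?N) \<le> 3 * exp (- (3 * d)) + \<delta>2"
    proof (cases "d / 100 \<le> real (card ?N) \<and> real (card ?N) \<le> 6 * d")
      case True
      have v: "valid (init z ?N)" by (rule valid_init[OF z N(2,3)]) (use True in auto)
      have P: "PP (init z ?N) = {z}" by (simp add: init_def)
      have Qeq: "Q ?N = (\<lambda>E. \<not> good (run n (init z ?N) E) \<or> fin_fail (run n (init z ?N) E) E)"
        using True by (simp add: Q_def)
      have "on_edges (edges_off (PP (init z ?N))) (\<lambda>E. (\<lambda>\<sigma> E. \<not> good \<sigma> \<or> fin_fail \<sigma> E) (run n (init z ?N) E) E)"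
        by (rule on_edges_run_comp[OF v]) (rule on_edges_comp[OF fin_fail_on])
      moreover have "Pr ?A p (Q ?N) \<le> \<Phi> (init z ?N) + \<delta>2"
        unfolding Qeq by (rule explore_fail[OF v _ Mw]) (use card_mono[OF finite_vertices, of "vertices n - PP (init z ?N)"] in auto)
      moreover have "\<Phi> (init z ?N) \<le> 3 * exp (- (3 * d))"
        by (rule \<Phi>_init[OF N(1,3) _ _ R F]) (use True in auto)
      ultimately show ?thesis unfolding Qeq P by simp
    next
      case False
      hence "Q ?N = (\<lambda>_. False)" by (auto simp: Q_def fun_eq_iff)
      thus ?thesis using nonneg by (simp add: on_edges_const)
    qed
    thus "on_edges (edges_off {z}) (Q ?N)" "Pr ?A p (Q ?N) \<le> 3 * exp (- (3 * d)) + \<delta>2" by auto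
  qed
  moreover have "bad_start z = (\<lambda>E. Q (nbrs n E z) E)" by (simp add: fun_eq_iff bad_start_def Q_def Let_def)
  ultimately show ?thesis by simp
qed

end

context exploration
begin

text \<open>If \<open>x\<close> dominates \<open>b - e\<close>, then after one step it dominates the idealised flow of \<open>b\<close>
  up to a new error, which is caused by \<open>e\<close> and by the mass of \<open>b\<close> on heavy vertices.\<close>

lemma push:
  assumes x: "\<And>i. i \<in> vertices n \<Longrightarrow> b i - e i \<le> x i" "\<And>i. 0 \<le> x i" and b: "\<And>i. 0 \<le> b i" "\<And>i. 0 \<le> e i"
    and deg: "\<And>v. v \<in> vertices n \<Longrightarrow> real (degree n E v) \<le> 6 * d"
  obtains e' where "\<And>i. 0 \<le> e' i" "\<And>r y. y \<in> vertices n \<Longrightarrow> r y \<le> (\<Sum>u\<in>vertices n. 20 / (21 * d) * b u * of_bool (adj E y u)) \<Longrightarrow> r y - e' y \<le> step n E x y"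
    "(\<Sum>i\<in>vertices n. e' i) \<le> 6 * ((\<Sum>i\<in>vertices n. e i) + (\<Sum>i\<in>heavy n d E. b i))"
proof -
  let ?V = "vertices n" and ?c = "20 / (21 * d)"
  have c0: "0 < ?c" using dpos by simp
  define f where "f u = e u + (if u \<in> heavy n d E then b u else 0)" for u
  define e' where "e' y = (\<Sum>u\<in>?V. ?c * f u * of_bool (adj E y u))" for y
  have f0: "0 \<le> f u" for u using b by (simp add: f_def)
  show thesis
  proof (rule that)
    show "0 \<le> e' i" for i unfolding e'_def using c0 f0 by (intro sum_nonneg) auto
    fix r :: "nat \<Rightarrow> real" and y
    assume y: "y \<in> ?V" and r: "r y \<le> (\<Sum>u\<in>?V. ?c * b u * of_bool (adj E y u))"
    have "(\<Sum>u\<in>?V. ?c * b u * of_bool (adj E y u)) - e' y = (\<Sum>u\<in>?V. ?c * (b u - f u) * of_bool (adj E y u))"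
      unfolding e'_def sum_subtractf[symmetric]
      by (rule sum.cong) (auto simp: algebra_simps diff_divide_distrib)
    also have "\<dots> \<le> (\<Sum>u\<in>?V. x u * trans E n u y)"
    proof (rule sum_mono)
      fix u assume u: "u \<in> ?V"
      show "?c * (b u - f u) * of_bool (adj E y u) \<le> x u * trans E n u y"
      proof (cases "adj E y u \<and> 0 < b u - f u")
        case True
        hence a: "adj E u y" by (simp add: adj_sym)
        have nh: "u \<notin> heavy n d E" using True b(2)[of u] by (auto simp: f_def)
        hence dg: "real (degree n E u) \<le> 21 / 20 * d" using u by (auto simp: heavy_def)
        have bx: "b u - f u \<le> x u" using x(1)[OF u] nh by (simp add: f_def)
        have "y \<in> {j \<in> ?V. adj E u j}" using a y by simp
        hence dg0: "0 < degree n E u" unfolding degree_def by (subst card_gt_0_iff) auto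
        have "?c \<le> 1 / real (degree n E u)" using dg dg0 dpos by (simp add: field_simps)
        hence "(b u - f u) * ?c \<le> x u * (1 / real (degree n E u))"
          using bx True x c0 by (intro mult_mono) auto
        thus ?thesis using True a by (simp add: trans_def mult.commute)
      next
        case False
        hence "?c * (b u - f u) * of_bool (adj E y u) \<le> 0"
          using mult_nonneg_nonpos[of ?c "b u - f u"] c0 by (cases "adj E y u") simp_all
        also have "0 \<le> x u * trans E n u y" using x(2) by (simp add: trans_nonneg)
        finally show ?thesis .
      qed
    qed
    finally show "r y - e' y \<le> step n E x y" using r by (simp add: step_def)
  next
    have "(\<Sum>i\<in>?V. e' i) = (\<Sum>u\<in>?V. ?c * f u * (\<Sum>y\<in>?V. of_bool (adj E u y)))"
      unfolding e'_def
    proof (subst sum.swap, intro sum.cong refl)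
      fix u
      show "(\<Sum>y\<in>?V. ?c * f u * of_bool (adj E y u)) = ?c * f u * (\<Sum>y\<in>?V. of_bool (adj E u y))"
        unfolding sum_distrib_left by (intro sum.cong refl) (simp add: adj_sym)
    qed
    also have "\<dots> = (\<Sum>u\<in>?V. ?c * f u * real (degree n E u))" by (simp only: real_degree)
    \<comment> \<open>Degrees up to \<open>6 * d\<close>, against the idealised
      \<open>21/20 * d\<close>, amplify an error by at most 120/21, rounded up to 6.\<close>
    also have "\<dots> \<le> (\<Sum>u\<in>?V. ?c * f u * (6 * d))"
      using deg c0 f0 by (intro sum_mono mult_left_mono) auto
    also have "\<dots> = 120 / 21 * (\<Sum>u\<in>?V. f u)" using dpos by (simp add: sum_distrib_left)
    also have "\<dots> \<le> 6 * (\<Sum>u\<in>?V. f u)" using f0 by (intro mult_right_mono sum_nonneg) auto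
    also have "(\<Sum>u\<in>?V. f u) = (\<Sum>i\<in>?V. e i) + (\<Sum>i\<in>heavy n d E. b i)"
      unfolding f_def sum.distrib by (subst sum.inter_restrict[symmetric]) (auto simp: heavy_def intro!: sum.cong)
    finally show "(\<Sum>i\<in>?V. e' i) \<le> 6 * ((\<Sum>i\<in>?V. e i) + (\<Sum>i\<in>heavy n d E. b i))" .
  qed
qed

end

context final_steps
begin

text \<open>Cauchy-Schwarz: a squared norm of at most \<open>c\<close> puts mass at most the root of
  \<open>c * h\<close> on any \<open>h\<close> vertices, so it does not matter where the heavy ones
  are.\<close>

lemma heavy_mass:
  assumes "finite A" "(\<Sum>u\<in>A. (b u)\<^sup>2) \<le> c" "c * h \<le> 1 / 10 ^ 8" "real (card (heavy n d E)) \<le> h" "\<And>u. u \<notin> A \<Longrightarrow> b u = 0" "0 \<le> c"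
  shows "(\<Sum>u\<in>heavy n d E. b u) \<le> 1 / 10 ^ 4"
proof -
  have fH: "finite (heavy n d E)" by (simp add: heavy_def)
  have "(\<Sum>u\<in>heavy n d E. b u)\<^sup>2 \<le> (\<Sum>u\<in>heavy n d E. (b u)\<^sup>2) * (\<Sum>u\<in>heavy n d E. 1\<^sup>2)"
    using Cauchy_Schwarz_ineq_sum[of b "\<lambda>_. 1" "heavy n d E"] by simp
  also have "(\<Sum>u\<in>heavy n d E. (b u)\<^sup>2) \<le> (\<Sum>u\<in>A. (b u)\<^sup>2)"
  proof -
    have "(\<Sum>u\<in>heavy n d E. (b u)\<^sup>2) = (\<Sum>u\<in>heavy n d E \<inter> A. (b u)\<^sup>2)"
      by (rule sum.mono_neutral_right[OF fH]) (use assms(5) in auto)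
    also have "\<dots> \<le> (\<Sum>u\<in>A. (b u)\<^sup>2)" by (rule sum_mono2) (use assms in auto)
    finally show ?thesis .
  qed
  also have "(\<Sum>u\<in>A. (b u)\<^sup>2) * (\<Sum>u\<in>heavy n d E. 1\<^sup>2) \<le> c * h"
    using assms by (intro mult_mono) (auto intro: order_trans[OF sum_nonneg])
  also have "\<dots> \<le> (1 / 10 ^ 4)\<^sup>2" using assms(3) by (simp add: power2_eq_square)
  finally show ?thesis by (rule power2_le_imp_le) (simp_all add: mult_right_mono)
qed

lemma mix_from:
  assumes iso: "no_isolated n E" and z: "z \<in> vertices n"
    and dz: "d / 100 \<le> real (degree n E z)" and nb: "\<not> bad_start z E"
    and deg: "\<And>v. v \<in> vertices n \<Longrightarrow> real (degree n E v) \<le> 6 * d"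
    and hv: "real (card (heavy n d E)) \<le> h" and h: "M * h \<le> 1 / 10 ^ 8" "cap1 * h \<le> 1 / 10 ^ 8" "cap2 * h \<le> 1 / 10 ^ 8"
    and sm: "6 * d * Rm \<le> smax"
    and st: "(\<Sum>y\<in>vertices n. max 0 (1 / real n - stat n E y)) \<le> 1 / 50"
  shows "dTV n (walk n E (dirac z) (t1 + 3)) (stat n E) \<le> 3 / 10"
proof -
  let ?V = "vertices n"
  define N where "N = nbrs n E z"
  define \<sigma> where "\<sigma> = run n (init z N) E"
  have N: "N \<subseteq> ?V" "z \<notin> N" "real (card N) = real (degree n E z)"
    using nbrs by (auto simp: N_def)
  have v0: "valid (init z N)" by (rule valid_init[OF z N(1,2)]) (use dz N in auto)
  have v: "valid \<sigma>" unfolding \<sigma>_def by (rule valid_run[OF v0])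
  have g: "walk_inv z \<sigma> E" unfolding \<sigma>_def by (rule walk_inv_run[OF v0]) (unfold N_def, rule walk_inv_init[OF z])
  have good: "good \<sigma>" and nf: "\<not> fin_fail \<sigma> E"
    using nb dz deg[OF z] N(3) by (auto simp: bad_start_def Let_def N_def[symmetric] \<sigma>_def[symmetric])
  note vd = validD[OF v]
  define T where "T = TT \<sigma>"
  define U where "U = UU \<sigma>"
  define S where "S = S1 \<sigma> E"
  define U' where "U' = U - S"
  define a where "a u = (if u \<in> T then wt \<sigma> u else 0)" for u
  define c1 where "c1 w = (if w \<in> S then b1 \<sigma> E w else 0)" for w
  define c2 where "c2 w = (if w \<in> U' then b2 \<sigma> S (b1 \<sigma> E) E w else 0)" for w
  have UV: "U \<subseteq> ?V" "T \<subseteq> ?V" "S \<subseteq> U" "finite T" "finite U" "finite U'" "finite S"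
    using vd finite_sub by (auto simp: U_def UU_def T_def S_def S1_def U'_def)
  have U'V: "U' \<subseteq> ?V" using UV by (auto simp: U'_def)
  have um1: "0 \<le> b1 \<sigma> E w" "b1 \<sigma> E w \<le> r1 \<sigma> E w" "(\<Sum>w\<in>U. (b1 \<sigma> E w)\<^sup>2) \<le> cap1" for w
    using unit_mass(1,2,6)[of "r1 \<sigma> E" cap1 U, OF r1_props(1,2)[OF v] less_imp_le[OF caps(1)]] UV(5)
    by (auto simp: b1_def U_def)
  have um2: "0 \<le> b2 \<sigma> S (b1 \<sigma> E) E w" "b2 \<sigma> S (b1 \<sigma> E) E w \<le> r2 \<sigma> S (b1 \<sigma> E) E w"
     "(\<Sum>w\<in>U'. (b2 \<sigma> S (b1 \<sigma> E) E w)\<^sup>2) \<le> cap2" "sum (b2 \<sigma> S (b1 \<sigma> E) E) U' \<le> 1" for w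
    using unit_mass(1,2,4,6)[of "r2 \<sigma> S (b1 \<sigma> E) E" cap2 U', OF r2_props[OF um1(1)] less_imp_le[OF caps(2)]] UV(6)
    by (auto simp: b2_def U_def U'_def)
  have a0: "0 \<le> a u" for u using vd by (auto simp: a_def T_def)
  have aw: "a i - 0 \<le> walk n E (dirac z) t1 i" for i
    using g good walk_dirac_nonneg by (auto simp: a_def T_def walk_inv_def good_def)
  obtain e1 where e1: "\<And>i. 0 \<le> e1 i"
      "\<And>r y. y \<in> ?V \<Longrightarrow> r y \<le> (\<Sum>u\<in>?V. bt * a u * of_bool (adj E y u)) \<Longrightarrow> r y - e1 y \<le> walk n E (dirac z) (Suc t1) y"
      "(\<Sum>i\<in>?V. e1 i) \<le> 6 * (\<Sum>i\<in>heavy n d E. a i)"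
    using push[of a "\<lambda>_. 0" "walk n E (dirac z) t1" E, OF aw walk_dirac_nonneg a0 order_refl deg]
    by (auto simp: walk_Suc bt_def)
  have s1: "c1 i - e1 i \<le> walk n E (dirac z) (Suc t1) i" if i: "i \<in> ?V" for i
  proof (rule e1(2)[OF i])
    show "c1 i \<le> (\<Sum>u\<in>?V. bt * a u * of_bool (adj E i u))"
    proof (cases "i \<in> S")
      case True
      have "c1 i \<le> r1 \<sigma> E i" using um1(2) True by (simp add: c1_def)
      also have "\<dots> \<le> (\<Sum>u\<in>T. bt * a u * of_bool (adj E i u))"
        using True UV(3) by (auto simp: r1_def capped_flow_def U_def[symmetric] T_def[symmetric] a_def)
      also have "\<dots> \<le> (\<Sum>u\<in>?V. bt * a u * of_bool (adj E i u))"
        by (rule sum_mono2) (use UV bt a0 in auto)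
      finally show ?thesis .
    qed (use bt a0 in \<open>auto simp: c1_def intro!: sum_nonneg\<close>)
  qed
  have c10: "0 \<le> c1 i" for i using um1 by (simp add: c1_def)
  obtain e2 where e2: "\<And>i. 0 \<le> e2 i"
      "\<And>r y. y \<in> ?V \<Longrightarrow> r y \<le> (\<Sum>u\<in>?V. bt * c1 u * of_bool (adj E y u)) \<Longrightarrow> r y - e2 y \<le> walk n E (dirac z) (Suc (Suc t1)) y"
      "(\<Sum>i\<in>?V. e2 i) \<le> 6 * ((\<Sum>i\<in>?V. e1 i) + (\<Sum>i\<in>heavy n d E. c1 i))"
    using push[of c1 e1 "walk n E (dirac z) (Suc t1)" E, OF s1 walk_dirac_nonneg c10 e1(1) deg]
    by (auto simp: walk_Suc[of _ _ _ "Suc t1"] bt_def)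
  have s2: "c2 i - e2 i \<le> walk n E (dirac z) (Suc (Suc t1)) i" if i: "i \<in> ?V" for i
  proof (rule e2(2)[OF i])
    show "c2 i \<le> (\<Sum>u\<in>?V. bt * c1 u * of_bool (adj E i u))"
    proof (cases "i \<in> U'")
      case True
      have "c2 i \<le> r2 \<sigma> S (b1 \<sigma> E) E i" using um2(2) True by (simp add: c2_def)
      also have "\<dots> \<le> (\<Sum>u\<in>S. bt * c1 u * of_bool (adj E i u))"
        using True by (auto simp: r2_def capped_flow_def U_def[symmetric] U'_def c1_def)
      also have "\<dots> \<le> (\<Sum>u\<in>?V. bt * c1 u * of_bool (adj E i u))"
        by (rule sum_mono2) (use UV bt c10 in auto)
      finally show ?thesis .
    qed (use bt c10 in \<open>auto simp: c2_def intro!: sum_nonneg\<close>)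
  qed
  have c20: "0 \<le> c2 i" for i using um2 by (simp add: c2_def)
  obtain e3 where e3: "\<And>i. 0 \<le> e3 i"
      "\<And>r y. y \<in> ?V \<Longrightarrow> r y \<le> (\<Sum>u\<in>?V. bt * c2 u * of_bool (adj E y u)) \<Longrightarrow> r y - e3 y \<le> walk n E (dirac z) (t1 + 3) y"
      "(\<Sum>i\<in>?V. e3 i) \<le> 6 * ((\<Sum>i\<in>?V. e2 i) + (\<Sum>i\<in>heavy n d E. c2 i))"
    using push[of c2 e2 "walk n E (dirac z) (Suc (Suc t1))" E, OF s2 walk_dirac_nonneg c20 e2(1) deg]
    by (auto simp: walk_Suc[of _ _ _ "Suc (Suc t1)"] bt_def numeral_3_eq_3)
  have n0: "0 < real n" using dpos by simp
  define q where "q y = r3 U' (b2 \<sigma> S (b1 \<sigma> E) E) E y" for y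
  \<comment> \<open>For \<open>qn\<close>: the mean is at most \<open>20 / (21 * n)\<close>, the two
    gaps add \<open>1 / (20 * n)\<close>, and 20/21 + 1/20 is below 1.003.\<close>
  have qle: "q y \<le> (\<Sum>u\<in>?V. bt * c2 u * of_bool (adj E y u))" and qn: "q y \<le> 1 / real n + 3 / (1000 * real n)"
    if y: "y \<in> U'" for y
  proof -
    let ?b = "b2 \<sigma> S (b1 \<sigma> E) E"
    let ?L = "{v\<in>U'. v < y}" and ?H = "{v\<in>U'. y < v}"
    have "q y \<le> (\<Sum>u\<in>?L. bt * c2 u * of_bool (adj E y u)) + (\<Sum>u\<in>?H. bt * c2 u * of_bool (adj E y u))"
      using y by (auto simp: q_def r3_def lo_def hi_def capped_flow_def c2_def intro!: add_mono)
    also have "\<dots> = (\<Sum>u\<in>?L \<union> ?H. bt * c2 u * of_bool (adj E y u))"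
      by (subst sum.union_disjoint) (use UV in auto)
    also have "\<dots> \<le> (\<Sum>u\<in>?V. bt * c2 u * of_bool (adj E y u))"
      by (rule sum_mono2) (use U'V bt c20 in auto)
    finally show "q y \<le> (\<Sum>u\<in>?V. bt * c2 u * of_bool (adj E y u))" .
    have "q y \<le> p * (\<Sum>v\<in>?L. bt * ?b v) + p * (\<Sum>v\<in>?H. bt * ?b v) + 1 / (20 * real n)"
      using y by (simp add: q_def r3_def lo_def hi_def capped_flow_def)
    also have "p * (\<Sum>v\<in>?L. bt * ?b v) + p * (\<Sum>v\<in>?H. bt * ?b v) = p * (\<Sum>v\<in>?L \<union> ?H. bt * ?b v)"
      by (subst sum.union_disjoint) (use UV in \<open>auto simp: algebra_simps\<close>)
    also have "\<dots> = 20 / (21 * real n) * (\<Sum>v\<in>?L \<union> ?H. ?b v)"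
      unfolding bt(2)[symmetric] by (simp add: sum_distrib_left mult.assoc)
    also have "\<dots> \<le> 20 / (21 * real n) * 1"
    proof (intro mult_left_mono)
      have "(\<Sum>v\<in>?L \<union> ?H. ?b v) \<le> sum ?b U'" by (rule sum_mono2) (use UV um2 in auto)
      thus "(\<Sum>v\<in>?L \<union> ?H. ?b v) \<le> 1" using um2(4) by linarith
    qed (use n0 in auto)
    finally show "q y \<le> 1 / real n + 3 / (1000 * real n)" using n0 by (simp add: field_simps)
  qed
  have cS: "real (card S) \<le> smax"
  proof -
    have "S \<subseteq> (\<Union>u\<in>T. {j \<in> ?V. adj E u j})"
      using UV by (auto simp: S_def S1_def T_def U_def adj_sym)
    hence "card S \<le> card (\<Union>u\<in>T. {j \<in> ?V. adj E u j})" by (intro card_mono) (use UV in auto)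
    also have "\<dots> \<le> (\<Sum>u\<in>T. degree n E u)" unfolding degree_def by (rule card_UN_le) (use UV in auto)
    finally have "real (card S) \<le> (\<Sum>u\<in>T. real (degree n E u))" by (metis of_nat_le_iff of_nat_sum)
    also have "\<dots> \<le> (\<Sum>u\<in>T. 6 * d)" using deg UV by (intro sum_mono) auto
    also have "\<dots> = real (card T) * (6 * d)" by simp
    also have "\<dots> \<le> Rm * (6 * d)"
    proof (intro mult_right_mono)
      have "real (card T) \<le> real (card (RR \<sigma>))" using card_mono[OF vd(6,3)] by (simp add: T_def)
      thus "real (card T) \<le> Rm" using good by (simp add: good_def)
    qed (use dpos in auto)
    also have "\<dots> \<le> smax" using sm by (simp add: mult_ac)
    finally show ?thesis .
  qed
  have q76: "76 / 100 \<le> sum q U'"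
    using nf cS by (auto simp: fin_fail_def q_def U'_def U_def S_def)
  have H0: "(\<Sum>i\<in>heavy n d E. a i) \<le> 1 / 10^4"
    by (rule heavy_mass[OF UV(4) _ h(1) hv _ M]) (use good in \<open>auto simp: a_def T_def good_def\<close>)
  have H1: "(\<Sum>i\<in>heavy n d E. c1 i) \<le> 1 / 10^4"
  proof (rule heavy_mass[OF UV(5) _ h(2) hv _ less_imp_le[OF caps(1)]])
    have "(\<Sum>u\<in>U. (c1 u)\<^sup>2) \<le> (\<Sum>u\<in>U. (b1 \<sigma> E u)\<^sup>2)" by (rule sum_mono) (simp add: c1_def)
    thus "(\<Sum>u\<in>U. (c1 u)\<^sup>2) \<le> cap1" using um1(3) by linarith
  qed (use UV in \<open>auto simp: c1_def\<close>)
  have H2: "(\<Sum>i\<in>heavy n d E. c2 i) \<le> 1 / 10^4"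
  proof (rule heavy_mass[OF UV(6) _ h(3) hv _ less_imp_le[OF caps(2)]])
    show "(\<Sum>u\<in>U'. (c2 u)\<^sup>2) \<le> cap2" using um2(3) by (simp add: c2_def)
  qed (auto simp: c2_def)
  \<comment> \<open>With heavy mass at most \<open>10^(-4)\<close> before each step, the three
    errors are at most 6, 42 and 258 times \<open>10^(-4)\<close>.\<close>
  have E3: "(\<Sum>i\<in>?V. e3 i) \<le> 3 / 100" using e1(3) e2(3) e3(3) H0 H1 H2 by simp
  \<comment> \<open>The flow is lowered by its excess over \<open>1 / n\<close>, by the error and by
    the deficit of \<open>stat\<close> below \<open>1 / n\<close>; what is left lies below both
    distributions. In total, 0.76 - 0.003 - 0.03 - 0.02 is above 0.7.\<close>
  have "(\<Sum>y\<in>?V. (if y \<in> U' then q y - 3 / (1000 * real n) else 0) - e3 y - max 0 (1 / real n - stat n E y))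
     \<le> (\<Sum>y\<in>?V. min (walk n E (dirac z) (t1 + 3) y) (stat n E y))"
  proof (rule sum_mono)
    fix y assume y: "y \<in> ?V"
    have w0: "0 \<le> walk n E (dirac z) (t1 + 3) y" by (rule walk_dirac_nonneg)
    have e0: "0 \<le> e3 y" by (rule e3(1))
    have s0: "0 \<le> stat n E y" by (rule stat_nonneg)
    show "(if y \<in> U' then q y - 3 / (1000 * real n) else 0) - e3 y - max 0 (1 / real n - stat n E y)
       \<le> min (walk n E (dirac z) (t1 + 3) y) (stat n E y)"
    proof (cases "y \<in> U'")
      case True
      have "q y - e3 y \<le> walk n E (dirac z) (t1 + 3) y" by (rule e3(2)[where r=q, OF y qle[OF True]])
      moreover have "0 \<le> 3 / (1000 * real n)" by simp
      moreover have "0 \<le> max 0 (1 / real n - stat n E y)" "1 / real n - stat n E y \<le> max 0 (1 / real n - stat n E y)"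
        by (rule max.cobounded1, rule max.cobounded2)
      ultimately show ?thesis unfolding if_P[OF True] min.bounded_iff
        using qn[OF True] e0 by (intro conjI; linarith)
    next
      case False
      have "0 \<le> max 0 (1 / real n - stat n E y)" by (rule max.cobounded1)
      thus ?thesis unfolding if_not_P[OF False] min.bounded_iff using w0 e0 s0 by (intro conjI; linarith)
    qed
  qed
  moreover have "(\<Sum>y\<in>?V. (if y \<in> U' then q y - 3 / (1000 * real n) else 0)) \<ge> 76 / 100 - 3 / 1000"
  proof -
    have "(\<Sum>y\<in>?V. (if y \<in> U' then q y - 3 / (1000 * real n) else 0)) = (\<Sum>y\<in>U'. q y - 3 / (1000 * real n))"
      by (rule sum.mono_neutral_cong_right) (use U'V in auto)
    also have "\<dots> = sum q U' - real (card U') * (3 / (1000 * real n))" by (simp add: sum_subtractf)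
    finally have "(\<Sum>y\<in>?V. (if y \<in> U' then q y - 3 / (1000 * real n) else 0)) = sum q U' - real (card U') * (3 / (1000 * real n))" .
    moreover have "real (card U') * (3 / (1000 * real n)) \<le> real n * (3 / (1000 * real n))"
      using card_mono[OF finite_vertices U'V] by (intro mult_right_mono) auto
    moreover have "real n * (3 / (1000 * real n)) = 3 / 1000" using n0 by simp
    ultimately show ?thesis using q76 by linarith
  qed
  ultimately have "(\<Sum>y\<in>?V. min (walk n E (dirac z) (t1 + 3) y) (stat n E y)) \<ge> 7 / 10"
    using E3 st by (simp add: sum_subtractf)
  moreover have "dTV n (walk n E (dirac z) (t1 + 3)) (stat n E) \<le> 1 - (\<Sum>y\<in>?V. min (walk n E (dirac z) (t1 + 3) y) (stat n E y))"
    by (rule dTV_overlap[OF dirac_walk_sum[OF iso z] stat_sum[OF iso]]) (use dpos in auto)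
  ultimately show ?thesis by linarith
qed

end

subsection \<open>Typical graphs\<close>

locale gnp =
  fixes n :: nat and p d :: real
  assumes p: "0 \<le> p" "p \<le> 1" and d: "d = p * real n" and n1: "1 \<le> n" and dpos: "0 < d"
begin

abbreviation "V \<equiv> vertices n"
abbreviation "PR Q \<equiv> Pr (pot_edges n) p Q"

section \<open>Degree tails and closeness of the stationary distribution to uniform\<close>

lemma deg_star: "real (degree n E v) = (\<Sum>u\<in>V - {v}. of_bool (adj E v u))"
  unfolding real_degree by (rule sum.mono_neutral_right) (auto simp: adj_def)

lemma card_rest: "v \<in> V \<Longrightarrow> p * real (card (V - {v})) = d - p"
  using n1 by (simp add: d algebra_simps of_nat_diff)

lemma deg_mgf:
  assumes "v \<in> V"
  shows "expect (pot_edges n) p (\<lambda>E. exp (\<theta> * real (degree n E v))) \<le> exp ((d - p) * (exp \<theta> - 1))"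
proof -
  have "expect (pot_edges n) p (\<lambda>E. exp (\<theta> * real (degree n E v))) \<le> exp (p * (\<Sum>u\<in>V - {v}. exp \<theta> - 1))"
  proof -
    have eq: "(\<lambda>E. exp (\<theta> * real (degree n E v))) = (\<lambda>E. exp (\<Sum>u\<in>V - {v}. \<theta> * of_bool (adj E v u)))"
      by (simp only: deg_star sum_distrib_left)
    show ?thesis unfolding eq by (rule expect_exp_star[OF p assms]) auto
  qed
  also have "p * (\<Sum>u\<in>V - {v}. exp \<theta> - 1) = (p * real (card (V - {v}))) * (exp \<theta> - 1)" by simp
  finally show ?thesis by (simp only: card_rest[OF assms])
qed

text \<open>Markov's inequality for \<open>exp (\<theta> * degree - c)\<close>; with
  \<open>\<theta>\<close> of either sign it serves both tails.\<close>

lemma deg_tail: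
  assumes "v \<in> V" and "\<And>E. Q E \<Longrightarrow> 0 \<le> \<theta> * real (degree n E v) - c"
  shows "PR Q \<le> exp ((d - p) * (exp \<theta> - 1) - c)"
proof -
  have "PR Q \<le> expect (pot_edges n) p (\<lambda>E. exp (- c) * exp (\<theta> * real (degree n E v)))"
  proof (rule Pr_le_expect[OF finite_pot_edges])
    fix E
    show "of_bool (Q E) \<le> exp (- c) * exp (\<theta> * real (degree n E v))"
      using assms(2)[of E] by (cases "Q E") (auto simp: exp_add[symmetric])
  qed
  also have "\<dots> \<le> exp (- c) * exp ((d - p) * (exp \<theta> - 1))" using deg_mgf[OF assms(1)] by simp
  also have "\<dots> = exp ((d - p) * (exp \<theta> - 1) - c)" by (simp add: exp_add[symmetric])
  finally show ?thesis .
qed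

lemma PR_vertex:
  assumes "\<And>v. v \<in> V \<Longrightarrow> PR (Q v) \<le> c"
  shows "PR (\<lambda>E. \<exists>v\<in>V. Q v E) \<le> real n * c"
proof -
  have "PR (\<lambda>E. \<exists>v\<in>V. Q v E) \<le> (\<Sum>v\<in>V. PR (Q v))" by (rule Pr_bex) simp
  also have "\<dots> \<le> (\<Sum>v\<in>V. c)" by (rule sum_mono) (rule assms)
  finally show ?thesis by simp
qed

lemma pd: "p \<le> d"
  using mult_left_mono[of 1 "real n" p] p n1 by (simp add: d)

lemma prob_isolated: "PR (\<lambda>E. \<not> no_isolated n E) \<le> exp (2 - (d - ln (real n)))"
proof -
  have n0: "0 < real n" using n1 by simp
  have "PR (\<lambda>E. \<exists>v\<in>V. degree n E v = 0) \<le> real n * exp (2 - d)"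
  proof (rule PR_vertex)
    fix v assume v: "v \<in> V"
    \<comment> \<open>\<open>\<theta> = - ln n\<close> stands in for minus infinity:
      \<open>exp \<theta> = 1 / n\<close> contributes at most 1 to the exponent, and replacing
      \<open>d - p\<close> by \<open>d\<close> costs at most 1 more, whence the 2.\<close>
    have "PR (\<lambda>E. degree n E v = 0) \<le> exp ((d - p) * (exp (- ln (real n)) - 1) - 0)"
      by (rule deg_tail[OF v]) simp
    also have "\<dots> \<le> exp (2 - d)"
    proof -
      have "(d - p) * exp (- ln (real n)) \<le> d * (1 / real n)"
        using pd p n0 by (intro mult_mono) (auto simp: exp_minus field_simps)
      also have "\<dots> \<le> 1" using p n0 by (simp add: d)
      finally show ?thesis using p by (simp add: algebra_simps)
    qed
    finally show "PR (\<lambda>E. degree n E v = 0) \<le> exp (2 - d)" .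
  qed
  moreover have "(\<lambda>E. \<not> no_isolated n E) = (\<lambda>E. \<exists>v\<in>V. degree n E v = 0)" by (auto simp: no_isolated_def fun_eq_iff)
  moreover have "exp (2 - (d - ln (real n))) = real n * exp (2 - d)"
    using n0 exp_add[of "2 - d" "ln (real n)"] by (simp add: algebra_simps)
  ultimately show ?thesis by simp
qed

lemma prob_max_degree: "PR (\<lambda>E. \<exists>v\<in>V. 6 * d < real (degree n E v)) \<le> real n * exp (- (4 * d))"
proof (rule PR_vertex)
  fix v assume v: "v \<in> V"
  have "PR (\<lambda>E. 6 * d < real (degree n E v)) \<le> exp ((d - p) * (exp 1 - 1) - 6 * d)"
    by (rule deg_tail[OF v]) simp
  also have "(d - p) * (exp 1 - 1) \<le> d * 2" using exp_le pd p by (intro mult_mono) auto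
  finally show "PR (\<lambda>E. 6 * d < real (degree n E v)) \<le> exp (- (4 * d))" by simp
qed

lemma prob_heavy: "PR (\<lambda>E. real n * exp (- (d / 3200)) < real (card (heavy n d E))) \<le> exp (- (d / 3200))"
proof -
  have n0: "0 < real n" using n1 by simp
  have one: "PR (\<lambda>E. v \<in> heavy n d E) \<le> exp (- (d / 1600))" if v: "v \<in> V" for v
  proof -
    \<comment> \<open>With \<open>\<theta> = 1/40\<close> the exponent is
      \<open>d * (41/1600 - 42/1600)\<close>. Markov's inequality below splits it evenly between the
      number of heavy vertices and the failure probability.\<close>
    have "PR (\<lambda>E. v \<in> heavy n d E) \<le> exp ((d - p) * (exp (1/40) - 1) - 21 / 800 * d)"
      by (rule deg_tail[OF v]) (simp add: heavy_def)
    also have "(d - p) * (exp (1/40) - 1) \<le> d * (41 / 1600)"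
      using exp_le_quadratic[of "1/40"] pd p by (intro mult_mono) (auto simp: power2_eq_square)
    finally show ?thesis by simp
  qed
  have "PR (\<lambda>E. real n * exp (- (d / 3200)) < real (card (heavy n d E)))
    \<le> expect (pot_edges n) p (\<lambda>E. exp (d / 3200) / real n * (\<Sum>v\<in>V. of_bool (v \<in> heavy n d E)))"
  proof (rule Pr_le_expect[OF finite_pot_edges])
    fix E
    have "(\<Sum>v\<in>V. of_bool (v \<in> heavy n d E)) = real (card (heavy n d E))"
      by (simp add: heavy_def Int_def conj_commute)
    moreover have "1 \<le> exp (d / 3200) / real n * real (card (heavy n d E))"
      if "real n * exp (- (d / 3200)) < real (card (heavy n d E))"
    proof -
      have "exp (d / 3200) / real n * (real n * exp (- (d / 3200))) \<le> exp (d / 3200) / real n * real (card (heavy n d E))"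
        using that by (intro mult_left_mono) auto
      thus ?thesis using n0 by (simp add: exp_minus)
    qed
    ultimately show "of_bool (real n * exp (- (d / 3200)) < real (card (heavy n d E)))
       \<le> exp (d / 3200) / real n * (\<Sum>v\<in>V. of_bool (v \<in> heavy n d E))"
      by (cases "real n * exp (- (d / 3200)) < real (card (heavy n d E))") auto
  qed
  also have "\<dots> = exp (d / 3200) / real n * (\<Sum>v\<in>V. PR (\<lambda>E. v \<in> heavy n d E))"
    by (simp add: Bochner_Integration.integral_sum expect_indicator del: sum_of_bool_eq)
  also have "\<dots> \<le> exp (d / 3200) / real n * (\<Sum>v\<in>V. exp (- (d / 1600)))"
    by (intro mult_left_mono sum_mono one) auto
  also have "\<dots> = exp (d / 3200) * exp (- (d / 1600))" using n0 by simp
  also have "\<dots> = exp (- (d / 3200))" by (simp add: exp_add[symmetric])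
  finally show ?thesis .
qed

definition var_bad :: "(nat set \<Rightarrow> bool) \<Rightarrow> bool" where
  "var_bad E \<longleftrightarrow> real n * d\<^sup>2 / 40000 < (\<Sum>v\<in>V. (real (degree n E v) - d)\<^sup>2)"

lemma prob_var_bad: "PR var_bad \<le> 80000 * (d + 1) / d\<^sup>2"
proof -
  have n0: "0 < real n" using n1 by simp
  have one: "expect (pot_edges n) p (\<lambda>E. (real (degree n E v) - d)\<^sup>2) \<le> 2 * (d + 1)" if v: "v \<in> V" for v
  proof -
    have "expect (pot_edges n) p (\<lambda>E. (real (degree n E v) - d)\<^sup>2) \<le> expect (pot_edges n) p (\<lambda>E. 2 * (real (degree n E v) - (d - p))\<^sup>2 + 2)"
    proof (rule expect_mono[OF finite_pot_edges])
      fix E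
      have "0 \<le> (real (degree n E v) - (d - p) + p)\<^sup>2" by simp
      moreover have "p\<^sup>2 \<le> 1" using p by (simp add: power_le_one)
      ultimately show "(real (degree n E v) - d)\<^sup>2 \<le> 2 * (real (degree n E v) - (d - p))\<^sup>2 + 2"
        by (simp add: power2_eq_square algebra_simps)
    qed
    also have "\<dots> = 2 * expect (pot_edges n) p (\<lambda>E. (real (degree n E v) - (d - p))\<^sup>2) + 2" by simp
    also have "expect (pot_edges n) p (\<lambda>E. (real (degree n E v) - (d - p))\<^sup>2) \<le> d - p"
      using expect_variance_star[OF p v, of "V - {v}" "\<lambda>_. 1"] card_rest[OF v] by (simp add: deg_star)
    finally show ?thesis using p by simp
  qed
  have "PR var_bad \<le> expect (pot_edges n) p (\<lambda>E. 40000 / (real n * d\<^sup>2) * (\<Sum>v\<in>V. (real (degree n E v) - d)\<^sup>2))"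
  proof (rule Pr_le_expect[OF finite_pot_edges])
    fix E
    have "1 \<le> 40000 / (real n * d\<^sup>2) * (\<Sum>v\<in>V. (real (degree n E v) - d)\<^sup>2)" if "var_bad E"
      using that n0 dpos by (simp add: var_bad_def field_simps)
    moreover have "0 \<le> 40000 / (real n * d\<^sup>2) * (\<Sum>v\<in>V. (real (degree n E v) - d)\<^sup>2)"
      using n0 by (intro mult_nonneg_nonneg sum_nonneg) auto
    ultimately show "of_bool (var_bad E) \<le> 40000 / (real n * d\<^sup>2) * (\<Sum>v\<in>V. (real (degree n E v) - d)\<^sup>2)"
      by (cases "var_bad E") auto
  qed
  also have "\<dots> = 40000 / (real n * d\<^sup>2) * (\<Sum>v\<in>V. expect (pot_edges n) p (\<lambda>E. (real (degree n E v) - d)\<^sup>2))"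
    by (simp add: Bochner_Integration.integral_sum)
  also have "\<dots> \<le> 40000 / (real n * d\<^sup>2) * (\<Sum>v\<in>V. 2 * (d + 1))"
    using n0 by (intro mult_left_mono sum_mono one) auto
  also have "\<dots> = 80000 * (d + 1) / d\<^sup>2" using n0 by simp
  finally show ?thesis .
qed

text \<open>A bound on the sum of squared deviations gives closeness to uniform in the
  \<open>l^1\<close> sense, although single degrees may be far from \<open>d\<close>.\<close>

lemma not_var_bad:
  assumes "\<not> var_bad E"
  shows "(\<Sum>y\<in>V. max 0 (1 / real n - stat n E y)) \<le> 1 / 50"
    "real n * d * (199 / 200) \<le> 2 * real (num_edges n E)"
proof -
  have n0: "0 < real n" using n1 by simp
  let ?D = "2 * real (num_edges n E)"
  let ?x = "\<lambda>v. real (degree n E v) - d"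
  have D: "?D = (\<Sum>v\<in>V. real (degree n E v))" using handshake[of n E] by (metis of_nat_mult of_nat_numeral of_nat_sum)
  \<comment> \<open>AM-GM, weighted so that the constant and the quadratic part each sum to at most
    \<open>n * d / 400\<close>.\<close>
  have ab: "\<bar>?x v\<bar> \<le> d / 400 + 100 / d * (?x v)\<^sup>2" for v
  proof -
    have "0 \<le> (d / 20 - 10 * (2 / 2) * \<bar>?x v\<bar>)\<^sup>2" by simp
    hence "d * \<bar>?x v\<bar> \<le> d\<^sup>2 / 400 + 100 * (?x v)\<^sup>2" by (simp add: power2_eq_square algebra_simps abs_mult_self_eq)
    thus ?thesis using dpos by (simp add: field_simps power2_eq_square)
  qed
  have s: "(\<Sum>v\<in>V. \<bar>?x v\<bar>) \<le> real n * d / 200"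
  proof -
    have "(\<Sum>v\<in>V. \<bar>?x v\<bar>) \<le> (\<Sum>v\<in>V. d / 400 + 100 / d * (?x v)\<^sup>2)" by (intro sum_mono ab)
    also have "\<dots> = real n * d / 400 + 100 / d * (\<Sum>v\<in>V. (?x v)\<^sup>2)" by (simp add: sum.distrib sum_distrib_left)
    also have "\<dots> \<le> real n * d / 400 + 100 / d * (real n * d\<^sup>2 / 40000)"
      using assms dpos by (intro add_left_mono mult_left_mono) (auto simp: var_bad_def)
    also have "\<dots> = real n * d / 200" using dpos by (simp add: power2_eq_square)
    finally show ?thesis .
  qed
  have "?D - real n * d = (\<Sum>v\<in>V. ?x v)" by (simp add: D sum_subtractf)
  hence Dd: "\<bar>?D - real n * d\<bar> \<le> real n * d / 200" using s sum_abs[of ?x V] by linarith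
  thus "real n * d * (199 / 200) \<le> ?D" by linarith
  have D1: "?D \<le> 201 / 200 * (real n * d)" using Dd by linarith
  have nd: "0 < real n * d" using n0 dpos by simp
  have Dp: "0 < ?D" using Dd nd by linarith
  have "max 0 (1 / real n - stat n E y) \<le> (d / 200 + \<bar>?x y\<bar>) / (real n * d)" for y
  proof -
    have "real (degree n E y) / (201 / 200 * (real n * d)) \<le> stat n E y"
    proof -
      have "0 < 201 / 200 * (real n * d)" using nd by linarith
      thus ?thesis unfolding stat_def
        by (rule divide_left_mono[OF D1 of_nat_0_le_iff mult_pos_pos[OF _ Dp]])
    qed
    moreover have "1 / real n - real (degree n E y) / (201 / 200 * (real n * d)) = (d / 200 - ?x y) / (201 / 200 * (real n * d))"
      using n0 dpos by (simp add: field_simps)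
    moreover have "(d / 200 - ?x y) / (201 / 200 * (real n * d)) \<le> (d / 200 + \<bar>?x y\<bar>) / (real n * d)"
      using nd dpos by (intro frac_le) auto
    moreover have "0 \<le> (d / 200 + \<bar>?x y\<bar>) / (real n * d)" using nd dpos by simp
    ultimately show ?thesis by simp
  qed
  hence "(\<Sum>y\<in>V. max 0 (1 / real n - stat n E y)) \<le> (\<Sum>y\<in>V. (d / 200 + \<bar>?x y\<bar>) / (real n * d))" by (rule sum_mono)
  also have "\<dots> = (real n * d / 200 + (\<Sum>v\<in>V. \<bar>?x v\<bar>)) / (real n * d)"
    by (simp add: sum_divide_distrib[symmetric] sum.distrib)
  also have "\<dots> \<le> (real n * d / 200 + real n * d / 200) / (real n * d)"
    by (rule divide_right_mono) (use s nd in linarith)+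
  also have "\<dots> = 1 / 100" using n0 dpos by (simp add: field_simps)
  finally show "(\<Sum>y\<in>V. max 0 (1 / real n - stat n E y)) \<le> 1 / 50" by simp
qed

definition low_adj :: "(nat set \<Rightarrow> bool) \<Rightarrow> bool" where
  "low_adj E \<longleftrightarrow> (\<exists>v\<in>V. \<exists>w\<in>V. v \<noteq> w \<and> adj E v w \<and> real (degree n E v) < d / 100 \<and> real (degree n E w) < d / 100)"

text \<open>For \<open>d\<close> close to \<open>ln n\<close>, a union bound cannot exclude single
  vertices of degree below \<open>d / 100\<close>. Adjacent pairs can be excluded, since three
  disjoint sets of edges are involved: the edge itself contributes \<open>p\<close>, and each
  endpoint about \<open>exp (- 7/8 * d)\<close>, up to a joint factor
  \<open>exp (6/100 * d)\<close>.\<close>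

lemma prob_low_adj: "PR low_adj \<le> real n * d * exp (4 - 169 / 100 * d)"
proof -
  have one: "PR (\<lambda>E. v \<noteq> w \<and> adj E v w \<and> real (degree n E v) < d / 100 \<and> real (degree n E w) < d / 100) \<le> p * exp (4 - 169 / 100 * d)"
    if vw: "v \<in> V" "w \<in> V" for v w
  proof (cases "v = w")
    case True thus ?thesis using p by simp
  next
    case False
    let ?S = "V - {v, w}"
    let ?f = "\<lambda>u E. exp (\<Sum>x\<in>?S. (-3) * of_bool (adj E u x)) :: real"
    have cS: "p * real (card ?S) \<ge> d - 2"
    proof -
      have "card ?S = n - 2" using False vw by (simp add: card_Diff_subset)
      hence "real n - 2 \<le> real (card ?S)" by simp
      hence "p * (real n - 2) \<le> p * real (card ?S)" using p by (intro mult_left_mono) auto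
      thus ?thesis using p by (simp add: d algebra_simps)
    qed
    have f: "expect (pot_edges n) p (?f u) \<le> exp (- (7 / 8 * (d - 2)))" if u: "u \<in> {v, w}" for u
    proof -
      have "expect (pot_edges n) p (?f u) \<le> exp (p * (\<Sum>x\<in>?S. exp (-3) - 1))"
        by (rule expect_exp_star[OF p]) (use u vw in auto)
      also have "p * (\<Sum>x\<in>?S. exp (-3) - 1) = - ((p * real (card ?S)) * (1 - exp (-3)))" by (simp add: algebra_simps)
      also have "\<dots> \<le> - (7 / 8 * (d - 2))"
      proof -
        have "8 \<le> exp (3::real)" using exp_lower_Taylor_quadratic[of 3] by (simp add: power2_eq_square)
        hence e: "exp (-3) \<le> (1 / 8 :: real)" by (simp add: exp_minus field_simps)
        have "(d - 2) * (7 / 8) \<le> (p * real (card ?S)) * (7 / 8)" using cS by simp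
        also have "\<dots> \<le> (p * real (card ?S)) * (1 - exp (-3))" using e p by (intro mult_left_mono) auto
        finally show ?thesis by simp
      qed
      finally show ?thesis by simp
    qed
    have degS: "(\<Sum>x\<in>?S. of_bool (adj E u x)) \<le> real (degree n E u)" for E u
      unfolding real_degree by (rule sum_mono2) auto
    have "PR (\<lambda>E. v \<noteq> w \<and> adj E v w \<and> real (degree n E v) < d / 100 \<and> real (degree n E w) < d / 100)
       \<le> expect (pot_edges n) p (\<lambda>E. exp (6 / 100 * d) * (of_bool (E {v, w}) * (?f v E * ?f w E)))"
    proof (rule Pr_le_expect[OF finite_pot_edges])
      fix E
      have "1 \<le> exp (6 / 100 * d) * (?f v E * ?f w E)" if "real (degree n E v) < d / 100" "real (degree n E w) < d / 100"
      proof -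
        have "0 \<le> 6 / 100 * d + ((\<Sum>x\<in>?S. (-3) * of_bool (adj E v x)) + (\<Sum>x\<in>?S. (-3) * of_bool (adj E w x)))"
          using that degS[of E v] degS[of E w] unfolding sum_distrib_left[symmetric] by linarith
        thus ?thesis unfolding exp_add[symmetric] by (simp only: one_le_exp_iff)
      qed
      thus "of_bool (v \<noteq> w \<and> adj E v w \<and> real (degree n E v) < d / 100 \<and> real (degree n E w) < d / 100)
        \<le> exp (6 / 100 * d) * (of_bool (E {v, w}) * (?f v E * ?f w E))"
        by (auto simp: adj_def of_bool_def)
    qed
    also have "\<dots> = exp (6 / 100 * d) * (expect (pot_edges n) p (\<lambda>E. of_bool (E {v, w})) * (expect (pot_edges n) p (?f v) * expect (pot_edges n) p (?f w)))"
    proof -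
      have o: "on_edges (star u ?S) (?f u)" for u by (rule on_edges_comp[OF on_edges_star_sum])
      have 1: "expect (pot_edges n) p (\<lambda>E. ?f v E * ?f w E) = expect (pot_edges n) p (?f v) * expect (pot_edges n) p (?f w)"
        by (rule expect_indep[OF finite_pot_edges o o]) (use False in \<open>auto simp: star_def doubleton_eq_iff\<close>)
      have o2: "on_edges (star v ?S \<union> star w ?S) (\<lambda>E. ?f v E * ?f w E)"
      proof (rule on_edgesI)
        fix E E' :: "nat set \<Rightarrow> bool" assume *: "\<And>e. e \<in> star v ?S \<union> star w ?S \<Longrightarrow> E e = E' e"
        have "?f v E = ?f v E'" by (rule on_edgesD[OF o]) (use * in blast)
        moreover have "?f w E = ?f w E'" by (rule on_edgesD[OF o]) (use * in blast)
        ultimately show "?f v E * ?f w E = ?f v E' * ?f w E'" by simp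
      qed
      have "expect (pot_edges n) p (\<lambda>E. of_bool (E {v, w}) * (?f v E * ?f w E))
        = expect (pot_edges n) p (\<lambda>E. of_bool (E {v, w})) * expect (pot_edges n) p (\<lambda>E. ?f v E * ?f w E)"
        by (rule expect_indep[OF finite_pot_edges on_edges_single o2]) (auto simp: star_def doubleton_eq_iff)
      thus ?thesis using 1 by simp
    qed
    also have "expect (pot_edges n) p (\<lambda>E. of_bool (E {v, w})) = p"
      using expect_single[OF finite_pot_edges pair_in_pot_edges[OF vw False] p, of of_bool] by simp
    also have "exp (6 / 100 * d) * (p * (expect (pot_edges n) p (?f v) * expect (pot_edges n) p (?f w)))
      \<le> exp (6 / 100 * d) * (p * (exp (- (7 / 8 * (d - 2))) * exp (- (7 / 8 * (d - 2)))))"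
      using f p by (intro mult_left_mono mult_mono) (auto intro!: Bochner_Integration.integral_nonneg)
    also have "\<dots> = p * exp (6 / 100 * d - 7 / 8 * (d - 2) - 7 / 8 * (d - 2))"
      by (simp add: exp_add[symmetric] exp_diff[symmetric] mult.left_commute[of _ p])
    also have "\<dots> \<le> p * exp (4 - 169 / 100 * d)"
    proof (rule mult_left_mono[OF _ p(1)], unfold exp_le_cancel_iff)
      show "6 / 100 * d - 7 / 8 * (d - 2) - 7 / 8 * (d - 2) \<le> 4 - 169 / 100 * d"
        by (simp add: algebra_simps)
    qed
    finally show ?thesis .
  qed
  have "PR low_adj \<le> real n * (real n * (p * exp (4 - 169 / 100 * d)))"
    unfolding low_adj_def by (intro PR_vertex one)
  thus ?thesis by (simp add: d mult_ac)
qed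

text \<open>The vertices of \<open>X\<close> are avoided.  A vertex \<open>w\<close> that is new at radius \<open>s + 1\<close> has a
  neighbour in the ball of radius \<open>s\<close> that avoids \<open>w\<close>, and this ball is independent of the
  edges at \<open>w\<close>.\<close>

fun ball :: "nat set \<Rightarrow> (nat set \<Rightarrow> bool) \<Rightarrow> nat \<Rightarrow> nat set" where
  "ball X E 0 = {1} - X"
| "ball X E (Suc s) = ball X E s \<union> {w \<in> V - X. \<exists>u\<in>ball X E s. adj E u w}"

lemma ball_sub: "ball X E s \<subseteq> V - X"
  using n1 by (induction s) (auto simp: vertices_def)

lemma ball_mono: "s \<le> t \<Longrightarrow> ball X E s \<subseteq> ball X E t"
  by (induction t) (auto simp: le_Suc_eq)

lemma ball_avoid: "ball X E s \<subseteq> ball {} E s"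
  by (induction s) auto

lemma ball_eq_avoid: "w \<notin> ball {} E s \<Longrightarrow> ball {} E s \<subseteq> ball {w} E s"
proof (induction s)
  case (Suc s)
  hence "ball {} E s \<subseteq> ball {w} E s" by simp
  thus ?case using Suc.prems by auto
qed auto

lemma ball_on: "on_edges (edges_off {w}) (\<lambda>E. ball {w} E s)"
proof (induction s)
  case (Suc s)
  show ?case
  proof (rule on_edgesI)
    fix E E' :: "nat set \<Rightarrow> bool" assume *: "\<And>e. e \<in> edges_off {w} \<Longrightarrow> E e = E' e"
    have 1: "ball {w} E s = ball {w} E' s" by (rule on_edgesD[OF Suc]) (rule *)
    have "adj E u x = adj E' u x" if "u \<in> ball {w} E' s" "x \<in> V - {w}" for u x
    proof -
      have "E {u, x} = E' {u, x}" by (rule *) (use that ball_sub[of "{w}" E' s] in \<open>auto simp: edges_off_def\<close>)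
      thus ?thesis by (simp add: adj_def)
    qed
    thus "ball {w} E (Suc s) = ball {w} E' (Suc s)" using 1 by auto
  qed
qed (simp add: on_edges_const)

lemma expect_ball: "expect (pot_edges n) p (\<lambda>E. real (card (ball {} E s))) \<le> (1 + d) ^ s"
proof (induction s)
  case (Suc s)
  let ?A = "pot_edges n"
  have pt: "real (card (ball {} E (Suc s))) \<le> real (card (ball {} E s)) + (\<Sum>w\<in>V. \<Sum>u\<in>V. of_bool (u \<in> ball {w} E s) * of_bool (adj E u w))" for E
  proof -
    have fb: "finite (ball {} E s)" by (rule finite_subset[OF ball_sub]) simp
    have new: "ball {} E (Suc s) \<subseteq> ball {} E s \<union> {w \<in> V. \<exists>u\<in>V. u \<in> ball {w} E s \<and> adj E u w}"
    proof
      fix w assume w: "w \<in> ball {} E (Suc s)"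
      show "w \<in> ball {} E s \<union> {w \<in> V. \<exists>u\<in>V. u \<in> ball {w} E s \<and> adj E u w}"
      proof (cases "w \<in> ball {} E s")
        case False
        then obtain u where "u \<in> ball {} E s" "adj E u w" "w \<in> V" using w by auto
        thus ?thesis using ball_eq_avoid[OF False] ball_sub[of "{w}" E s] by blast
      qed simp
    qed
    have "card (ball {} E (Suc s)) \<le> card (ball {} E s \<union> {w \<in> V. \<exists>u\<in>V. u \<in> ball {w} E s \<and> adj E u w})"
      by (rule card_mono[OF _ new]) (use fb in auto)
    also have "\<dots> \<le> card (ball {} E s) + card {w \<in> V. \<exists>u\<in>V. u \<in> ball {w} E s \<and> adj E u w}" by (rule card_Un_le)
    finally have "real (card (ball {} E (Suc s))) \<le> real (card (ball {} E s)) + real (card {w \<in> V. \<exists>u\<in>V. u \<in> ball {w} E s \<and> adj E u w})" by simp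
    also have "real (card {w \<in> V. \<exists>u\<in>V. u \<in> ball {w} E s \<and> adj E u w}) = (\<Sum>w\<in>{w \<in> V. \<exists>u\<in>V. u \<in> ball {w} E s \<and> adj E u w}. 1)"
      by simp
    also have "\<dots> \<le> (\<Sum>w\<in>{w \<in> V. \<exists>u\<in>V. u \<in> ball {w} E s \<and> adj E u w}. \<Sum>u\<in>V. of_bool (u \<in> ball {w} E s) * of_bool (adj E u w))"
    proof (rule sum_mono)
      fix w assume "w \<in> {w \<in> V. \<exists>u\<in>V. u \<in> ball {w} E s \<and> adj E u w}"
      then obtain u where u: "u \<in> V" "u \<in> ball {w} E s" "adj E u w" by blast
      have "(of_bool (u \<in> ball {w} E s) * of_bool (adj E u w) :: real) \<le> (\<Sum>u\<in>V. of_bool (u \<in> ball {w} E s) * of_bool (adj E u w))"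
        by (rule member_le_sum) (use u in auto)
      thus "1 \<le> (\<Sum>u\<in>V. of_bool (u \<in> ball {w} E s) * of_bool (adj E u w) :: real)" using u by simp
    qed
    also have "\<dots> \<le> (\<Sum>w\<in>V. \<Sum>u\<in>V. of_bool (u \<in> ball {w} E s) * of_bool (adj E u w))"
      by (rule sum_mono2) (auto intro!: sum_nonneg)
    finally show ?thesis by simp
  qed
  have entry: "expect ?A p (\<lambda>E. of_bool (u \<in> ball {w} E s) * of_bool (adj E u w)) \<le> p * expect ?A p (\<lambda>E. of_bool (u \<in> ball {} E s))"
    if uw: "u \<in> V" "w \<in> V" for u w
  proof (cases "u = w")
    case True
    thus ?thesis using p by (simp add: adj_def expect_indicator)
  next
    case False
    have "expect ?A p (\<lambda>E. of_bool (u \<in> ball {w} E s) * of_bool (adj E u w))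
      = expect ?A p (\<lambda>E. of_bool (u \<in> ball {w} E s)) * expect ?A p (\<lambda>E. of_bool (adj E u w))"
    proof (rule expect_indep[OF finite_pot_edges])
      show "on_edges (edges_off {w}) (\<lambda>E. of_bool (u \<in> ball {w} E s) :: real)"
        by (rule on_edges_comp[OF ball_on, where g="\<lambda>B. of_bool (u \<in> B)"])
      show "on_edges {{u, w}} (\<lambda>E. of_bool (adj E u w) :: real)" by (rule on_edgesI) (simp add: adj_def)
      show "edges_off {w} \<inter> {{u, w}} = {}" by (auto simp: edges_off_def)
    qed
    also have "expect ?A p (\<lambda>E. of_bool (adj E u w)) = p"
      using expect_single[OF finite_pot_edges pair_in_pot_edges[OF uw False] p, of of_bool] False by (simp add: adj_def)
    also have "expect ?A p (\<lambda>E. of_bool (u \<in> ball {w} E s)) \<le> expect ?A p (\<lambda>E. of_bool (u \<in> ball {} E s))"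
      by (rule expect_mono) (use ball_avoid in auto)
    finally show ?thesis using p by (simp add: mult.commute mult_right_mono)
  qed
  have cb0: "real (card (ball {} E s)) = (\<Sum>u\<in>V. of_bool (u \<in> ball {} E s))" for E
    using ball_sub[of "{}" E s] by (simp add: inf.absorb2 Collect_mem_eq)
  have "expect ?A p (\<lambda>E. real (card (ball {} E (Suc s)))) \<le> expect ?A p (\<lambda>E. real (card (ball {} E s)) + (\<Sum>w\<in>V. \<Sum>u\<in>V. of_bool (u \<in> ball {w} E s) * of_bool (adj E u w)))"
    by (intro expect_mono finite_pot_edges pt)
  also have "\<dots> = expect ?A p (\<lambda>E. real (card (ball {} E s))) + (\<Sum>w\<in>V. \<Sum>u\<in>V. expect ?A p (\<lambda>E. of_bool (u \<in> ball {w} E s) * of_bool (adj E u w)))"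
  proof -
    have "expect ?A p (\<lambda>E. \<Sum>w\<in>V. \<Sum>u\<in>V. of_bool (u \<in> ball {w} E s) * of_bool (adj E u w))
       = (\<Sum>w\<in>V. expect ?A p (\<lambda>E. \<Sum>u\<in>V. of_bool (u \<in> ball {w} E s) * of_bool (adj E u w)))"
      by (rule Bochner_Integration.integral_sum) (rule integrable_bern[OF finite_pot_edges])
    also have "\<dots> = (\<Sum>w\<in>V. \<Sum>u\<in>V. expect ?A p (\<lambda>E. of_bool (u \<in> ball {w} E s) * of_bool (adj E u w)))"
      by (intro sum.cong refl Bochner_Integration.integral_sum integrable_bern[OF finite_pot_edges])
    finally show ?thesis
      by (subst Bochner_Integration.integral_add[OF integrable_bern[OF finite_pot_edges] integrable_bern[OF finite_pot_edges]])
         (simp only:)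
  qed
  also have "\<dots> \<le> expect ?A p (\<lambda>E. real (card (ball {} E s))) + (\<Sum>w\<in>V. \<Sum>u\<in>V. p * expect ?A p (\<lambda>E. of_bool (u \<in> ball {} E s)))"
    by (intro add_left_mono sum_mono entry)
  also have "(\<Sum>w\<in>V. \<Sum>u\<in>V. p * expect ?A p (\<lambda>E. of_bool (u \<in> ball {} E s))) = d * (\<Sum>u\<in>V. expect ?A p (\<lambda>E. of_bool (u \<in> ball {} E s)))"
    by (simp add: sum_distrib_left[symmetric] d mult_ac del: expect_indicator)
  also have "(\<Sum>u\<in>V. expect ?A p (\<lambda>E. of_bool (u \<in> ball {} E s))) = expect ?A p (\<lambda>E. \<Sum>u\<in>V. of_bool (u \<in> ball {} E s))"
    by (rule Bochner_Integration.integral_sum[symmetric]) auto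
  also have "\<dots> = expect ?A p (\<lambda>E. real (card (ball {} E s)))" by (simp only: cb0)
  also have "expect ?A p (\<lambda>E. real (card (ball {} E s))) + d * expect ?A p (\<lambda>E. real (card (ball {} E s))) = (1 + d) * expect ?A p (\<lambda>E. real (card (ball {} E s)))"
    by (simp add: algebra_simps)
  also have "\<dots> \<le> (1 + d) * (1 + d) ^ s" using dpos by (intro mult_left_mono Suc.IH) auto
  finally show ?case by simp
qed simp

lemma prob_ball: "PR (\<lambda>E. real n / d < real (card (ball {} E s))) \<le> (1 + d) ^ s * d / real n"
proof -
  have n0: "0 < real n" using n1 by simp
  have "PR (\<lambda>E. real n / d < real (card (ball {} E s))) \<le> expect (pot_edges n) p (\<lambda>E. d / real n * real (card (ball {} E s)))"
  proof (rule Pr_le_expect[OF finite_pot_edges])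
    fix E
    show "of_bool (real n / d < real (card (ball {} E s))) \<le> d / real n * real (card (ball {} E s))"
      using n0 dpos by (cases "real n / d < real (card (ball {} E s))") (auto simp: field_simps)
  qed
  also have "\<dots> = d / real n * expect (pot_edges n) p (\<lambda>E. real (card (ball {} E s)))" by simp
  also have "\<dots> \<le> d / real n * (1 + d) ^ s" using n0 dpos by (intro mult_left_mono expect_ball) auto
  finally show ?thesis by (simp add: mult_ac)
qed

lemma dTV_lower:
  assumes iso: "no_isolated n E" and vb: "\<not> var_bad E" and b: "real (card (ball {} E s)) \<le> real n / d"
    and deg: "\<And>v. v \<in> V \<Longrightarrow> real (degree n E v) \<le> 6 * d" and t: "t \<le> s" and d24: "24 \<le> d"
  shows "dTV n (walk n E (dirac 1) t) (stat n E) \<ge> 1 / exp 1"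
proof -
  have n0: "0 < real n" using n1 by simp
  have v1: "1 \<in> V" using n1 by (simp add: vertices_def)
  let ?D = "\<lambda>t. ball {} E t \<union> - V"
  have "1 - (\<Sum>j\<in>?D t \<inter> V. stat n E j) \<le> dTV n (walk n E (dirac 1) t) (stat n E)"
    by (rule dTV_support[OF iso v1, of ?D]) auto
  moreover have "(\<Sum>j\<in>?D t \<inter> V. stat n E j) \<le> 1 / 2"
  proof -
    have nE: "0 < 2 * real (num_edges n E)" "real n * d / 2 \<le> 2 * real (num_edges n E)"
      using not_var_bad(2)[OF vb] n0 dpos mult_pos_pos[of "real n" d] by linarith+
    \<comment> \<open>No degree exceeds \<open>6 * d\<close> and the degrees sum to at least
      \<open>n * d / 2\<close>. The \<open>n / d\<close> vertices of the ball thus have stationary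
      mass at most \<open>12 / d\<close>, which is at most 1/2.\<close>
    have st: "stat n E j \<le> 12 / real n" if "j \<in> V" for j
    proof -
      have "stat n E j \<le> (6 * d) / (real n * d / 2)"
        unfolding stat_def using deg[OF that] nE n0 dpos by (intro frac_le) auto
      thus ?thesis using n0 dpos by simp
    qed
    have sub: "?D t \<inter> V \<subseteq> ball {} E s" using ball_mono[OF t, of "{}" E] by auto
    have fb: "finite (ball {} E s)" by (rule finite_subset[OF ball_sub]) simp
    have "(\<Sum>j\<in>?D t \<inter> V. stat n E j) \<le> (\<Sum>j\<in>?D t \<inter> V. 12 / real n)" by (intro sum_mono st) auto
    also have "\<dots> = real (card (?D t \<inter> V)) * (12 / real n)" by simp
    also have "\<dots> \<le> (real n / d) * (12 / real n)"
      using card_mono[OF fb sub] b by (intro mult_right_mono) auto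
    also have "\<dots> \<le> 1 / 2" using n0 dpos d24 by (simp add: field_simps)
    finally show ?thesis .
  qed
  ultimately show ?thesis using inverse_e_le_half by linarith
qed

section \<open>Paths of length three between two vertices\<close>

definition few_links :: "nat \<Rightarrow> nat \<Rightarrow> (nat set \<Rightarrow> bool) \<Rightarrow> bool" where
  "few_links x y E \<longleftrightarrow>
     (\<forall>v\<in>{x, y}. 19 / 20 * d \<le> real (degree n E v) \<and> real (degree n E v) \<le> 21 / 20 * d) \<and>
     (\<Sum>(a, b)\<in>(nbrs n E x - {y}) \<times> (nbrs n E y - {x}). of_bool (adj E a b)) < 209 / 250 * (p * d\<^sup>2)"

text \<open>Two common neighbours may occur in \<open>P\<close> in both orders, so an edge has
  multiplicity up to 2 and the terms are grouped by edge. At rate 1/40 the moment contributes at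
  most \<open>- 39/1600\<close> per unit of \<open>p * card P\<close>, and \<open>k / 40\<close> at
  most \<open>38/1600\<close>.\<close>

lemma pair_count_tail:
  assumes P: "finite P" "\<And>a b. (a, b) \<in> P \<Longrightarrow> a \<in> V \<and> b \<in> V \<and> a \<noteq> b" and k: "k \<le> 95 / 100 * (p * real (card P))"
  shows "PR (\<lambda>E. (\<Sum>(a, b)\<in>P. of_bool (E {a, b})) < k) \<le> exp (- (p * real (card P) / 1600))"
proof -
  let ?m = "\<lambda>(a, b). {a, b}"
  define B where "B = ?m ` P"
  define c where "c e = real (card {x \<in> P. ?m x = e})" for e
  have BA: "B \<subseteq> pot_edges n" using P(2) by (auto simp: B_def intro!: pair_in_pot_edges)
  have fB: "finite B" using P by (simp add: B_def)
  have grp: "(\<Sum>e\<in>B. c e * f e) = (\<Sum>x\<in>P. f (?m x))" for f :: "nat set \<Rightarrow> real"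
  proof -
    have "(\<Sum>x\<in>P. f (?m x)) = (\<Sum>e\<in>B. \<Sum>x\<in>{x \<in> P. ?m x = e}. f (?m x))"
      unfolding B_def by (rule sum.image_gen[OF P(1)])
    also have "\<dots> = (\<Sum>e\<in>B. c e * f e)" by (intro sum.cong refl) (simp add: c_def)
    finally show ?thesis by simp
  qed
  have c2: "c e \<le> 2" if "e \<in> B" for e
  proof -
    obtain x where x: "x \<in> P" "e = ?m x" using \<open>e \<in> B\<close> unfolding B_def by (elim imageE)
    define a where "a = fst x"
    define b where "b = snd x"
    have ab: "e = {a, b}" using x(2) by (simp add: a_def b_def case_prod_unfold)
    have "{x \<in> P. ?m x = e} \<subseteq> {(a, b), (b, a)}"
    proof
      fix z assume "z \<in> {x \<in> P. ?m x = e}"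
      hence "{fst z, snd z} = {a, b}" by (simp add: ab case_prod_unfold)
      thus "z \<in> {(a, b), (b, a)}" by (simp add: doubleton_eq_iff prod_eq_iff)
    qed
    hence "card {x \<in> P. ?m x = e} \<le> card {(a, b), (b, a)}" by (intro card_mono) auto
    also have "\<dots> \<le> 2" using card_length[of "[(a, b), (b, a)]"] by simp
    finally show ?thesis unfolding c_def by linarith
  qed
  have cP: "(\<Sum>e\<in>B. c e) = real (card P)" using grp[of "\<lambda>_. 1"] by simp
  let ?Z = "\<lambda>E. \<Sum>(a, b)\<in>P. of_bool (E {a, b}) :: real"
  have Z: "?Z E = (\<Sum>e\<in>B. c e * of_bool (E e))" for E
    using grp[of "\<lambda>e. of_bool (E e)"] by (simp add: case_prod_unfold)
  have "PR (\<lambda>E. ?Z E < k) \<le> expect (pot_edges n) p (\<lambda>E. exp (k / 40) * exp (\<Sum>e\<in>B. - (c e / 40) * of_bool (E e)))"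
  proof (rule Pr_le_expect[OF finite_pot_edges])
    fix E
    have "exp (k / 40) * exp (\<Sum>e\<in>B. - (c e / 40) * of_bool (E e)) = exp ((k - ?Z E) / 40)"
      unfolding Z exp_add[symmetric] by (simp add: sum_negf sum_divide_distrib diff_divide_distrib)
    moreover have "1 \<le> exp ((k - ?Z E) / 40)" if "?Z E < k" using that by simp
    ultimately show "of_bool (?Z E < k) \<le> exp (k / 40) * exp (\<Sum>e\<in>B. - (c e / 40) * of_bool (E e))"
      by (cases "?Z E < k") simp_all
  qed
  also have "\<dots> \<le> exp (k / 40) * exp (p * (\<Sum>e\<in>B. exp (- (c e / 40)) - 1))"
    using expect_exp_linear[OF finite_pot_edges BA p, of "\<lambda>e. - (c e / 40)"] by simp
  also have "\<dots> \<le> exp (k / 40) * exp (p * (\<Sum>e\<in>B. c e * - (39 / 1600)))"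
  proof (intro mult_left_mono iffD2[OF exp_le_cancel_iff] sum_mono)
    fix e assume e: "e \<in> B"
    have c0: "0 \<le> c e" by (simp add: c_def)
    have "exp (- (c e / 40)) \<le> 1 - c e / 40 + (c e / 40)\<^sup>2 / 2"
      by (rule exp_minus_le_quadratic) (use c0 in simp)
    moreover have "(c e / 40)\<^sup>2 / 2 \<le> c e / 1600"
      using mult_left_mono[OF c2[OF e] c0] by (simp add: power2_eq_square)
    ultimately show "exp (- (c e / 40)) - 1 \<le> c e * - (39 / 1600)" by simp
  qed (use p in auto)
  also have "(\<Sum>e\<in>B. c e * - (39 / 1600)) = - (39 / 1600) * real (card P)"
    by (simp add: sum_distrib_right[symmetric] cP sum_negf sum_divide_distrib[symmetric] sum_distrib_left[symmetric])
  also have "exp (k / 40) * exp (p * (- (39 / 1600) * real (card P))) = exp (k / 40 - 39 / 1600 * (p * real (card P)))"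
    by (simp add: exp_add[symmetric])
  also have "\<dots> \<le> exp (- (p * real (card P) / 1600))" using k by simp
  finally show ?thesis .
qed

text \<open>The edges at \<open>x\<close> and \<open>y\<close> are revealed first; leaving
  \<open>y\<close> and \<open>x\<close> out of the two neighbourhoods makes all counted edges
  independent of them. Of about \<open>(19/20 * d)^2\<close> pairs, at least
  \<open>22/25 * d^2\<close> remain after removing coincidences, and 209/250 is 95/100 of
  22/25.\<close>

lemma prob_few_links:
  assumes xy: "x \<in> V" "y \<in> V" "x \<noteq> y" and d100: "1000 \<le> d"
  shows "PR (few_links x y) \<le> exp (- (p * d\<^sup>2 / 3200))"
proof -
  define ok where "ok = (\<lambda>S::nat set. 19 / 20 * d \<le> real (card S) \<and> real (card S) \<le> 21 / 20 * d)"
  define Q where "Q = (\<lambda>(S, T) E. ok S \<and> ok T \<and> (\<Sum>(a, b)\<in>(S - {y}) \<times> (T - {x}). of_bool (adj E a b)) < 209 / 250 * (p * d\<^sup>2))"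
  have "PR (\<lambda>E. Q (nbrs n E x, nbrs n E y) E) \<le> exp (- (p * d\<^sup>2 / 3200))"
  proof (rule Pr_two_stage_le[OF finite_pot_edges, where B="star x (V - {x}) \<union> star y (V - {y})" and h="\<lambda>E. (nbrs n E x, nbrs n E y)" and Q=Q and C="\<lambda>_. edges_off {x, y}"])
    show "on_edges (star x (V - {x}) \<union> star y (V - {y})) (\<lambda>E. (nbrs n E x, nbrs n E y))"
      by (rule on_edgesI) (auto simp: nbrs_def adj_def star_def)
    show "(star x (V - {x}) \<union> star y (V - {y})) \<inter> edges_off {x, y} = {}" by (auto simp: star_def edges_off_def)
    fix E
    define S where "S = nbrs n E x"
    define T where "T = nbrs n E y"
    have ST: "finite S" "S \<subseteq> V" "x \<notin> S" "finite T" "T \<subseteq> V" "y \<notin> T" using nbrs by (auto simp: S_def T_def)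
    let ?R = "(S - {y}) \<times> (T - {x})"
    show "on_edges (edges_off {x, y}) (Q (nbrs n E x, nbrs n E y))"
    proof (rule on_edgesI)
      fix E1 E2 :: "nat set \<Rightarrow> bool" assume *: "\<And>e. e \<in> edges_off {x, y} \<Longrightarrow> E1 e = E2 e"
      have "(\<Sum>(a, b)\<in>?R. of_bool (adj E1 a b) :: real) = (\<Sum>(a, b)\<in>?R. of_bool (adj E2 a b))"
      proof (intro sum.cong refl)
        fix z assume z: "z \<in> ?R"
        obtain a b where ab: "z = (a, b)" by (cases z)
        have "E1 {a, b} = E2 {a, b}" by (rule *) (use z ab ST in \<open>auto simp: edges_off_def\<close>)
        thus "(case z of (a, b) \<Rightarrow> (of_bool (adj E1 a b) :: real)) = (case z of (a, b) \<Rightarrow> of_bool (adj E2 a b))"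
          by (simp add: ab adj_def)
      qed
      thus "Q (nbrs n E x, nbrs n E y) E1 = Q (nbrs n E x, nbrs n E y) E2"
        by (simp add: Q_def S_def T_def)
    qed
    show "PR (Q (nbrs n E x, nbrs n E y)) \<le> exp (- (p * d\<^sup>2 / 3200))"
    proof (cases "ok S \<and> ok T")
      case True
      define P where "P = {(a, b) \<in> ?R. a \<noteq> b}"
      have fP: "finite P" unfolding P_def by (rule finite_subset[of _ ?R]) (use ST in auto)
      have Sum: "(\<Sum>(a, b)\<in>?R. of_bool (adj E' a b) :: real) = (\<Sum>(a, b)\<in>P. of_bool (E' {a, b}))" for E'
        by (rule sum.mono_neutral_cong_right) (use ST in \<open>auto simp: P_def adj_def\<close>)
      have cP: "22 / 25 * d\<^sup>2 \<le> real (card P)"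
      proof -
        have "?R \<subseteq> P \<union> (\<lambda>a. (a, a)) ` S" by (auto simp: P_def)
        hence "card ?R \<le> card (P \<union> (\<lambda>a. (a, a)) ` S)" by (intro card_mono) (use fP ST in auto)
        also have "\<dots> \<le> card P + card S" using card_Un_le[of P "(\<lambda>a. (a, a)) ` S"] card_image_le[OF ST(1), of "\<lambda>a. (a, a)"] by linarith
        finally have "real (card ?R) \<le> real (card P) + real (card S)" by linarith
        moreover have "real (card ?R) = real (card (S - {y})) * real (card (T - {x}))" by (simp add: card_cartesian_product)
        moreover have "19 / 20 * d - 1 \<le> real (card (S - {y}))" "19 / 20 * d - 1 \<le> real (card (T - {x}))"
          using True ST by (auto simp: ok_def card_Diff_singleton_if of_nat_diff)
        hence "(19 / 20 * d - 1) * (19 / 20 * d - 1) \<le> real (card (S - {y})) * real (card (T - {x}))"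
          using d100 by (intro mult_mono) auto
        moreover have "1000 * d \<le> d\<^sup>2" using d100 dpos by (simp add: power2_eq_square)
        moreover have "(19 / 20 * d - 1) * (19 / 20 * d - 1) = 361 / 400 * d\<^sup>2 - 19 / 10 * d + 1"
          by (simp add: power2_eq_square algebra_simps)
        ultimately show ?thesis using True d100 unfolding ok_def by linarith
      qed
      have pP: "22 / 25 * (p * d\<^sup>2) \<le> p * real (card P)" using mult_left_mono[OF cP p(1)] by simp
      have "PR (Q (nbrs n E x, nbrs n E y)) \<le> PR (\<lambda>E'. (\<Sum>(a, b)\<in>P. of_bool (E' {a, b})) < 209 / 250 * (p * d\<^sup>2))"
        by (rule Pr_mono) (auto simp: Q_def S_def[symmetric] T_def[symmetric] Sum)
      also have "\<dots> \<le> exp (- (p * real (card P) / 1600))"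
        by (rule pair_count_tail[OF fP]) (use ST pP in \<open>auto simp: P_def\<close>)
      also have "\<dots> \<le> exp (- (p * d\<^sup>2 / 3200))"
      proof -
        have "0 \<le> p * d\<^sup>2" using p by simp
        thus ?thesis using pP by simp
      qed
      finally show ?thesis .
    next
      case False
      hence "Q (nbrs n E x, nbrs n E y) = (\<lambda>_. False)"
        unfolding Q_def S_def T_def by (simp add: fun_eq_iff) blast
      thus ?thesis by simp
    qed
  qed
  moreover have "few_links x y = (\<lambda>E. Q (nbrs n E x, nbrs n E y) E)"
    by (auto simp: few_links_def Q_def ok_def nbrs(4) fun_eq_iff)
  ultimately show ?thesis by simp
qed

lemma dense_mix:
  assumes iso: "no_isolated n E" and z: "z \<in> V" and vb: "\<not> var_bad E"
    and deg: "\<And>v. v \<in> V \<Longrightarrow> 19 / 20 * d \<le> real (degree n E v) \<and> real (degree n E v) \<le> 21 / 20 * d"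
    and links: "\<And>y. y \<in> V \<Longrightarrow> y \<noteq> z \<Longrightarrow> \<not> few_links z y E" and n200: "200 \<le> n"
  shows "dTV n (walk n E (dirac z) 3) (stat n E) \<le> 33 / 100"
proof -
  have n0: "0 < real n" using n1 by simp
  define c where "c = 20 / (21 * d)"
  have c0: "0 < c" using dpos by (simp add: c_def)
  have tr: "c * of_bool (adj E u v) \<le> trans E n u v" if uv: "u \<in> V" for u v
  proof (cases "adj E u v")
    case True
    have "0 < degree n E u" using iso uv by (simp add: no_isolated_def)
    thus ?thesis using True deg[OF uv] dpos by (simp add: trans_def c_def field_simps)
  qed (simp add: trans_def)
  have w3: "72 / 100 / real n \<le> walk n E (dirac z) 3 y" if y: "y \<in> V" "y \<noteq> z" for y
  proof -
    let ?R = "(nbrs n E z - {y}) \<times> (nbrs n E y - {z})"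
    \<comment> \<open>Each path has weight at least \<open>c^3\<close>, and
      \<open>p * d^2 = d^3 / n\<close>, so \<open>d\<close> cancels;
      \<open>(20/21)^3 * 209/250\<close> is slightly more than 0.72.\<close>
    have "72 / 100 / real n \<le> c ^ 3 * (209 / 250 * (p * d\<^sup>2))"
    proof -
      have pe: "p = d / real n" using n0 by (simp add: d)
      have "c ^ 3 * (209 / 250 * (p * d\<^sup>2)) = (8000 / 9261 * (209 / 250)) / real n"
        using n0 dpos unfolding c_def by (subst pe) (simp add: power3_eq_cube power2_eq_square field_simps)
      moreover have "72 / 100 / real n \<le> (8000 / 9261 * (209 / 250)) / real n"
        by (rule divide_right_mono) auto
      ultimately show ?thesis by simp
    qed
    also have "\<dots> \<le> c ^ 3 * (\<Sum>(a, b)\<in>?R. of_bool (adj E a b))"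
      using links[OF y] deg z y c0 by (intro mult_left_mono) (auto simp: few_links_def)
    also have "\<dots> = (\<Sum>(a, b)\<in>?R. c ^ 3 * of_bool (adj E a b))" by (simp add: sum_distrib_left case_prod_unfold)
    also have "\<dots> \<le> (\<Sum>(a, b)\<in>?R. trans E n z a * trans E n a b * trans E n b y)"
    proof (rule sum_mono)
      fix x assume "x \<in> ?R"
      then obtain a b where x: "x = (a, b)" and ab: "a \<in> nbrs n E z" "b \<in> nbrs n E y" by auto
      hence adj: "adj E z a" "adj E b y" "a \<in> V" "b \<in> V" by (auto simp: nbrs_def adj_sym)
      have "c * (c * of_bool (adj E a b)) * c \<le> trans E n z a * trans E n a b * trans E n b y"
        using tr[OF z, of a] tr[of a b] tr[of b y] adj c0 by (intro mult_mono) (auto simp: trans_nonneg)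
      thus "(case x of (a, b) \<Rightarrow> c ^ 3 * of_bool (adj E a b)) \<le> (case x of (a, b) \<Rightarrow> trans E n z a * trans E n a b * trans E n b y)"
        by (simp add: x power3_eq_cube mult_ac)
    qed
    also have "\<dots> \<le> (\<Sum>(a, b)\<in>V \<times> V. trans E n z a * trans E n a b * trans E n b y)"
      by (rule sum_mono2) (auto simp: nbrs_def trans_nonneg)
    also have "\<dots> = (\<Sum>b\<in>V. (\<Sum>a\<in>V. trans E n z a * trans E n a b) * trans E n b y)"
      by (simp add: sum.cartesian_product[symmetric] sum_distrib_right) (rule sum.swap)
    also have "\<dots> = walk n E (dirac z) 3 y"
    proof -
      have "walk n E (dirac z) (Suc (Suc 0)) b = (\<Sum>a\<in>V. trans E n z a * trans E n a b)" for b
        unfolding walk_Suc[of _ _ _ "Suc 0"] step_def walk_dirac_Suc0[OF z] ..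
      thus ?thesis unfolding numeral_3_eq_3 walk_Suc[of _ _ _ "Suc (Suc 0)"] step_def by simp
    qed
    finally show ?thesis .
  qed
  have "(\<Sum>y\<in>V. (if y = z then 0 else 72 / 100 / real n) - max 0 (1 / real n - stat n E y))
     \<le> (\<Sum>y\<in>V. min (walk n E (dirac z) 3 y) (stat n E y))"
  proof (rule sum_mono)
    fix y assume y: "y \<in> V"
    have m: "0 \<le> max 0 (1 / real n - stat n E y)" "1 / real n - stat n E y \<le> max 0 (1 / real n - stat n E y)"
      by (rule max.cobounded1, rule max.cobounded2)
    have "72 / 100 / real n \<le> 1 / real n" by (rule divide_right_mono) auto
    thus "(if y = z then 0 else 72 / 100 / real n) - max 0 (1 / real n - stat n E y)
       \<le> min (walk n E (dirac z) 3 y) (stat n E y)"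
      unfolding min.bounded_iff
      using m w3[OF y] walk_dirac_nonneg[of n E z 3 y] stat_nonneg[of n E y] by (cases "y = z"; simp; linarith)
  qed
  moreover have "(\<Sum>y\<in>V. if y = z then 0 else 72 / 100 / real n) \<ge> 716 / 1000"
  proof -
    have "(\<Sum>y\<in>V. if y = z then 0 else 72 / 100 / real n) = (\<Sum>y\<in>V - {z}. 72 / 100 / real n)"
      by (rule sum.mono_neutral_cong_right) auto
    also have "\<dots> = (real n - 1) * (72 / 100 / real n)" using z n1 by (simp add: of_nat_diff)
    also have "\<dots> = 72 / 100 - 72 / 100 / real n" using n0 by (simp add: field_simps)
    finally have "(\<Sum>y\<in>V. if y = z then 0 else 72 / 100 / real n) = 72 / 100 - 72 / 100 / real n" .
    moreover have "72 / 100 / real n \<le> 72 / 100 / 200" by (rule divide_left_mono) (use n200 in auto)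
    ultimately show ?thesis by linarith
  qed
  ultimately have "(\<Sum>y\<in>V. min (walk n E (dirac z) 3 y) (stat n E y)) \<ge> 67 / 100"
    using not_var_bad(1)[OF vb] unfolding sum_subtractf by linarith
  moreover have "dTV n (walk n E (dirac z) 3) (stat n E) \<le> 1 - (\<Sum>y\<in>V. min (walk n E (dirac z) 3 y) (stat n E y))"
    by (rule dTV_overlap[OF dirac_walk_sum[OF iso z] stat_sum[OF iso n1]])
  ultimately show ?thesis by linarith
qed

end

subsection \<open>Assembling the bounds\<close>

lemma stat_stationary:
  assumes "no_isolated n E" "j \<in> vertices n"
  shows "(\<Sum>i\<in>vertices n. stat n E i * trans E n i j) = stat n E j"
proof -
  have "(\<Sum>i\<in>vertices n. stat n E i * trans E n i j) = (\<Sum>i\<in>vertices n. of_bool (adj E j i) / (2 * real (num_edges n E)))"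
    by (intro sum.cong refl) (use assms(1) in \<open>auto simp: stat_def trans_def no_isolated_def adj_sym\<close>)
  thus ?thesis unfolding stat_def real_degree sum_divide_distrib .
qed

lemma dTV_cong:
  assumes "\<And>j. j \<in> vertices n \<Longrightarrow> p j = q j" shows "dTV n p r = dTV n q r"
proof -
  have "(\<Sum>i\<in>A. p i) = (\<Sum>i\<in>A. q i)" if "A \<in> Pow (vertices n)" for A
    using that assms by (intro sum.cong) auto
  thus ?thesis unfolding dTV_def by (simp cong: image_cong_simp)
qed

text \<open>The discrepancy on \<open>A\<close> after the step is \<open>x - stat\<close> integrated
  against \<open>g\<close>, the probability of stepping into \<open>A\<close>. As \<open>g\<close>
  lies between 0 and 1, this is between minus the negative part and the positive part of
  \<open>x - stat\<close>, and each part is the discrepancy of a set before the step.\<close>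

lemma dTV_step:
  assumes iso: "no_isolated n E" and mass: "(\<Sum>i\<in>vertices n. x i) = (\<Sum>i\<in>vertices n. stat n E i)"
  shows "dTV n (step n E x) (stat n E) \<le> dTV n x (stat n E)"
proof (rule dTV_leI)
  fix A assume A: "A \<subseteq> vertices n"
  let ?V = "vertices n"
  define y where "y i = x i - stat n E i" for i
  define g where "g i = (\<Sum>j\<in>A. trans E n i j)" for i
  define c where "c = dTV n x (stat n E)"
  have g: "0 \<le> g i" "g i \<le> 1" if "i \<in> ?V" for i
  proof -
    show "0 \<le> g i" by (simp add: g_def sum_nonneg trans_nonneg)
    have "g i \<le> (\<Sum>j\<in>?V. trans E n i j)" unfolding g_def
      by (rule sum_mono2) (use A trans_nonneg in auto)
    thus "g i \<le> 1" using trans_row_sum[of n E i] iso that by (simp add: no_isolated_def)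
  qed
  have "(\<Sum>j\<in>A. step n E x j) - (\<Sum>j\<in>A. stat n E j) = (\<Sum>j\<in>A. \<Sum>i\<in>?V. y i * trans E n i j)"
    unfolding step_def y_def sum_subtractf[symmetric]
  proof (intro sum.cong refl)
    fix j assume "j \<in> A"
    thus "(\<Sum>i\<in>?V. x i * trans E n i j) - stat n E j = (\<Sum>i\<in>?V. (x i - stat n E i) * trans E n i j)"
      using stat_stationary[OF iso, of j] A by (auto simp: left_diff_distrib sum_subtractf)
  qed
  also have "\<dots> = (\<Sum>i\<in>?V. y i * g i)" by (subst sum.swap) (simp add: g_def sum_distrib_left)
  finally have eq: "(\<Sum>j\<in>A. step n E x j) - (\<Sum>j\<in>A. stat n E j) = (\<Sum>i\<in>?V. y i * g i)" .
  have bd: "\<bar>\<Sum>i\<in>B. y i\<bar> \<le> c" if "B \<subseteq> ?V" for B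
    using dTV_ge[OF that, of x "stat n E"] by (simp add: c_def y_def sum_subtractf)
  have pos: "(\<Sum>i\<in>?V. max 0 (y i)) \<le> c" "(\<Sum>i\<in>?V. max 0 (- y i)) \<le> c"
  proof -
    have "(\<Sum>i\<in>?V. max 0 (y i)) = (\<Sum>i\<in>{i\<in>?V. 0 \<le> y i}. y i)"
      by (rule sum.mono_neutral_cong_right) (auto simp: max_def)
    thus "(\<Sum>i\<in>?V. max 0 (y i)) \<le> c" using bd[of "{i\<in>?V. 0 \<le> y i}"] by (auto simp: abs_le_iff)
    have "(\<Sum>i\<in>?V. max 0 (- y i)) = (\<Sum>i\<in>{i\<in>?V. y i \<le> 0}. - y i)"
      by (rule sum.mono_neutral_cong_right) (auto simp: max_def)
    thus "(\<Sum>i\<in>?V. max 0 (- y i)) \<le> c" using bd[of "{i\<in>?V. y i \<le> 0}"] by (auto simp: abs_le_iff sum_negf)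
  qed
  have "(\<Sum>i\<in>?V. y i * g i) \<le> (\<Sum>i\<in>?V. max 0 (y i))"
  proof (rule sum_mono)
    fix i assume i: "i \<in> ?V"
    have "y i * g i \<le> max 0 (y i) * g i" using g[OF i] by (intro mult_right_mono) auto
    also have "\<dots> \<le> max 0 (y i)" using g[OF i] by (simp add: mult_left_le)
    finally show "y i * g i \<le> max 0 (y i)" .
  qed
  moreover have "(\<Sum>i\<in>?V. - (y i * g i)) \<le> (\<Sum>i\<in>?V. max 0 (- y i))"
  proof (rule sum_mono)
    fix i assume i: "i \<in> ?V"
    have "(- y i) * g i \<le> max 0 (- y i) * g i" using g[OF i] by (intro mult_right_mono) auto
    also have "\<dots> \<le> max 0 (- y i)" using g[OF i] by (simp add: mult_left_le)
    finally show "- (y i * g i) \<le> max 0 (- y i)" by simp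
  qed
  ultimately show "\<bar>(\<Sum>j\<in>A. step n E x j) - (\<Sum>j\<in>A. stat n E j)\<bar> \<le> c"
    unfolding eq using pos by (simp add: abs_le_iff sum_negf)
qed

text \<open>Splits off the first step, whereas \<open>walk_Suc\<close> splits off the last.\<close>

lemma walk_dirac_Suc:
  assumes z: "z \<in> vertices n"
  shows "j \<in> vertices n \<Longrightarrow> walk n E (dirac z) (Suc t) j = (\<Sum>i\<in>vertices n. trans E n z i * walk n E (dirac i) t j)"
proof (induction t arbitrary: j)
  case 0
  thus ?case unfolding walk_dirac_Suc0[OF z] walk_0 by (simp add: dirac_sum)
next
  case (Suc t)
  have "walk n E (dirac z) (Suc (Suc t)) j = (\<Sum>k\<in>vertices n. (\<Sum>i\<in>vertices n. trans E n z i * walk n E (dirac i) t k) * trans E n k j)"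
    unfolding walk_Suc[of _ _ _ "Suc t"] step_def using Suc.IH by (intro sum.cong refl) simp
  also have "\<dots> = (\<Sum>i\<in>vertices n. \<Sum>k\<in>vertices n. trans E n z i * walk n E (dirac i) t k * trans E n k j)"
    by (subst sum.swap) (simp add: sum_distrib_right)
  also have "\<dots> = (\<Sum>i\<in>vertices n. trans E n z i * walk n E (dirac i) (Suc t) j)"
    by (simp add: walk_Suc step_def sum_distrib_left mult.assoc)
  finally show ?case .
qed

lemma dTV_first_step:
  assumes iso: "no_isolated n E" and z: "z \<in> vertices n" and c: "0 \<le> c"
    and nb: "\<And>i. i \<in> vertices n \<Longrightarrow> adj E z i \<Longrightarrow> dTV n (walk n E (dirac i) t) (stat n E) \<le> c"
  shows "dTV n (walk n E (dirac z) (Suc t)) (stat n E) \<le> c"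
proof -
  let ?V = "vertices n"
  let ?x = "\<lambda>i. if i \<in> ?V then trans E n z i else 0"
  \<comment> \<open>Vertices not adjacent to \<open>z\<close> have weight 0; giving them
    \<open>stat\<close> keeps the bound \<open>c\<close> valid for every \<open>i\<close>.\<close>
  let ?r = "\<lambda>i. if adj E z i then walk n E (dirac i) t else stat n E"
  have x: "is_dist n ?x"
    using trans_row_sum[of n E z] iso z by (auto simp: is_dist_def trans_nonneg no_isolated_def)
  have "dTV n (walk n E (dirac z) (Suc t)) (stat n E) = dTV n (\<lambda>j. \<Sum>i\<in>?V. ?x i * ?r i j) (stat n E)"
  proof (rule dTV_cong)
    fix j assume j: "j \<in> ?V"
    show "walk n E (dirac z) (Suc t) j = (\<Sum>i\<in>?V. ?x i * ?r i j)"
      unfolding walk_dirac_Suc[OF z j] by (intro sum.cong refl) (auto simp: trans_def)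
  qed
  also have "\<dots> \<le> c"
  proof (rule dTV_mix[OF x])
    fix i assume i: "i \<in> ?V"
    have "dTV n (stat n E) (stat n E) \<le> c" by (rule dTV_leI) (use c in simp)
    thus "dTV n (?r i) (stat n E) \<le> c" using nb[OF i] by auto
  qed
  finally show ?thesis .
qed

definition good_graph :: "nat \<Rightarrow> real \<Rightarrow> (nat set \<Rightarrow> bool) \<Rightarrow> bool" where
  "good_graph n d E \<longleftrightarrow> connected_graph n E \<and> \<not> bipartite_graph n E \<and> \<bar>Tmix n E - ln (real n) / ln d\<bar> \<le> 3"

text \<open>All requirements of the sparse case that \<open>d\<close> be large, stated in
  \<open>d\<close> alone so that they hold eventually.\<close>

definition sparse_numerics :: "real \<Rightarrow> bool" where
  "sparse_numerics d \<longleftrightarrow> 1000 \<le> d \<and> 120000 \<le> d powr (1/4) \<and> 12 \<le> ln d \<and> 2 * 10 ^ 8 \<le> d powr (3/20)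
     \<and> 100 \<le> d powr (1/5) \<and> 2000 \<le> d powr (2/5)
     \<and> 2 * 10 ^ 6 * d powr (9/4) * exp (- (d / 3200)) \<le> 1 / 10 ^ 8
     \<and> exp (- (d / 10)) * d powr (1/20) * d / 100 + d powr (- (3/20)) \<le> 1
     \<and> - (d * ln d / 200000) + 2 * d + d powr (17/20) \<le> - (3 * d)"

context gnp
begin

abbreviation "L \<equiv> ln (real n) / ln d"

lemma good_graphI:
  assumes iso: "no_isolated n E"
    and mix: "\<And>z. z \<in> V \<Longrightarrow> dTV n (walk n E (dirac z) T) (stat n E) < 1 / exp 1"
    and T: "real T \<le> L + 3"
    and low: "\<And>t. real t < L - 3 \<Longrightarrow> dTV n (walk n E (dirac 1) t) (stat n E) \<ge> 1 / exp 1"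
  shows "good_graph n d E"
  unfolding good_graph_def
  using mixing_imp_connected[OF iso n1 mix] mixing_imp_nonbipartite[OF iso n1 mix] Tmix_window[OF iso n1 mix T low] by blast

lemma third_le_inverse_e: "1 / 3 \<le> 1 / exp (1::real)"
  using exp_le by (simp add: field_simps)

definition common_bad :: "(nat set \<Rightarrow> bool) \<Rightarrow> bool" where
  "common_bad E \<longleftrightarrow> \<not> no_isolated n E \<or> (\<exists>v\<in>V. 6 * d < real (degree n E v)) \<or>
     real n * exp (- (d / 3200)) < real (card (heavy n d E)) \<or> var_bad E"

lemma prob_common_bad:
  assumes "ln (real n) \<le> d"
  shows "PR common_bad \<le> exp (2 - (d - ln (real n))) + exp (- (3 * d)) + exp (- (d / 3200)) + 80000 * (d + 1) / d\<^sup>2"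
proof -
  have n0: "0 < real n" using n1 by simp
  have "real n \<le> exp d" using assms n0 by (metis exp_ln exp_le_cancel_iff)
  hence "real n * exp (- (4 * d)) \<le> exp d * exp (- (4 * d))" by (intro mult_right_mono) auto
  also have "\<dots> = exp (- (3 * d))" by (simp add: exp_add[symmetric])
  finally have m: "real n * exp (- (4 * d)) \<le> exp (- (3 * d))" .
  show ?thesis unfolding common_bad_def
    using Pr_disj[of "pot_edges n" p "\<lambda>E. \<not> no_isolated n E" "\<lambda>E. (\<exists>v\<in>V. 6 * d < real (degree n E v)) \<or>
       real n * exp (- (d / 3200)) < real (card (heavy n d E)) \<or> var_bad E"]
      Pr_disj[of "pot_edges n" p "\<lambda>E. \<exists>v\<in>V. 6 * d < real (degree n E v)" "\<lambda>E.
       real n * exp (- (d / 3200)) < real (card (heavy n d E)) \<or> var_bad E"]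
      Pr_disj[of "pot_edges n" p "\<lambda>E. real n * exp (- (d / 3200)) < real (card (heavy n d E))" var_bad]
      prob_isolated prob_max_degree prob_heavy prob_var_bad m by linarith
qed

lemma prob_low_degree: "1000 \<le> d \<Longrightarrow> PR (\<lambda>E. \<exists>v\<in>V. real (degree n E v) < 19 / 20 * d) \<le> real n * exp (1 - d / 1600)"
proof (rule PR_vertex)
  fix v assume v: "v \<in> V" and d1000: "1000 \<le> d"
  have "PR (\<lambda>E. real (degree n E v) < 19 / 20 * d) \<le> exp ((d - p) * (exp (- (1/40)) - 1) - - (19 / 800 * d))"
    by (rule deg_tail[OF v]) simp
  also have "\<dots> \<le> exp (1 - d / 1600)"
  proof -
    have "exp (- (1/40)) - 1 \<le> (- 79 / 3200 :: real)"
      using exp_minus_le_quadratic[of "1/40"] by (simp add: power2_eq_square)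
    hence "(d - p) * (exp (- (1/40)) - 1) \<le> (d - p) * (- 79 / 3200)" using pd by (intro mult_left_mono) auto
    also have "\<dots> \<le> (d - 1) * (- 79 / 3200)" using p by (intro mult_right_mono_neg) auto
    finally have "(d - p) * (exp (- (1/40)) - 1) \<le> (d - 1) * (- 79 / 3200)" .
    moreover have "(d - 1) * (- 79 / 3200) \<le> 1 - d / 1600 - 19 / 800 * d" using d1000 by (simp add: field_simps)
    ultimately show ?thesis unfolding exp_le_cancel_iff by simp
  qed
  finally show "PR (\<lambda>E. real (degree n E v) < 19 / 20 * d) \<le> exp (1 - d / 1600)" .
qed

text \<open>Here \<open>0 \<le> L < 3\<close>: three steps lie within \<open>L + 3\<close>, and
  there is no time below \<open>L - 3\<close>.\<close>

lemma dense_prob: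
  assumes d1000: "1000 \<le> d" and nd: "ln (real n) \<le> d" and n200: "200 \<le> n" and dense: "real n \<le> d powr (5/2)"
    and h: "real n * exp (- (d / 3200)) < 1"
  shows "PR (\<lambda>E. \<not> good_graph n d E) \<le>
     exp (2 - (d - ln (real n))) + exp (- (3 * d)) + exp (- (d / 3200)) + 80000 * (d + 1) / d\<^sup>2
     + real n * exp (1 - d / 1600) + (real n)\<^sup>2 * exp (- (real n powr (1/5) / 3200))"
proof -
  have n0: "0 < real n" using n1 by simp
  have L0: "0 \<le> L" "L < 3"
  proof -
    have ld: "0 < ln d" using d1000 by simp
    show "0 \<le> L" using ld n1 by simp
    have "ln (real n) \<le> ln (d powr (5/2))" using dense n0 by (subst ln_le_cancel_iff) auto
    also have "\<dots> = 5 / 2 * ln d" using dpos by (simp add: ln_powr)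
    finally have "ln (real n) < 3 * ln d" using ld by linarith
    thus "L < 3" using ld by (simp add: field_simps)
  qed
  \<comment> \<open>The density assumption makes \<open>p * d^2 = d^3 / n\<close> at least a
    positive power of \<open>n\<close>, enough to beat the number of pairs.\<close>
  have pd3: "real n powr (1/5) \<le> p * d\<^sup>2"
  proof -
    have "real n powr (2/5) \<le> (d powr (5/2)) powr (2/5)" using dense n0 by (intro powr_mono2) auto
    also have "\<dots> = d" using dpos by (simp add: powr_powr)
    finally have "(real n powr (2/5)) ^ 3 \<le> d ^ 3" by (intro power_mono) auto
    hence "real n powr (6/5) \<le> d ^ 3" using n0 by (simp add: powr_power)
    hence "real n powr (6/5) / real n \<le> d ^ 3 / real n" by (intro divide_right_mono) auto
    moreover have "real n powr (6/5) / real n = real n powr (1/5)" using n0 powr_diff[of "real n" "6/5" 1] by simp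
    moreover have "d ^ 3 / real n = p * d\<^sup>2" using n0 by (simp add: d power3_eq_cube power2_eq_square)
    ultimately show ?thesis by simp
  qed
  have fl: "PR (\<lambda>E. \<exists>x\<in>V. \<exists>y\<in>V. x \<noteq> y \<and> few_links x y E) \<le> real n * (real n * exp (- (real n powr (1/5) / 3200)))"
  proof (intro PR_vertex)
    fix x y assume xy: "x \<in> V" "y \<in> V"
    show "PR (\<lambda>E. x \<noteq> y \<and> few_links x y E) \<le> exp (- (real n powr (1/5) / 3200))"
    proof (cases "x = y")
      case False
      have "PR (\<lambda>E. x \<noteq> y \<and> few_links x y E) \<le> exp (- (p * d\<^sup>2 / 3200))"
        using prob_few_links[OF xy False d1000] False by simp
      also have "\<dots> \<le> exp (- (real n powr (1/5) / 3200))" using pd3 by simp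
      finally show ?thesis .
    qed simp
  qed
  have "PR (\<lambda>E. \<not> good_graph n d E) \<le> PR (\<lambda>E. common_bad E \<or> (\<exists>v\<in>V. real (degree n E v) < 19 / 20 * d) \<or> (\<exists>x\<in>V. \<exists>y\<in>V. x \<noteq> y \<and> few_links x y E))"
  proof (rule Pr_mono, rule ccontr)
    fix E
    assume ng: "\<not> good_graph n d E"
      and ok: "\<not> (common_bad E \<or> (\<exists>v\<in>V. real (degree n E v) < 19 / 20 * d) \<or> (\<exists>x\<in>V. \<exists>y\<in>V. x \<noteq> y \<and> few_links x y E))"
    have iso: "no_isolated n E" and vb: "\<not> var_bad E" and hv: "real (card (heavy n d E)) \<le> real n * exp (- (d / 3200))"
      using ok by (auto simp: common_bad_def)
    \<comment> \<open>By \<open>h\<close>, the bound on the number of heavy vertices is below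
      1.\<close>
    have "card (heavy n d E) = 0" using hv h by linarith
    hence "heavy n d E = {}" by (subst (asm) card_0_eq) (auto simp: heavy_def)
    hence deg: "19 / 20 * d \<le> real (degree n E v) \<and> real (degree n E v) \<le> 21 / 20 * d" if "v \<in> V" for v
      using that ok by (force simp: heavy_def not_less)
    have "good_graph n d E"
    proof (rule good_graphI[OF iso, of 3])
      fix z assume z: "z \<in> V"
      have "dTV n (walk n E (dirac z) 3) (stat n E) \<le> 33 / 100"
        by (rule dense_mix[OF iso z vb deg _ n200]) (use ok z in auto)
      thus "dTV n (walk n E (dirac z) 3) (stat n E) < 1 / exp 1" using third_le_inverse_e by linarith
    qed (use L0 in auto)
    thus False using ng by simp
  qed
  also have "\<dots> \<le> PR common_bad + (PR (\<lambda>E. \<exists>v\<in>V. real (degree n E v) < 19 / 20 * d) + PR (\<lambda>E. \<exists>x\<in>V. \<exists>y\<in>V. x \<noteq> y \<and> few_links x y E))"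
    by (intro order_trans[OF Pr_disj] add_left_mono Pr_disj)
  finally show ?thesis
    using prob_common_bad[OF nd] prob_low_degree[OF d1000] fl by (simp add: power2_eq_square mult.assoc)
qed

section \<open>Parameters of the sparse regime\<close>

context
  assumes num: "sparse_numerics d" and nd: "ln (real n) \<le> d" and n200: "200 \<le> n" and sparse: "d powr (5/2) < real n"
begin

definition t1 :: nat where "t1 = nat \<lceil>L - 9/4\<rceil>"
definition Rm :: real where "Rm = 100 * d ^ t1"
definition M :: real where "M = 10 ^ 6 / (d - 6) ^ t1"
text \<open>The exponents satisfy \<open>9/4 - 1 < 7/5\<close>, \<open>7/5 - 1 < 3/5\<close> and
  \<open>3/5 < 1\<close>: each cap exceeds the previous squared norm divided by \<open>d\<close> by
  a power of \<open>d\<close>, and the last one is small compared with \<open>d / n\<close>.\<close>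

definition cap1 :: real where "cap1 = d powr (7/5) / real n"
definition cap2 :: real where "cap2 = d powr (3/5) / real n"
text \<open>Of order \<open>d * ln d\<close>: large enough for \<open>l1 / 100\<close> to dominate
  \<open>3 * d\<close>, small enough for \<open>exp (200 * l1 / d)\<close> to be only
  \<open>d^(1/10)\<close>.\<close>

definition l1 :: real where "l1 = d * ln d / 2000"

lemma numD: "1000 \<le> d" "120000 \<le> d powr (1/4)" "12 \<le> ln d" "2 * 10 ^ 8 \<le> d powr (3/20)"
   "100 \<le> d powr (1/5)" "2000 \<le> d powr (2/5)" "2 * 10 ^ 6 * d powr (9/4) * exp (- (d / 3200)) \<le> 1 / 10 ^ 8"
   "exp (- (d / 10)) * d powr (1/20) * d / 100 + d powr (- (3/20)) \<le> 1"
   "- (d * ln d / 200000) + 2 * d + d powr (17/20) \<le> - (3 * d)"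
  using num by (auto simp: sparse_numerics_def)

lemma L_bounds: "5 / 2 < L" "L * ln d = ln (real n)" "L \<le> d / ln d" "real t1 < L - 5/4" "L - 9/4 \<le> real t1" "1 \<le> t1"
proof -
  have n0: "0 < real n" using n1 by simp
  have ld: "0 < ln d" using numD by linarith
  have "ln (d powr (5/2)) < ln (real n)" using sparse n0 dpos by (subst ln_less_cancel_iff) auto
  hence "5 / 2 * ln d < ln (real n)" using dpos by (simp add: ln_powr)
  thus L: "5 / 2 < L" using ld by (simp add: field_simps)
  show "L * ln d = ln (real n)" using ld by simp
  show "L \<le> d / ln d" using nd ld by (intro divide_right_mono) auto
  have c: "0 < \<lceil>L - 9/4\<rceil>" unfolding zero_less_ceiling using L by linarith
  hence r: "real t1 = of_int \<lceil>L - 9/4\<rceil>" unfolding t1_def by simp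
  show "L - 9/4 \<le> real t1" unfolding r by (rule le_of_int_ceiling)
  show "real t1 < L - 5/4" unfolding r using ceiling_correct[of "L - 9/4"] by linarith
  show "1 \<le> t1" using c unfolding t1_def by linarith
qed

lemma d_t1: "d ^ t1 \<le> real n * d powr (- (5/4))" "real n * d powr (- (9/4)) \<le> d ^ t1"
proof -
  have n0: "0 < real n" using n1 by simp
  have ld: "0 < ln d" using numD by linarith
  have dt: "d ^ t1 = exp (real t1 * ln d)" using dpos by (simp add: powr_realpow[symmetric] powr_def)
  have nn: "real n * d powr a = exp ((L + a) * ln d)" for a
    using n0 dpos ld by (simp add: powr_def distrib_right exp_add)
  show "d ^ t1 \<le> real n * d powr (- (5/4))" unfolding dt nn exp_le_cancel_iff
    using L_bounds(4) ld by (intro mult_right_mono) auto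
  show "real n * d powr (- (9/4)) \<le> d ^ t1" unfolding dt nn exp_le_cancel_iff
    using L_bounds(5) ld by (intro mult_right_mono) auto
qed

text \<open>Bernoulli's inequality with \<open>t1 \<le> d / ln d\<close> and
  \<open>ln d \<ge> 12\<close>: replacing \<open>d\<close> by \<open>d - 6\<close> costs at most a
  factor 2.\<close>

lemma M_bound: "M \<le> 2 * 10 ^ 6 * d powr (9/4) / real n"
proof -
  have n0: "0 < real n" using n1 by simp
  have ld: "0 < ln d" using numD by linarith
  have "real t1 * (6 / d) \<le> (d / ln d) * (6 / d)"
    using L_bounds(3,4) dpos by (intro mult_right_mono) auto
  also have "\<dots> = 6 / ln d" using dpos by simp
  also have "\<dots> \<le> 6 / 12" using numD(3) by (intro divide_left_mono) auto
  finally have t: "real t1 * (6 / d) \<le> 1 / 2" by simp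
  have "1 - real t1 * (6 / d) \<le> (1 - 6 / d) ^ t1"
    using Bernoulli_inequality[of "- (6 / d)" t1] numD(1) by (simp add: field_simps)
  hence "1 / 2 \<le> (1 - 6 / d) ^ t1" using t by linarith
  hence "d ^ t1 * (1 / 2) \<le> d ^ t1 * (1 - 6 / d) ^ t1" using dpos by (intro mult_left_mono) auto
  also have "\<dots> = (d - 6) ^ t1" using dpos by (simp add: power_mult_distrib[symmetric] right_diff_distrib)
  finally have "real n * d powr (- (9/4)) / 2 \<le> (d - 6) ^ t1" using d_t1(2) by linarith
  hence "M \<le> 10 ^ 6 / (real n * d powr (- (9/4)) / 2)"
    unfolding M_def using n0 dpos numD(1) by (intro divide_left_mono mult_pos_pos) auto
  thus ?thesis using n0 dpos by (simp add: powr_minus field_simps)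
qed

lemma steps_locale: "final_steps n t1 p d Rm l1 M cap1 cap2 (6 * d * Rm)"
proof
  have n0: "0 < real n" using n1 by simp
  show "0 \<le> p" "p \<le> 1" "d = p * real n" using p d by auto
  show "16 \<le> d" using numD(1) by simp
  have R4: "Rm * d \<le> 100 * (real n * d powr (- (1/4)))"
  proof -
    have "Rm * d \<le> 100 * (real n * (d powr (- (5/4)) * d powr 1))"
      using mult_right_mono[OF d_t1(1), of d] dpos by (simp add: Rm_def mult.assoc)
    also have "d powr (- (5/4)) * d powr 1 = d powr (- (1/4))" by (simp only: powr_add[symmetric]) simp
    finally show ?thesis .
  qed
  have d4: "d powr (- (1/4)) \<le> 1 / 120000"
    using numD(2) dpos by (simp add: powr_minus field_simps)
  \<comment> \<open>1200 is \<open>200 * 6\<close>, as required for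
    \<open>smax = 6 * d * Rm\<close>; it is obtained as 120000 / 100.\<close>
  have R5: "Rm * d \<le> real n / 1200"
  proof -
    have "100 * (real n * d powr (- (1/4))) \<le> 100 * (real n * (1 / 120000))" by (intro mult_left_mono d4) auto
    thus ?thesis using R4 by linarith
  qed
  show "Rm * d \<le> real n" using R5 n0 by simp
  show R0: "0 \<le> Rm" using dpos by (simp add: Rm_def)
  show "0 \<le> l1" unfolding l1_def
    by (intro divide_nonneg_nonneg mult_nonneg_nonneg) (use dpos numD(3) in linarith)+
  show "1 \<le> t1" by (rule L_bounds(6))
  show "0 < cap1" "0 < cap2" using n0 dpos by (auto simp: cap1_def cap2_def)
  show "0 \<le> M" using numD(1) by (simp add: M_def)
  show "200 \<le> n" by (rule n200)
  show "M \<le> d * cap1 / 100"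
  proof -
    have "2 * 10 ^ 6 * d powr (9/4) \<le> d powr (3/20) * d powr (9/4) / 100"
      using mult_right_mono[OF numD(4), of "d powr (9/4)"] by simp
    also have "d powr (3/20) * d powr (9/4) = d * d powr (7/5)"
      using dpos powr_add[of d 1 "7/5"] by (simp add: powr_add[symmetric])
    finally have "2 * 10 ^ 6 * d powr (9/4) / real n \<le> d * d powr (7/5) / 100 / real n"
      by (rule divide_right_mono) simp
    thus ?thesis using M_bound by (simp add: cap1_def mult_ac)
  qed
  have one: "1 \<le> d" using numD(1) by simp
  show "2 \<le> real n * cap1"
  proof -
    have "d powr 1 \<le> d powr (7/5)" using one by (intro powr_mono) auto
    thus ?thesis using numD(1) n0 dpos by (simp add: cap1_def)
  qed
  show "2 \<le> real n * cap2"
  proof -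
    have "d powr (2/5) \<le> d powr (3/5)" using one by (intro powr_mono) auto
    thus ?thesis using numD(6) n0 by (simp add: cap2_def)
  qed
  show "cap1 \<le> d * cap2 / 100"
  proof -
    have "100 * d powr (7/5) \<le> d powr (1/5) * d powr (7/5)"
      using numD(5) by (intro mult_right_mono) auto
    also have "\<dots> = d * d powr (3/5)"
      using dpos powr_add[of d 1 "3/5"] by (simp add: powr_add[symmetric])
    finally have "d powr (7/5) / real n \<le> d * d powr (3/5) / 100 / real n"
      by (intro divide_right_mono) auto
    thus ?thesis by (simp add: cap1_def cap2_def mult_ac)
  qed
  show "real n * cap2 \<le> d / 2000"
  proof -
    have "2000 * d powr (3/5) \<le> d powr (2/5) * d powr (3/5)"
      using numD(6) by (intro mult_right_mono) auto
    also have "\<dots> = d" using dpos by (simp add: powr_add[symmetric])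
    finally show ?thesis using n0 by (simp add: cap2_def)
  qed
  show "200 * (6 * d * Rm) \<le> real n" using R5 by (simp add: mult_ac)
  have "Rm * 1 \<le> Rm * d" using one R0 by (intro mult_left_mono) auto
  thus "200 * Rm \<le> real n" using R5 by simp
qed

interpretation fs: final_steps n t1 p d Rm l1 M cap1 cap2 "6 * d * Rm"
  by (rule steps_locale)

text \<open>The gain \<open>l1 / 100\<close> outgrows all costs: \<open>k1\<close> is at most
  \<open>ln d / 1000 + 1\<close> per level, so at most \<open>d / ln d\<close> levels cost
  \<open>O(d)\<close>, and the term \<open>k2 * Rm\<close> for edges to waiting vertices is at most
  \<open>d^(17/20) / 2\<close>.\<close>

lemma exponent_bound: "- (l1 / 100) + fs.k1 * real t1 + fs.k2 * Rm \<le> - (3 * d)"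
proof -
  have n0: "0 < real n" using n1 by simp
  have ld: "0 < ln d" using numD by linarith
  have e2: "exp (200 * l1 / d) = d powr (1/10)" using dpos by (simp add: l1_def powr_def)
  have e1: "exp (100 * l1 / d) = d powr (1/20)" using dpos by (simp add: l1_def powr_def)
  have pR: "p * Rm \<le> 100 * d powr (- (1/4))"
  proof -
    have "p * Rm \<le> p * (100 * (real n * d powr (- (5/4))))"
      using d_t1(1) p by (intro mult_left_mono) (auto simp: Rm_def)
    also have "\<dots> = 100 * (d powr 1 * d powr (- (5/4)))" using dpos by (simp add: d)
    also have "d powr 1 * d powr (- (5/4)) = d powr (- (1/4))" by (simp only: powr_add[symmetric]) simp
    finally show ?thesis .
  qed
  have k2R: "fs.k2 * Rm \<le> d powr (17/20) / 2"
  proof -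
    have "fs.k2 * Rm = (p * Rm) * (d powr (1/10) * d powr 1 / 200)"
      using dpos by (simp add: fs.k2_def e2)
    also have "\<dots> \<le> (100 * d powr (- (1/4))) * (d powr (1/10) * d powr 1 / 200)"
      by (intro mult_right_mono pR) auto
    also have "\<dots> = (d powr (- (1/4)) * d powr (1/10) * d powr 1) / 2" by simp
    also have "d powr (- (1/4)) * d powr (1/10) * d powr 1 = d powr (17/20)" by (simp only: powr_add[symmetric]) simp
    finally show ?thesis .
  qed
  have "fs.k1 = ln d / 1000 + exp (- (d / 10)) * d powr (1/20) * d / 100 + (fs.k2 * Rm) * (2 / d)"
  proof -
    have l1d: "2 * l1 / d = ln d / 1000" using dpos by (simp add: l1_def)
    show ?thesis unfolding fs.k1_def e1 l1d by (simp add: mult_ac)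
  qed
  also have "(fs.k2 * Rm) * (2 / d) \<le> (d powr (17/20) / 2) * (2 / d)"
    using k2R dpos by (intro mult_right_mono) auto
  also have "(d powr (17/20) / 2) * (2 / d) = d powr (- (3/20))"
    using dpos powr_diff[of d "17/20" 1] by simp
  finally have k1: "fs.k1 \<le> ln d / 1000 + 1" using numD(8) by linarith
  have "fs.k1 * real t1 \<le> (ln d / 1000 + 1) * (d / ln d)"
    using k1 L_bounds(3,4) ld by (intro mult_mono) auto
  also have "\<dots> = d / 1000 + d / ln d" using ld by (simp add: distrib_right add_divide_distrib)
  also have "d / ln d \<le> d / 1" using numD(1,3) dpos by (intro divide_left_mono) auto
  finally have k1t: "fs.k1 * real t1 \<le> 2 * d" using dpos by simp
  have "0 \<le> d powr (17/20)" by simp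
  moreover have "l1 / 100 = d * ln d / 200000" by (simp add: l1_def)
  ultimately show ?thesis using k1t k2R numD(9) by linarith
qed

lemma heavy_numeric:
  "M * (real n * exp (- (d / 3200))) \<le> 1 / 10 ^ 8"
  "cap1 * (real n * exp (- (d / 3200))) \<le> 1 / 10 ^ 8"
  "cap2 * (real n * exp (- (d / 3200))) \<le> 1 / 10 ^ 8"
proof -
  have n0: "0 < real n" using n1 by simp
  have gen: "c * (real n * exp (- (d / 3200))) \<le> 1 / 10 ^ 8" if "c \<le> 2 * 10 ^ 6 * d powr (9/4) / real n" for c
  proof -
    have "c * (real n * exp (- (d / 3200))) \<le> 2 * 10 ^ 6 * d powr (9/4) / real n * (real n * exp (- (d / 3200)))"
      using that by (intro mult_right_mono) auto
    also have "\<dots> = 2 * 10 ^ 6 * d powr (9/4) * exp (- (d / 3200))" using n0 by simp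
    finally show ?thesis using numD(7) by linarith
  qed
  have pw: "d powr a / real n \<le> 2 * 10 ^ 6 * d powr (9/4) / real n" if "a \<le> 9/4" for a
  proof (rule divide_right_mono)
    have "d powr a \<le> d powr (9/4)" using that numD(1) by (intro powr_mono) auto
    hence "d powr a \<le> 1 * d powr (9/4)" by simp
    also have "\<dots> \<le> 2 * 10 ^ 6 * d powr (9/4)" by (rule mult_right_mono) auto
    finally show "d powr a \<le> 2 * 10 ^ 6 * d powr (9/4)" .
  qed simp
  show "M * (real n * exp (- (d / 3200))) \<le> 1 / 10 ^ 8" by (rule gen[OF M_bound])
  show "cap1 * (real n * exp (- (d / 3200))) \<le> 1 / 10 ^ 8" unfolding cap1_def by (intro gen pw) simp
  show "cap2 * (real n * exp (- (d / 3200))) \<le> 1 / 10 ^ 8" unfolding cap2_def by (intro gen pw) simp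
qed

text \<open>\<open>n > d^(5/2)\<close> gives \<open>d^(7/5) \<le> n^(14/25)\<close>, hence
  \<open>1 / cap1 \<ge> n^(11/25)\<close>; this survives the factor \<open>n\<close> of the union
  bound.\<close>

lemma d2_bound: "fs.\<delta>2 \<le> 4 * exp (- (real n powr (11/25) / 80000))"
proof -
  have n0: "0 < real n" "1 \<le> real n" using n1 by simp_all
  have dn: "d powr (7/5) \<le> real n powr (14/25)"
  proof -
    have "(d powr (5/2)) powr (14/25) \<le> real n powr (14/25)" using sparse by (intro powr_mono2) auto
    thus ?thesis using dpos by (simp add: powr_powr)
  qed
  have e: "exp (- (1 / (80000 * (x / real n)))) \<le> exp (- (real n powr (11/25) / 80000))"
    if x: "0 < x" "x \<le> real n powr (14/25)" for x
  proof -
    have "real n powr (11/25) * x \<le> real n powr (11/25) * real n powr (14/25)"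
      using x by (intro mult_left_mono) auto
    also have "\<dots> = real n" using n0 by (simp add: powr_add[symmetric])
    finally have "real n powr (11/25) \<le> real n / x" using x by (simp add: field_simps)
    thus ?thesis by simp
  qed
  have "exp (- (real n / 80000)) \<le> exp (- (real n powr (11/25) / 80000))"
    using powr_mono[of "11/25" 1 "real n"] n0 by simp
  moreover have "exp (- (1 / (80000 * cap1))) \<le> exp (- (real n powr (11/25) / 80000))"
    unfolding cap1_def by (rule e) (use dn dpos in auto)
  moreover have "exp (- (1 / (80000 * cap2))) \<le> exp (- (real n powr (11/25) / 80000))"
    unfolding cap2_def
  proof (rule e)
    have "d powr (3/5) \<le> d powr (7/5)" using numD(1) by (intro powr_mono) auto
    thus "d powr (3/5) \<le> real n powr (14/25)" using dn by linarith
  qed (use dpos in auto)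
  ultimately show ?thesis unfolding fs.\<delta>2_def by linarith
qed

lemma sparse_mix:
  assumes cb: "\<not> common_bad E" and la: "\<not> low_adj E" and bs: "\<And>z. z \<in> V \<Longrightarrow> \<not> fs.bad_start z E" and z: "z \<in> V"
  shows "dTV n (walk n E (dirac z) (t1 + 4)) (stat n E) \<le> 3 / 10"
proof -
  have iso: "no_isolated n E" and vb: "\<not> var_bad E" and hv: "real (card (heavy n d E)) \<le> real n * exp (- (d / 3200))"
    and deg: "\<And>v. v \<in> V \<Longrightarrow> real (degree n E v) \<le> 6 * d"
    using cb by (auto simp: common_bad_def not_less)
  have hi: "dTV n (walk n E (dirac z) (t1 + 3)) (stat n E) \<le> 3 / 10" if "z \<in> V" "d / 100 \<le> real (degree n E z)" for z
    by (rule fs.mix_from[OF iso that bs[OF that(1)] deg hv heavy_numeric order_refl not_var_bad(1)[OF vb]])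
  have s: "t1 + 4 = Suc (t1 + 3)" by simp
  show ?thesis
  proof (cases "d / 100 \<le> real (degree n E z)")
    case True
    have "dTV n (step n E (walk n E (dirac z) (t1 + 3))) (stat n E) \<le> dTV n (walk n E (dirac z) (t1 + 3)) (stat n E)"
      by (rule dTV_step[OF iso]) (simp only: dirac_walk_sum[OF iso z] stat_sum[OF iso n1])
    thus ?thesis using hi[OF z True] unfolding s walk_Suc by linarith
  next
    case False
    show ?thesis unfolding s
    proof (rule dTV_first_step[OF iso z])
      fix i assume i: "i \<in> V" "adj E z i"
      have "z \<noteq> i" using i by (auto simp: adj_def)
      hence "d / 100 \<le> real (degree n E i)" using la False i z unfolding low_adj_def by force
      thus "dTV n (walk n E (dirac i) (t1 + 3)) (stat n E) \<le> 3 / 10" by (rule hi[OF i(1)])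
    qed simp
  qed
qed

lemma sparse_prob:
  "PR (\<lambda>E. \<not> good_graph n d E) \<le>
     exp (2 - (d - ln (real n))) + exp (- (3 * d)) + exp (- (d / 3200)) + 80000 * (d + 1) / d\<^sup>2
     + d * exp (4 - 69 / 100 * d) + 3 * exp (- (2 * d)) + 3 / d\<^sup>2
     + 4 * real n * exp (- (real n powr (11/25) / 80000))"
proof -
  have n0: "0 < real n" using n1 by simp
  have ld: "0 < ln d" using numD by linarith
  have ne: "real n \<le> exp d" using nd n0 by (metis exp_ln exp_le_cancel_iff)
  \<comment> \<open>Every time below \<open>L - 3\<close> is at most \<open>s\<close>; for
    \<open>L < 3\<close> there is none, and the event below is empty.\<close>
  define s where "s = nat \<lfloor>L - 3\<rfloor>"
  have ball: "PR (\<lambda>E. 3 \<le> L \<and> real n / d < real (card (ball {} E s))) \<le> 3 / d\<^sup>2"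
  proof (cases "3 \<le> L")
    case True
    have sL: "real s \<le> L - 3" using True unfolding s_def by simp
    \<comment> \<open>As \<open>s \<le> d\<close>, the factor \<open>(1 + 1 / d)^s\<close> is at
      most \<open>exp 1\<close>, so having \<open>1 + d\<close> instead of \<open>d\<close> in the
      ball estimate costs only a constant.\<close>
    have "1 + d = d * (1 + 1 / d)" using dpos by (simp add: distrib_left)
    hence "(1 + d) ^ s = (d * (1 + 1 / d)) ^ s" by (rule arg_cong[where f="\<lambda>x. x ^ s"])
    also have "\<dots> = d ^ s * (1 + 1 / d) ^ s" by (rule power_mult_distrib)
    also have "\<dots> \<le> (real n / d ^ 3) * 3"
    proof (intro mult_mono)
      have "d ^ s = exp (real s * ln d)" using dpos by (simp add: powr_realpow[symmetric] powr_def)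
      also have "\<dots> \<le> exp ((L - 3) * ln d)" using sL ld by simp
      also have "\<dots> = real n / d ^ 3"
      proof -
        have "(L - 3) * ln d = ln (real n) - 3 * ln d" using ld by (simp add: left_diff_distrib)
        moreover have "3 * ln d = ln (d ^ 3)" using dpos by (simp add: ln_realpow)
        ultimately show ?thesis using n0 dpos by (simp add: exp_diff)
      qed
      finally show "d ^ s \<le> real n / d ^ 3" .
      have "(1 + 1 / d) ^ s \<le> exp (1 / d) ^ s" using dpos by (intro power_mono exp_ge_add_one_self) auto
      also have "\<dots> = exp (real s / d)" by (simp add: exp_of_nat_mult[symmetric])
      also have "\<dots> \<le> exp 1"
      proof -
        have "d / ln d \<le> d / 1" using numD(1,3) dpos by (intro divide_left_mono) auto
        hence "real s \<le> d" using sL L_bounds(3) by linarith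
        thus ?thesis using dpos by simp
      qed
      also have "\<dots> \<le> 3" by (rule exp_le)
      finally show "(1 + 1 / d) ^ s \<le> 3" .
    qed (use dpos in auto)
    finally have "(1 + d) ^ s * (d / real n) \<le> real n / d ^ 3 * 3 * (d / real n)"
      using dpos by (intro mult_right_mono) auto
    also have "\<dots> = 3 / d\<^sup>2" using n0 dpos by (simp add: power2_eq_square power3_eq_cube)
    finally show ?thesis using prob_ball[of s] True by simp
  next
    case False thus ?thesis by simp
  qed
  have la: "PR low_adj \<le> d * exp (4 - 69 / 100 * d)"
  proof -
    have "real n * d * exp (4 - 169 / 100 * d) \<le> exp d * d * exp (4 - 169 / 100 * d)"
      using ne dpos by (intro mult_right_mono) auto
    also have "\<dots> = d * (exp d * exp (4 - 169 / 100 * d))" by simp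
    also have "\<dots> = d * exp (4 - 69 / 100 * d)" by (simp add: exp_add[symmetric])
    finally show ?thesis using prob_low_adj by linarith
  qed
  have bs: "PR (\<lambda>E. \<exists>z\<in>V. fs.bad_start z E) \<le> 3 * exp (- (2 * d)) + 4 * real n * exp (- (real n powr (11/25) / 80000))"
  proof -
    have "PR (\<lambda>E. \<exists>z\<in>V. fs.bad_start z E) \<le> real n * (3 * exp (- (3 * d)) + fs.\<delta>2)"
    proof (rule PR_vertex)
      fix z assume z: "z \<in> V"
      show "PR (fs.bad_start z) \<le> 3 * exp (- (3 * d)) + fs.\<delta>2"
        by (rule fs.bad_start_prob[OF z _ _ exponent_bound]) (use numD(1) in \<open>auto simp: M_def Rm_def\<close>)
    qed
    also have "\<dots> \<le> real n * (3 * exp (- (3 * d)) + 4 * exp (- (real n powr (11/25) / 80000)))"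
      using d2_bound n0 by (intro mult_left_mono) auto
    also have "\<dots> = 3 * (real n * exp (- (3 * d))) + 4 * real n * exp (- (real n powr (11/25) / 80000))"
      by (simp add: algebra_simps)
    also have "real n * exp (- (3 * d)) \<le> exp d * exp (- (3 * d))" using ne by (intro mult_right_mono) auto
    also have "exp d * exp (- (3 * d)) = exp (- (2 * d))" by (simp add: exp_add[symmetric])
    finally show ?thesis by simp
  qed
  have "PR (\<lambda>E. \<not> good_graph n d E) \<le> PR (\<lambda>E. common_bad E \<or> low_adj E \<or> (\<exists>z\<in>V. fs.bad_start z E) \<or> (3 \<le> L \<and> real n / d < real (card (ball {} E s))))"
  proof (rule Pr_mono, rule ccontr)
    fix E
    assume ng: "\<not> good_graph n d E"
      and ok: "\<not> (common_bad E \<or> low_adj E \<or> (\<exists>z\<in>V. fs.bad_start z E) \<or> (3 \<le> L \<and> real n / d < real (card (ball {} E s))))"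
    have iso: "no_isolated n E" and vb: "\<not> var_bad E" and deg: "\<And>v. v \<in> V \<Longrightarrow> real (degree n E v) \<le> 6 * d"
      using ok by (auto simp: common_bad_def not_less)
    have "good_graph n d E"
    proof (rule good_graphI[OF iso, of "t1 + 4"])
      fix z assume z: "z \<in> V"
      have "dTV n (walk n E (dirac z) (t1 + 4)) (stat n E) \<le> 3 / 10"
        by (rule sparse_mix) (use ok z in auto)
      thus "dTV n (walk n E (dirac z) (t1 + 4)) (stat n E) < 1 / exp 1" using third_le_inverse_e by linarith
    next
      show "real (t1 + 4) \<le> L + 3" using L_bounds(4) by simp
    next
      fix t :: nat assume t: "real t < L - 3"
      hence L3: "3 \<le> L" by (smt (verit) of_nat_0_le_iff)
      have ts: "t \<le> s" using t unfolding s_def by linarith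
      show "dTV n (walk n E (dirac 1) t) (stat n E) \<ge> 1 / exp 1"
        by (rule dTV_lower[OF iso vb _ deg ts]) (use ok L3 numD(1) in \<open>auto simp: not_less\<close>)
    qed
    thus False using ng by simp
  qed
  also have "\<dots> \<le> PR common_bad + (PR low_adj + (PR (\<lambda>E. \<exists>z\<in>V. fs.bad_start z E) + PR (\<lambda>E. 3 \<le> L \<and> real n / d < real (card (ball {} E s)))))"
    by (intro order_trans[OF Pr_disj] add_left_mono order_trans[OF Pr_disj] Pr_disj)
  finally show ?thesis using prob_common_bad[OF nd] la bs ball by linarith
qed

end

end

section \<open>Error terms and passage to the limit\<close>

definition err_d :: "real \<Rightarrow> real" where
  "err_d d = exp (- (3 * d)) + exp (- (d / 3200)) + 80000 * (d + 1) / d\<^sup>2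
     + d * exp (4 - 69 / 100 * d) + 3 * exp (- (2 * d)) + 3 / d\<^sup>2"

definition err_n :: "real \<Rightarrow> real" where
  "err_n x = x * exp (1 - x powr (2/5) / 1600) + x\<^sup>2 * exp (- (x powr (1/5) / 3200))
     + 4 * x * exp (- (x powr (11/25) / 80000))"

lemma err_d_tendsto: "(err_d \<longlongrightarrow> 0) at_top"
  unfolding err_d_def by real_asymp

lemma err_n_tendsto: "(err_n \<longlongrightarrow> 0) at_top"
  unfolding err_n_def by real_asymp

lemma eventually_sparse_numerics: "eventually sparse_numerics at_top"
proof -
  have "eventually (\<lambda>d::real. 1000 \<le> d) at_top" "eventually (\<lambda>d::real. 120000 \<le> d powr (1/4)) at_top"
    "eventually (\<lambda>d::real. 12 \<le> ln d) at_top" "eventually (\<lambda>d::real. 2 * 10 ^ 8 \<le> d powr (3/20)) at_top"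
    "eventually (\<lambda>d::real. 100 \<le> d powr (1/5)) at_top" "eventually (\<lambda>d::real. 2000 \<le> d powr (2/5)) at_top"
    "eventually (\<lambda>d::real. 2 * 10 ^ 6 * d powr (9/4) * exp (- (d / 3200)) \<le> 1 / 10 ^ 8) at_top"
    "eventually (\<lambda>d::real. exp (- (d / 10)) * d powr (1/20) * d / 100 + d powr (- (3/20)) \<le> 1) at_top"
    "eventually (\<lambda>d::real. - (d * ln d / 200000) + 2 * d + d powr (17/20) \<le> - (3 * d)) at_top"
    by real_asymp+
  hence "eventually (\<lambda>d::real. 1000 \<le> d \<and> 120000 \<le> d powr (1/4) \<and> 12 \<le> ln d \<and> 2 * 10 ^ 8 \<le> d powr (3/20)
     \<and> 100 \<le> d powr (1/5) \<and> 2000 \<le> d powr (2/5)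
     \<and> 2 * 10 ^ 6 * d powr (9/4) * exp (- (d / 3200)) \<le> 1 / 10 ^ 8
     \<and> exp (- (d / 10)) * d powr (1/20) * d / 100 + d powr (- (3/20)) \<le> 1
     \<and> - (d * ln d / 200000) + 2 * d + d powr (17/20) \<le> - (3 * d)) at_top"
    by eventually_elim blast
  thus ?thesis
    unfolding sparse_numerics_def .
qed

text \<open>Joins the two regimes. One sum of a function of \<open>d\<close> and a function of
  \<open>n\<close> covers both, so the limits can be taken separately; only the first term depends
  on \<open>d - ln n\<close>.\<close>

lemma prob_not_good_graph:
  fixes n :: nat and p :: real
  assumes p: "0 \<le> p" "p \<le> 1" and num: "sparse_numerics (p * real n)" "1000 \<le> p * real n"
    and nd: "ln (real n) \<le> p * real n" and n: "200 \<le> n" "real n * exp (- (real n powr (2/5) / 3200)) < 1"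
  shows "Pr (pot_edges n) p (\<lambda>E. \<not> good_graph n (p * real n) E)
     \<le> exp (2 - (p * real n - ln (real n))) + err_d (p * real n) + err_n (real n)"
proof -
  define d where "d = p * real n"
  have d1000: "1000 \<le> d" using num(2) by (simp add: d_def)
  have n0: "0 < real n" using n by simp
  interpret gnp n p d by unfold_locales (use p d1000 n in \<open>auto simp: d_def\<close>)
  have nn: "0 \<le> d * exp (4 - 69 / 100 * d)" "0 \<le> 3 * exp (- (2 * d))" "0 \<le> 3 / d\<^sup>2"
    "0 \<le> real n * exp (1 - real n powr (2/5) / 1600)" "0 \<le> (real n)\<^sup>2 * exp (- (real n powr (1/5) / 3200))"
    "0 \<le> 4 * real n * exp (- (real n powr (11/25) / 80000))"
    using d1000 by simp_all
  have "PR (\<lambda>E. \<not> good_graph n d E) \<le> exp (2 - (d - ln (real n))) + err_d d + err_n (real n)"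
  proof (cases "real n \<le> d powr (5/2)")
    case True
    \<comment> \<open>In the dense regime \<open>d \<ge> n^(2/5)\<close> turns the terms that mix
      \<open>n\<close> and \<open>d\<close> into functions of \<open>n\<close> alone.\<close>
    have "real n powr (2/5) \<le> (d powr (5/2)) powr (2/5)" using True by (intro powr_mono2) auto
    hence nd': "real n powr (2/5) \<le> d" using d1000 by (simp add: powr_powr)
    have "real n * exp (- (d / 3200)) \<le> real n * exp (- (real n powr (2/5) / 3200))"
      using nd' by (intro mult_left_mono) auto
    hence h: "real n * exp (- (d / 3200)) < 1" using n(2) by linarith
    have "real n * exp (1 - d / 1600) \<le> real n * exp (1 - real n powr (2/5) / 1600)"
      using nd' by (intro mult_left_mono) auto
    thus ?thesis
      using dense_prob[OF d1000 nd[folded d_def] n(1) True h] nn unfolding err_d_def err_n_def by linarith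
  next
    case False
    thus ?thesis
      using sparse_prob[OF num(1)[folded d_def] nd[folded d_def] n(1)] nn unfolding err_d_def err_n_def by linarith
  qed
  thus ?thesis by (simp add: d_def)
qed

theorem theorem1:
  fixes p :: "nat \<Rightarrow> real"
  assumes "\<And>n. 0 \<le> p n \<and> p n \<le> 1"
    and "filterlim (\<lambda>n. p n * real n - ln (real n)) at_top at_top"
  shows "(\<lambda>n. measure_pmf.prob (Gnp n (p n))
            {E. connected_graph n E \<and> \<not> bipartite_graph n E \<and>
                \<bar>Tmix n E - ln (real n) / ln (p n * real n)\<bar> \<le> 3})
         \<longlonglongrightarrow> 1"
proof -
  define d where "d n = p n * real n" for n
  define B where "B n = exp (2 - (d n - ln (real n))) + err_d (d n) + err_n (real n)" for n
  have om: "filterlim (\<lambda>n. d n - ln (real n)) at_top at_top" using assms(2) by (simp add: d_def)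
  have dinf: "filterlim d at_top at_top"
    by (rule filterlim_at_top_mono[OF om]) (use eventually_ge_at_top[of 1] in eventually_elim, simp)
  have "((\<lambda>x::real. exp (2 - x)) \<longlongrightarrow> 0) at_top" by real_asymp
  hence "(\<lambda>n. exp (2 - (d n - ln (real n)))) \<longlonglongrightarrow> 0" using om by (rule filterlim_compose)
  moreover have "(\<lambda>n. err_d (d n)) \<longlonglongrightarrow> 0" using err_d_tendsto dinf by (rule filterlim_compose)
  moreover have "(\<lambda>n. err_n (real n)) \<longlonglongrightarrow> 0" using err_n_tendsto filterlim_real_sequentially by (rule filterlim_compose)
  ultimately have "B \<longlonglongrightarrow> 0 + 0 + 0" unfolding B_def by (intro tendsto_add)
  hence "(\<lambda>n. 1 - B n) \<longlonglongrightarrow> 1 - (0 + 0 + 0)" by (intro tendsto_diff tendsto_const)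
  hence B: "(\<lambda>n. 1 - B n) \<longlonglongrightarrow> 1" by simp
  have "eventually (\<lambda>x::real. x * exp (- (x powr (2/5) / 3200)) < 1) at_top" by real_asymp
  hence e1: "eventually (\<lambda>n. real n * exp (- (real n powr (2/5) / 3200)) < 1) sequentially"
    using filterlim_real_sequentially by (rule eventually_compose_filterlim)
  have e2: "eventually (\<lambda>n. sparse_numerics (d n)) sequentially"
    by (rule eventually_compose_filterlim[OF eventually_sparse_numerics dinf])
  have e3: "eventually (\<lambda>n. 1000 \<le> d n) sequentially" using dinf by (rule filterlim_at_top[THEN iffD1, rule_format])
  have e4: "eventually (\<lambda>n. 0 \<le> d n - ln (real n)) sequentially" using om by (rule filterlim_at_top[THEN iffD1, rule_format])
  show ?thesis
  proof (rule tendsto_sandwich[OF _ _ B tendsto_const])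
    show "eventually (\<lambda>n. 1 - B n \<le> measure_pmf.prob (Gnp n (p n))
            {E. connected_graph n E \<and> \<not> bipartite_graph n E \<and>
                \<bar>Tmix n E - ln (real n) / ln (p n * real n)\<bar> \<le> 3}) sequentially"
      using e1 e2 e3 e4 eventually_ge_at_top[of 200]
    proof eventually_elim
      case (elim n)
      have "Pr (pot_edges n) (p n) (\<lambda>E. \<not> good_graph n (d n) E) \<le> B n"
        unfolding B_def d_def
        by (rule prob_not_good_graph) (use assms(1) elim in \<open>auto simp: d_def\<close>)
      moreover have "measure_pmf.prob (bern (pot_edges n) (p n)) {E. good_graph n (d n) E}
          = 1 - Pr (pot_edges n) (p n) (\<lambda>E. \<not> good_graph n (d n) E)"
      proof -
        have "{E. good_graph n (d n) E} = space (measure_pmf (bern (pot_edges n) (p n))) - {E. \<not> good_graph n (d n) E}" by auto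
        thus ?thesis using measure_pmf.prob_compl[of "{E. \<not> good_graph n (d n) E}" "bern (pot_edges n) (p n)"] by simp
      qed
      ultimately have "1 - B n \<le> measure_pmf.prob (bern (pot_edges n) (p n)) {E. good_graph n (d n) E}" by linarith
      thus ?case by (simp add: Gnp_bern good_graph_def d_def)
    qed
  qed (simp add: always_eventually)
qed

end
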